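(* \textsc{Generalized Rainbow Matching} restricted to strictly CM-colored edge-colored graphs admits a polynomial-time algorithm.
   Context: An edge-colored graph $G=(V,E;c)$ consists of an undirected loopless graph $(V,E)$, possibly with parallel edges, and a map $c:E\to\{1,\dots,k\}$. For a color $i$, the color class $G_i$ is the subgraph whose edges are the edges of color $i$ and whose vertices are those incident to such edges. A graph is complete multipartite (CM) if its vertex set can be partitioned into parts, each inducing an independent set, such that any two vertices in different parts are adjacent. An edge-colored graph is strictly CM-colored if every color class is CM. \textsc{Generalized Rainbow Matching}: given an edge-colored graph $G$, an integer $m_i\ge 1$ for each color $i$ (part of the input), and an integer $p$, decide whether $G$ has a matching (set of pairwise vertex-disjoint edges) of size at least $p$ containing at most $m_i$ edges of color $i$ for every color $i$. *)

theory Defs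
  imports
    "HOL-Computational_Algebra.Polynomial"
    "HOL-Library.Disjoint_Sets"
    "HOL-Library.Discrete_Functions"
begin

section \<open>Edge-colored multigraphs\<close>

text \<open>Edges are abstract objects with a set of end points, so parallel edges (of the same or of
  different colors) are possible. The colors are \<open>1, \<dots>, ncolors G\<close>.\<close>

record ('v, 'e) ecgraph =
  verts :: "'v set"
  edges :: "'e set"
  ends :: "'e \<Rightarrow> 'v set"
  col :: "'e \<Rightarrow> nat"
  ncolors :: nat

definition wf_ecgraph :: "('v, 'e) ecgraph \<Rightarrow> bool" where
  "wf_ecgraph G \<longleftrightarrow> finite (verts G) \<and> finite (edges G) \<and>
     (\<forall>e\<in>edges G. ends G e \<subseteq> verts G \<and> card (ends G e) = 2 \<and> col G e \<in> {1..ncolors G})"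

definition adjacent :: "('v, 'e) ecgraph \<Rightarrow> 'v \<Rightarrow> 'v \<Rightarrow> bool" where
  "adjacent G u v \<longleftrightarrow> (\<exists>e\<in>edges G. ends G e = {u, v})"

definition color_class :: "('v, 'e) ecgraph \<Rightarrow> nat \<Rightarrow> ('v, 'e) ecgraph" where
  "color_class G i =
     G\<lparr>verts := (\<Union>e\<in>{e\<in>edges G. col G e = i}. ends G e), edges := {e\<in>edges G. col G e = i}\<rparr>"

definition complete_multipartite :: "('v, 'e) ecgraph \<Rightarrow> bool" where
  "complete_multipartite G \<longleftrightarrow> (\<exists>P. partition_on (verts G) P \<and>
     (\<forall>A\<in>P. \<forall>u\<in>A. \<forall>v\<in>A. \<not> adjacent G u v) \<and>
     (\<forall>A\<in>P. \<forall>B\<in>P. A \<noteq> B \<longrightarrow> (\<forall>u\<in>A. \<forall>v\<in>B. adjacent G u v)))"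

definition strictly_CM_colored :: "('v, 'e) ecgraph \<Rightarrow> bool" where
  "strictly_CM_colored G \<longleftrightarrow> (\<forall>i\<in>{1..ncolors G}. complete_multipartite (color_class G i))"

definition matching :: "('v, 'e) ecgraph \<Rightarrow> 'e set \<Rightarrow> bool" where
  "matching G M \<longleftrightarrow> M \<subseteq> edges G \<and> disjoint_family_on (ends G) M"

definition has_generalized_rainbow_matching ::
    "('v, 'e) ecgraph \<Rightarrow> (nat \<Rightarrow> nat) \<Rightarrow> int \<Rightarrow> bool" where
  "has_generalized_rainbow_matching G m p \<longleftrightarrow>
     (\<exists>M. matching G M \<and> p \<le> int (card M) \<and>
          (\<forall>i\<in>{1..ncolors G}. card {e\<in>M. col G e = i} \<le> m i))"


section \<open>Instances and their encoding\<close>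

text \<open>An instance has the vertices \<open>0, \<dots>, nverts I - 1\<close>; its edge number \<open>j\<close> is given by the
  triple \<open>edge_list I ! j\<close> of two end points and a color; color \<open>i\<close> has the bound
  \<open>bounds I ! (i - 1)\<close>, and the number of colors is the number of bounds.\<close>

record grm_instance =
  nverts :: nat
  edge_list :: "(nat \<times> nat \<times> nat) list"
  bounds :: "nat list"
  target :: int

definition graph_of :: "grm_instance \<Rightarrow> (nat, nat) ecgraph" where
  "graph_of I =
     \<lparr>verts = {..<nverts I},
      edges = {..<length (edge_list I)},
      ends = (\<lambda>j. case edge_list I ! j of (u, v, _) \<Rightarrow> {u, v}),
      col = (\<lambda>j. case edge_list I ! j of (_, _, i) \<Rightarrow> i),
      ncolors = length (bounds I)\<rparr>"

definition bound_of :: "grm_instance \<Rightarrow> nat \<Rightarrow> nat" where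
  "bound_of I i = bounds I ! (i - 1)"

definition grm_instances :: "grm_instance set" where
  "grm_instances = {I. wf_ecgraph (graph_of I) \<and> (\<forall>i\<in>{1..ncolors (graph_of I)}. 1 \<le> bound_of I i)}"

definition grm_yes :: "grm_instance \<Rightarrow> bool" where
  "grm_yes I \<longleftrightarrow> has_generalized_rainbow_matching (graph_of I) (bound_of I) (target I)"

text \<open>The vertices are listed one by one, so that the input is at least as long as the number of
  vertices, whereas the bounds and the target are single words and thus written in binary. The
  target is given by a sign word and its absolute value.\<close>

definition encode :: "grm_instance \<Rightarrow> nat list" where
  "encode I =
     [nverts I, length (edge_list I), length (bounds I),
      (if target I < 0 then 1 else 0), nat \<bar>target I\<bar>]
     @ [0..<nverts I]
     @ bounds I
     @ concat (map (\<lambda>(u, v, i). [u, v, i]) (edge_list I))"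


section \<open>Polynomial time on a random access machine\<close>

text \<open>Structured programs for a random access machine. The memory consists of finitely many arrays
  per program, each of them a sequence of registers holding natural numbers; a scalar variable is
  register 0 of an array. All addresses may be computed. Every command and every test takes one
  step. The arithmetic consists of addition and truncated subtraction only: as there is no
  multiplication, the bit length of the contents of the registers grows by at most a constant
  (depending on the program) in each step, so that the number of steps is polynomially related to
  logarithmic cost and to Turing machine time.\<close>

type_synonym state = "string \<Rightarrow> nat \<Rightarrow> nat"

datatype aexp =
    Const nat
  | Read string aexp
  | Plus aexp aexp
  | Minus aexp aexp

datatype bexp =
    Less aexp aexp
  | Not bexp
  | And bexp bexp

datatype com =
    Skip
  | Assign string aexp aexp
  | Seq com com
  | Cond bexp com com
  | While bexp com

fun aval :: "aexp \<Rightarrow> state \<Rightarrow> nat" where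
  "aval (Const n) s = n"
| "aval (Read x a) s = s x (aval a s)"
| "aval (Plus a b) s = aval a s + aval b s"
| "aval (Minus a b) s = aval a s - aval b s"

fun bval :: "bexp \<Rightarrow> state \<Rightarrow> bool" where
  "bval (Less a b) s \<longleftrightarrow> aval a s < aval b s"
| "bval (Not b) s \<longleftrightarrow> \<not> bval b s"
| "bval (And b c) s \<longleftrightarrow> bval b s \<and> bval c s"

text \<open>\<open>exec c s t s'\<close>: started in \<open>s\<close>, the program \<open>c\<close> halts after exactly \<open>t\<close> steps in \<open>s'\<close>.\<close>

inductive exec :: "com \<Rightarrow> state \<Rightarrow> nat \<Rightarrow> state \<Rightarrow> bool" where
  exec_Skip: "exec Skip s 1 s"
| exec_Assign: "exec (Assign x a e) s 1 (s(x := (s x)(aval a s := aval e s)))"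
| exec_Seq: "exec c s t s' \<Longrightarrow> exec d s' u s'' \<Longrightarrow> exec (Seq c d) s (t + u) s''"
| exec_CondTrue: "bval b s \<Longrightarrow> exec c s t s' \<Longrightarrow> exec (Cond b c d) s (1 + t) s'"
| exec_CondFalse: "\<not> bval b s \<Longrightarrow> exec d s t s' \<Longrightarrow> exec (Cond b c d) s (1 + t) s'"
| exec_WhileFalse: "\<not> bval b s \<Longrightarrow> exec (While b c) s 1 s"
| exec_WhileTrue: "bval b s \<Longrightarrow> exec c s t s' \<Longrightarrow> exec (While b c) s' u s'' \<Longrightarrow>
    exec (While b c) s (1 + t + u) s''"

inductive_cases exec_SkipE: "exec Skip s t s'"
inductive_cases exec_AssignE: "exec (Assign x a e) s t s'"
inductive_cases exec_SeqE: "exec (Seq c d) s t s'"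
inductive_cases exec_CondE: "exec (Cond b c d) s t s'"
inductive_cases exec_WhileE: "exec (While b c) s t s'"

lemma exec_deterministic:
  "exec c s t s' \<Longrightarrow> exec c s u s'' \<Longrightarrow> u = t \<and> s'' = s'"
proof (induction arbitrary: u s'' rule: exec.induct)
  case (exec_Skip s)
  then show ?case by (rule exec_SkipE) simp
next
  case (exec_Assign x a e s)
  then show ?case by (rule exec_AssignE) simp
next
  case (exec_Seq c s t s' d v r)
  from exec_Seq.prems obtain t' r' v' where
    *: "u = t' + v'" "exec c s t' r'" "exec d r' v' s''" by (rule exec_SeqE)
  from exec_Seq.IH(1)[OF *(2)] exec_Seq.IH(2)[of v' s''] * show ?case by simp
next
  case (exec_CondTrue b s c t s' d)
  from exec_CondTrue.prems exec_CondTrue.hyps(1) obtain t' where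
    *: "u = 1 + t'" "exec c s t' s''" by (elim exec_CondE) simp_all
  from exec_CondTrue.IH[OF *(2)] * show ?case by simp
next
  case (exec_CondFalse b s d t s' c)
  from exec_CondFalse.prems exec_CondFalse.hyps(1) obtain t' where
    *: "u = 1 + t'" "exec d s t' s''" by (elim exec_CondE) simp_all
  from exec_CondFalse.IH[OF *(2)] * show ?case by simp
next
  case (exec_WhileFalse b s c)
  from exec_WhileFalse.prems show ?case
    by (rule exec_WhileE) (use exec_WhileFalse.hyps in simp_all)
next
  case (exec_WhileTrue b s c t s' v r)
  from exec_WhileTrue.prems obtain t' r' v' where
    *: "u = 1 + t' + v'" "exec c s t' r'" "exec (While b c) r' v' s''"
    by (rule exec_WhileE) (use exec_WhileTrue.hyps(1) in simp_all)
  from exec_WhileTrue.IH(1)[OF *(2)] exec_WhileTrue.IH(2)[of v' s''] * show ?case by simp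
qed

definition init_state :: "nat list \<Rightarrow> state" where
  "init_state w = (\<lambda>x i.
     if x = ''input'' \<and> i < length w then w ! i
     else if x = ''length'' \<and> i = 0 then length w
     else 0)"

definition accepting :: "state \<Rightarrow> bool" where
  "accepting s \<longleftrightarrow> s ''output'' 0 \<noteq> 0"

text \<open>The number of bits of the input; \<open>floor_log n + 1\<close> is the length of \<open>n\<close> in binary.\<close>

definition input_size :: "nat list \<Rightarrow> nat" where
  "input_size w = (\<Sum>n\<leftarrow>w. floor_log n + 1)"

text \<open>Some program answers the question \<open>Q\<close> correctly and in polynomial time on (the encodings
  of) all instances from \<open>D\<close>. Its behaviour on other inputs is irrelevant.\<close>

definition poly_time_decidable_on :: "('a \<Rightarrow> nat list) \<Rightarrow> 'a set \<Rightarrow> ('a \<Rightarrow> bool) \<Rightarrow> bool" where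
  "poly_time_decidable_on enc D Q \<longleftrightarrow>
     (\<exists>c (q :: nat poly). \<forall>I\<in>D. \<exists>t s.
        exec c (init_state (enc I)) t s \<and>
        t \<le> poly q (input_size (enc I)) \<and>
        (accepting s \<longleftrightarrow> Q I))"

end

theory Submission
  imports Defs
begin

text \<open>Reduction to perfect matching: for every color \<open>i\<close> and every slot \<open>k < min (m i) n\<close> there is a
  gadget with hubs \<open>A\<close>, \<open>B\<close> joined by an edge and, for every part of the color class, a path
  \<open>Port - Gate\<close> whose gate is adjacent to both hubs and whose port is adjacent to all vertices of the
  part. A perfect matching of the gadget either uses the edge \<open>A - B\<close> and no original vertex, or leads
  \<open>A\<close> and \<open>B\<close> through two different parts to two original vertices, which are adjacent in color \<open>i\<close>
  because the class is complete multipartite. Joining \<open>n - 2 p\<close> dummies to all original vertices, perfect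
  matchings correspond to rainbow matchings of size \<open>p\<close>.

  Perfect matchings are found by a variant of Edmonds' algorithm that needs neither a root nor explicit
  shrinking: for every outer vertex \<open>z\<close> it stores a matching \<open>F z\<close> that misses \<open>z\<close>. The blocks
  (blossoms) and the inner vertices form an unrooted tree in which every inner vertex has degree two, and
  \<open>F z\<close> matches every inner vertex away from \<open>z\<close>. An edge between outer vertices \<open>x\<close>, \<open>y\<close> of different
  blocks makes those inner vertices \<open>t\<close> outer that \<open>F x\<close> and \<open>F y\<close> match into different blocks: the new
  matching \<open>F t\<close> is \<open>F x\<close> on the side of \<open>t\<close> containing \<open>x\<close>, \<open>F y\<close> on the other side, and the edge
  \<open>x y\<close>. If no step applies, the inner vertices violate Tutte's condition.\<close>

section \<open>Perfect matchings by alternating search\<close>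

text \<open>Complete multipartiteness is what lets one pair of hubs serve a whole color: a slot only
  has to reach two different parts, and whichever original vertices answer are joined in that color.
  The bounds are written in binary and may be exponentially large; a matching uses a color at most
  \<open>n\<close> times, so \<open>n\<close> slots per color suffice and the gadget graph stays
  polynomial. The search is shaped by the wish to avoid nested blossoms and the tracing of
  alternating paths. With a whole matching per outer vertex, augmenting copies one row and merging
  combines two. The tree itself is never stored: \<open>blk (F z t)\<close> is the block met when
  the inner vertex \<open>t\<close> is crossed coming from \<open>z\<close>, and this one expression
  states every property of the tree. The price is quadratic memory and the need to show that the
  combined rows are matchings again. The machine has no multiplication, so matrix rows are found
  through a table built by addition. Programs are written with bounded loops, whose running time
  follows from their syntax; all other arguments about programs concern values only.\<close>

lemma even_card_involution:
  assumes "finite A" "\<And>v. v \<in> A \<Longrightarrow> f v \<in> A \<and> f (f v) = v \<and> f v \<noteq> v"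
  shows "even (card A)"
  using assms
proof (induction A rule: finite_psubset_induct)
  case (psubset A)
  show ?case
  proof (cases "A = {}")
    case False
    then obtain a where a: "a \<in> A" by blast
    let ?B = "A - {a, f a}"
    have fa: "f a \<in> A" "f a \<noteq> a" "f (f a) = a" using psubset.prems a by auto
    have "even (card ?B)"
    proof (rule psubset.IH)
      show "?B \<subset> A" using a by blast
      show "f v \<in> ?B \<and> f (f v) = v \<and> f v \<noteq> v" if "v \<in> ?B" for v
        using psubset.prems[of v] fa that by (metis Diff_iff insertE insertI1 insertI2 singletonD)
    qed
    moreover have "card A = card ?B + 2"
      using a fa psubset.hyps card_Diff_subset[of "{a, f a}" A] card_mono[of A "{a, f a}"] by auto
    ultimately show ?thesis by simp
  qed simp
qed

text \<open>An involution whose fixed points are the unmatched vertices: one array stores it,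
  without a special value for being unmatched.\<close>

definition matching_fun :: "(nat \<Rightarrow> nat \<Rightarrow> bool) \<Rightarrow> nat \<Rightarrow> (nat \<Rightarrow> nat) \<Rightarrow> bool" where
  "matching_fun E N M \<longleftrightarrow> (\<forall>v<N. M v < N \<and> M (M v) = v \<and> (M v \<noteq> v \<longrightarrow> E v (M v)))"

definition has_perfect_matching :: "'a set \<Rightarrow> ('a \<Rightarrow> 'a \<Rightarrow> bool) \<Rightarrow> bool" where
  "has_perfect_matching V E \<longleftrightarrow> (\<exists>f. \<forall>v\<in>V. f v \<in> V \<and> f (f v) = v \<and> f v \<noteq> v \<and> E v (f v))"

text \<open>\<open>S\<close> holds the outer and \<open>T\<close> the inner vertices, all others are
  unreached; \<open>M\<close> is the matching of the current phase. With \<open>blk (F z t)\<close>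
  read as the block behind \<open>t\<close> as seen from \<open>z\<close>, the last axioms express a
  tree in which inner vertices have degree two: \<open>t\<close> has only two sides
  (\<open>side_two\<close>), the neighbours of \<open>s\<close> lie on the same side of another
  inner vertex \<open>t\<close> (\<open>side_F\<close>), \<open>s\<close> and \<open>t\<close>
  cannot each separate \<open>z\<close> from the other (\<open>side_or\<close>), and in the tree
  hung up at \<open>z\<close> at most one inner vertex leads to a given block
  (\<open>side_inj\<close>).\<close>

locale search =
  fixes E :: "nat \<Rightarrow> nat \<Rightarrow> bool" and N :: nat and M :: "nat \<Rightarrow> nat"
    and S T :: "nat set" and blk :: "nat \<Rightarrow> nat" and F :: "nat \<Rightarrow> nat \<Rightarrow> nat"
  assumes S_sub: "S \<subseteq> {..<N}" and T_sub: "T \<subseteq> {..<N}" and disj: "S \<inter> T = {}"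
    and blk_S: "z \<in> S \<Longrightarrow> blk z \<in> S"
    and F_lt: "z \<in> S \<Longrightarrow> v < N \<Longrightarrow> F z v < N"
    and F_inv: "z \<in> S \<Longrightarrow> v < N \<Longrightarrow> F z (F z v) = v"
    and F_E: "z \<in> S \<Longrightarrow> v < N \<Longrightarrow> F z v \<noteq> v \<Longrightarrow> E v (F z v)"
    and F_self: "z \<in> S \<Longrightarrow> F z z = z"
    and F_S: "z \<in> S \<Longrightarrow> v \<in> S \<Longrightarrow> v \<noteq> z \<Longrightarrow>
      F z v \<noteq> v \<and> (F z v \<in> T \<or> F z v \<in> S \<and> blk (F z v) = blk v)"
    and F_T: "z \<in> S \<Longrightarrow> t \<in> T \<Longrightarrow> F z t \<in> S"
    and F_R: "z \<in> S \<Longrightarrow> v < N \<Longrightarrow> v \<notin> S \<Longrightarrow> v \<notin> T \<Longrightarrow> F z v = M v"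
    and side_blk: "z \<in> S \<Longrightarrow> z' \<in> S \<Longrightarrow> blk z = blk z' \<Longrightarrow> t \<in> T \<Longrightarrow> blk (F z t) = blk (F z' t)"
    and side_ne: "z \<in> S \<Longrightarrow> t \<in> T \<Longrightarrow> blk (F z t) \<noteq> blk z"
    and side_two: "z1 \<in> S \<Longrightarrow> z2 \<in> S \<Longrightarrow> z3 \<in> S \<Longrightarrow> t \<in> T \<Longrightarrow> blk (F z1 t) \<noteq> blk (F z2 t) \<Longrightarrow>
      blk (F z3 t) = blk (F z1 t) \<or> blk (F z3 t) = blk (F z2 t)"
    and side_F: "z \<in> S \<Longrightarrow> z' \<in> S \<Longrightarrow> s \<in> T \<Longrightarrow> t \<in> T \<Longrightarrow> s \<noteq> t \<Longrightarrow>
      blk (F (F z s) t) = blk (F (F z' s) t)"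
    and side_or: "z \<in> S \<Longrightarrow> z1 \<in> S \<Longrightarrow> z2 \<in> S \<Longrightarrow> s \<in> T \<Longrightarrow> t \<in> T \<Longrightarrow> s \<noteq> t \<Longrightarrow>
      blk (F z t) = blk (F (F z1 s) t) \<or> blk (F z s) = blk (F (F z2 t) s)"
    and side_inj: "z \<in> S \<Longrightarrow> s \<in> T \<Longrightarrow> t \<in> T \<Longrightarrow> blk (F z s) = blk (F z t) \<Longrightarrow> s = t"

lemma search_init:
  assumes "matching_fun E N M" "r < N" "M r = r" "blk r = r" "\<And>v. v < N \<Longrightarrow> F r v = M v"
  shows "search E N M {r} {} blk F"
  using assms by unfold_locales (auto simp: matching_fun_def)

text \<open>The axioms look up \<open>blk\<close> only at outer vertices and \<open>F\<close> only
  in rows of outer vertices and columns below \<open>N\<close>. The arrays of a program may hold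
  anything elsewhere.\<close>

lemma search_cong:
  assumes "search E N M S T blk F"
    and b: "\<And>v. v \<in> S \<Longrightarrow> blk' v = blk v"
    and f: "\<And>z v. z \<in> S \<Longrightarrow> v < N \<Longrightarrow> F' z v = F z v"
  shows "search E N M S T blk' F'"
proof -
  interpret search E N M S T blk F by fact
  have lt: "\<And>v. v \<in> S \<Longrightarrow> v < N" "\<And>v. v \<in> T \<Longrightarrow> v < N" using S_sub T_sub by auto
  have bF: "z \<in> S \<Longrightarrow> t \<in> T \<Longrightarrow> blk' (F' z t) = blk (F z t)" for z t
    using b f F_T lt by simp
  have bFF: "z \<in> S \<Longrightarrow> s \<in> T \<Longrightarrow> t \<in> T \<Longrightarrow> blk' (F' (F' z s) t) = blk (F (F z s) t)" for z s t
    using b f F_T lt by simp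
  show ?thesis
  proof unfold_locales
    show "F' z v \<noteq> v \<and> (F' z v \<in> T \<or> F' z v \<in> S \<and> blk' (F' z v) = blk' v)"
      if "z \<in> S" "v \<in> S" "v \<noteq> z" for z v
      using F_S[OF that] that b f lt by auto
    show "F' z (F' z v) = v" if "z \<in> S" "v < N" for z v
      using F_inv F_lt f that by simp
    show "blk' (F' z t) = blk' (F' z' t)" if "z \<in> S" "z' \<in> S" "blk' z = blk' z'" "t \<in> T" for z z' t
      using that side_blk[of z z' t] b bF by simp
    show "blk' (F' z3 t) = blk' (F' z1 t) \<or> blk' (F' z3 t) = blk' (F' z2 t)"
      if "z1 \<in> S" "z2 \<in> S" "z3 \<in> S" "t \<in> T" "blk' (F' z1 t) \<noteq> blk' (F' z2 t)" for z1 z2 z3 t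
      using that side_two[of z1 z2 z3 t] bF by simp
    show "blk' (F' (F' z s) t) = blk' (F' (F' z' s) t)"
      if "z \<in> S" "z' \<in> S" "s \<in> T" "t \<in> T" "s \<noteq> t" for z z' s t
      using that side_F[of z z' s t] bFF by simp
    show "blk' (F' z t) = blk' (F' (F' z1 s) t) \<or> blk' (F' z s) = blk' (F' (F' z2 t) s)"
      if "z \<in> S" "z1 \<in> S" "z2 \<in> S" "s \<in> T" "t \<in> T" "s \<noteq> t" for z z1 z2 s t
      using that side_or[of z z1 z2 s t] bF bFF by simp
    show "s = t" if "z \<in> S" "s \<in> T" "t \<in> T" "blk' (F' z s) = blk' (F' z t)" for z s t
      using that side_inj[of z s t] bF by simp
  qed (simp_all add: S_sub T_sub disj b f lt bF blk_S F_lt F_E F_self F_T F_R side_ne)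
qed

section \<open>Consequences of the tree axioms, and the three steps of the search\<close>

context search
begin

lemma lt_S: "v \<in> S \<Longrightarrow> v < N" and lt_T: "v \<in> T \<Longrightarrow> v < N"
  using S_sub T_sub by auto

lemma fin_S: "finite S" and fin_T: "finite T"
  using S_sub T_sub by (auto intro: finite_subset)

lemma F_R_closed:
  assumes "z \<in> S" "v < N" "v \<notin> S" "v \<notin> T"
  shows "F z v \<notin> S" "F z v \<notin> T"
proof -
  show "F z v \<notin> T" using F_T[OF assms(1), of "F z v"] F_inv assms by auto
  show "F z v \<notin> S" using F_S[OF assms(1), of "F z v"] F_inv[OF assms(1,2)] F_self[OF assms(1)] assms by metis
qed

text \<open>\<open>F z\<close> pairs up the rest of the block of \<open>z\<close>: if it led from
  there to an inner vertex, that vertex would be matched back into the block of \<open>z\<close>,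
  against \<open>side_ne\<close>.\<close>

lemma odd_block:
  assumes "z \<in> S" shows "odd (card {v \<in> S. blk v = blk z})"
proof -
  let ?C = "{v \<in> S. blk v = blk z}"
  have "even (card (?C - {z}))"
  proof (rule even_card_involution)
    show "F z v \<in> ?C - {z} \<and> F z (F z v) = v \<and> F z v \<noteq> v" if "v \<in> ?C - {z}" for v
    proof -
      have v: "v \<in> S" "blk v = blk z" "v \<noteq> z" using that by auto
      have inv: "F z (F z v) = v" using F_inv assms lt_S v by blast
      have "F z v \<notin> T"
        using side_ne[OF assms, of "F z v"] inv v by auto
      then show ?thesis using F_S[OF assms v(1,3)] inv F_self[OF assms] v by auto
    qed
  qed (use fin_S in auto)
  moreover have "card ?C = Suc (card (?C - {z}))"
    using assms fin_S by (intro card.remove) auto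
  ultimately show ?thesis by simp
qed

text \<open>A parity argument, used for a hypothetical perfect matching and for \<open>F x\<close>
  on a block that does not contain \<open>x\<close>.\<close>

lemma block_leaves:
  assumes "z \<in> S" "\<And>v. v \<in> S \<Longrightarrow> blk v = blk z \<Longrightarrow>
      f (f v) = v \<and> f v \<noteq> v \<and> (f v \<in> T \<or> f v \<in> S \<and> blk (f v) = blk z)"
  obtains v where "v \<in> S" "blk v = blk z" "f v \<in> T"
proof (rule ccontr)
  assume "\<not> thesis"
  then have *: "v \<in> S \<Longrightarrow> blk v = blk z \<Longrightarrow> f v \<notin> T" for v using that by blast
  have "even (card {v \<in> S. blk v = blk z})"
    by (rule even_card_involution[where f = f]) (use * assms(2) fin_S in auto)
  then show False using odd_block[OF assms(1)] by simp
qed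

text \<open>The inner vertices are a Tutte barrier: in a stuck search they are the only neighbours
  that a block has outside of itself. A perfect matching would send every block, being odd, to an
  inner vertex of its own, while \<open>side_inj\<close> and \<open>side_ne\<close> inject the inner
  vertices into the blocks other than that of \<open>z\<close>.\<close>

lemma stuck_no_perfect_matching:
  assumes stuck: "\<And>x y. x \<in> S \<Longrightarrow> y < N \<Longrightarrow> E x y \<Longrightarrow> y \<in> T \<or> y \<in> S \<and> blk y = blk x"
    and ne: "S \<noteq> {}"
  shows "\<not> has_perfect_matching {..<N} E"
proof
  assume "has_perfect_matching {..<N} E"
  then obtain f where f: "\<And>v. v < N \<Longrightarrow> f v < N \<and> f (f v) = v \<and> f v \<noteq> v \<and> E v (f v)"
    unfolding has_perfect_matching_def by auto
  have "\<exists>v. v \<in> S \<and> blk v = b \<and> f v \<in> T" if "b \<in> blk ` S" for b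
  proof -
    obtain z where z: "z \<in> S" "b = blk z" using \<open>b \<in> blk ` S\<close> by blast
    show ?thesis
      by (rule block_leaves[OF z(1), of f]) (use f stuck lt_S z in \<open>metis | blast\<close>)+
  qed
  then obtain h where h: "\<And>b. b \<in> blk ` S \<Longrightarrow> h b \<in> S \<and> blk (h b) = b \<and> f (h b) \<in> T" by metis
  have "inj_on (\<lambda>b. f (h b)) (blk ` S)"
    by (rule inj_onI) (metis f h lt_S)
  then have le: "card (blk ` S) \<le> card T"
    using h fin_T by (intro card_inj_on_le[where f = "\<lambda>b. f (h b)"]) auto
  obtain z where z: "z \<in> S" using ne by blast
  have "card T \<le> card (blk ` S - {blk z})"
    by (rule card_inj_on_le[where f = "\<lambda>t. blk (F z t)"])
      (use z F_T side_ne side_inj fin_S in \<open>auto intro!: inj_onI\<close>)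
  also have "\<dots> < card (blk ` S)"
    using z fin_S by (intro psubset_card_mono) auto
  finally show False using le by simp
qed

text \<open>\<open>F x\<close> leaves both \<open>x\<close> and \<open>y\<close> free, so the edge
  \<open>x y\<close> can be added. Strictness comes from \<open>r\<close>: fixed points of
  \<open>M'\<close> are unreached, where \<open>F x\<close> agrees with \<open>M\<close>, whereas
  \<open>r\<close> is outer and no longer fixed.\<close>

lemma augment:
  assumes x: "x \<in> S" and y: "y < N" "y \<notin> S" "y \<notin> T" "F x y = y" and E: "E x y" "E y x"
    and r: "r \<in> S" "M r = r"
    and M': "\<And>v. v < N \<Longrightarrow> M' v = (if v = x then y else if v = y then x else F x v)"
  shows "matching_fun E N M'" "card {v. v < N \<and> M' v = v} < card {v. v < N \<and> M v = v}"
proof -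
  have xN: "x < N" and ne: "x \<noteq> y" using lt_S x y by auto
  have "F x v \<noteq> x \<and> F x v \<noteq> y" if "v < N" "v \<noteq> x" "v \<noteq> y" for v
    using F_inv[OF x that(1)] F_self[OF x] y(4) that by auto
  then show "matching_fun E N M'"
    unfolding matching_fun_def using M' x y(1) E xN ne F_lt[OF x] F_inv[OF x] F_E[OF x] by auto
  have "{v. v < N \<and> M' v = v} \<subset> {v. v < N \<and> M v = v}"
  proof (rule psubsetI)
    show "{v. v < N \<and> M' v = v} \<subseteq> {v. v < N \<and> M v = v}"
    proof clarify
      fix v assume v: "v < N" "M' v = v"
      then have v': "v \<noteq> x" "F x v = v" using M'[of v] ne by (auto split: if_splits)
      then have "v \<notin> S" "v \<notin> T" using F_S[OF x, of v] F_T[OF x, of v] disj by auto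
      then show "M v = v" using F_R[OF x v(1)] v' by simp
    qed
    have "M' r \<noteq> r"
      using M'[OF lt_S[OF r(1)]] ne y r F_S[OF x r(1)] by auto
    then show "{v. v < N \<and> M' v = v} \<noteq> {v. v < N \<and> M v = v}"
      using r lt_S by blast
  qed
  then show "card {v. v < N \<and> M' v = v} < card {v. v < N \<and> M v = v}"
    by (intro psubset_card_mono) auto
qed

text \<open>The vertex \<open>w\<close> becomes a leaf of the tree, a block by itself hanging behind
  \<open>y\<close>. Its matching exchanges the edge \<open>y w\<close> of \<open>F x\<close> for
  \<open>x y\<close>.\<close>

lemma grow:
  assumes x: "x \<in> S" and y: "y < N" "y \<notin> S" "y \<notin> T" "F x y \<noteq> y" and E: "E x y" "E y x"
    and w: "w = F x y"
  shows "search E N M (insert w S) (insert y T) (blk(w := w))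
     (F(w := (F x)(w := w, x := y, y := x)))"
proof -
  let ?F = "F(w := (F x)(w := w, x := y, y := x))"
  let ?b = "blk(w := w)"
  have wS: "w \<notin> S" "w \<notin> T" using F_R_closed[OF x y(1-3)] w by auto
  have wN: "w < N" and wy: "w \<noteq> y" and xy: "x \<noteq> y" and xw: "x \<noteq> w" using F_lt x y w wS by auto
  have xN: "x < N" using lt_S x by simp
  have Fxw: "F x w = y" using F_inv[OF x y(1)] w by simp
  have Fzy: "F z y = w" if "z \<in> S" for z using F_R[OF that y(1-3)] F_R[OF x y(1-3)] w by simp
  have Fzw: "F z w = y" if "z \<in> S" for z using F_inv[OF that y(1)] Fzy[OF that] by simp
  have Fx: "F x v \<notin> {w, x, y}" if "v < N" "v \<notin> {w, x, y}" for v
    using F_inv[OF x that(1)] F_self[OF x] Fxw w that by auto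
  have zw: "z \<noteq> w" "z \<noteq> y" if "z \<in> S" for z using that wS y by auto
  have tw: "t \<noteq> w" "t \<noteq> y" "t \<noteq> x" if "t \<in> T" for t using that wS y x disj by auto
  \<comment> \<open>in the new structure, the vertex \<open>w\<close> sees the old inner vertices as \<open>x\<close> does\<close>
  have gold: "?b (?F z t) = blk (F (if z = w then x else z) t)" if "z \<in> insert w S" "t \<in> T" for z t
  proof -
    have "F (if z = w then x else z) t \<in> S" using F_T that x by auto
    then have "F (if z = w then x else z) t \<noteq> w" using wS by metis
    then show ?thesis using tw[OF that(2)] by auto
  qed
  \<comment> \<open>The two sides of \<open>y\<close>: from \<open>w\<close> it leads back to the
    block of \<open>x\<close>, from everywhere else it leads to \<open>w\<close>.\<close>
  have gnew: "?b (?F z y) = (if z = w then blk x else w)" if "z \<in> insert w S" for z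
    using that Fzy zw xw xy wy by auto
  have bw: "blk z \<noteq> w" if "z \<in> S" for z using blk_S[OF that] wS by auto
  define \<pi> where "\<pi> z = (if z = w then x else z)" for z
  have \<pi>: "\<pi> z \<in> S" if "z \<in> insert w S" for z using that x by (auto simp: \<pi>_def)
  have old: "?b (?F z t) = blk (F (\<pi> z) t)" if "z \<in> insert w S" "t \<in> T" for z t
    using gold[OF that] unfolding \<pi>_def .
  have FT: "?F z s = F (\<pi> z) s" "?F z s \<in> S" "?F z s \<noteq> w" if "z \<in> insert w S" "s \<in> T" for z s
  proof -
    show eq: "?F z s = F (\<pi> z) s" using tw[OF that(2)] by (simp add: \<pi>_def)
    show "?F z s \<in> S" unfolding eq by (rule F_T[OF \<pi>[OF that(1)] that(2)])
    then show "?F z s \<noteq> w" using wS(1) by metis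
  qed
  have Fy: "?F z y = (if z = w then x else w)" if "z \<in> insert w S" for z
    using that Fzy wy xy by auto
  have \<pi>F: "?F z s \<in> insert w S" "\<pi> (?F z s) = (if s = y then x else F (\<pi> z) s)"
    if "z \<in> insert w S" "s \<in> insert y T" for z s
  proof -
    have "s = y \<or> s \<in> T \<and> s \<noteq> y" using that(2) tw by blast
    then show "?F z s \<in> insert w S" "\<pi> (?F z s) = (if s = y then x else F (\<pi> z) s)"
      using FT[OF that(1), of s] Fy[OF that(1)] x xw unfolding \<pi>_def
      by (auto simp del: fun_upd_apply)
  qed
  show ?thesis
  proof unfold_locales
    fix z v assume z: "z \<in> insert w S" and v: "v < N"
    show "?F z v < N" using z v F_lt x y wN xN by auto
    show "?F z (?F z v) = v" using z v F_inv x wS xy wy xw Fx[of v] by (auto split: if_splits)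
    show "?F z v \<noteq> v \<Longrightarrow> E v (?F z v)" using z v F_E x E by (auto split: if_splits)
  next
    fix z v assume z: "z \<in> insert w S" and v: "v \<in> insert w S" "v \<noteq> z"
    show "?F z v \<noteq> v \<and> (?F z v \<in> insert y T \<or> ?F z v \<in> insert w S \<and> ?b (?F z v) = ?b v)"
    proof (cases "z = w")
      case True
      then have "v \<in> S" using v by auto
      then show ?thesis using True F_S[OF x, of v] xy zw[of v] zw v by (auto split: if_splits)
    next
      case False
      then have zS: "z \<in> S" using z by auto
      then show ?thesis using False F_S[OF zS, of v] v Fzw[OF zS] wy zw by auto
    qed
  next
    fix z v assume "z \<in> insert w S" "v < N" "v \<notin> insert w S" "v \<notin> insert y T"
    then show "?F z v = M v" using F_R x by auto
  next
    fix z t assume z: "z \<in> insert w S" and t: "t \<in> insert y T"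
    show "?b (?F z t) \<noteq> ?b z"
    proof (cases "t = y")
      case True
      then show ?thesis using gnew[OF z] bw[of z] bw[OF x] z by (auto simp del: fun_upd_apply simp: fun_upd_def)
    next
      case False
      then have t: "t \<in> T" using t by simp
      show ?thesis
      proof (cases "z = w")
        case True
        then show ?thesis using gold[OF z t] bw[OF F_T[OF x t]] by (simp add: fun_upd_def)
      next
        case False
        then have "z \<in> S" using z by simp
        then show ?thesis using gold[OF z t] side_ne[OF _ t, of z] False by (simp add: fun_upd_def)
      qed
    qed
  next
    fix z z' t
    assume z: "z \<in> insert w S" "z' \<in> insert w S" "?b z = ?b z'" and t: "t \<in> insert y T"
    have "z = z' \<or> z \<in> S \<and> z' \<in> S \<and> blk z = blk z' \<and> z \<noteq> w \<and> z' \<noteq> w"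
      using z bw zw by (auto split: if_splits)
    then show "?b (?F z t) = ?b (?F z' t)"
    proof (elim disjE conjE)
      assume *: "z \<in> S" "z' \<in> S" "blk z = blk z'" "z \<noteq> w" "z' \<noteq> w"
      show ?thesis
      proof (cases "t = y")
        case True
        then show ?thesis using gnew[OF z(1)] gnew[OF z(2)] * by simp
      next
        case False
        then have t: "t \<in> T" using t by simp
        then show ?thesis using gold[OF z(1) t] gold[OF z(2) t] side_blk[OF *(1-3) t] * by simp
      qed
    qed simp
  next
    fix z1 z2 z3 t
    assume z: "z1 \<in> insert w S" "z2 \<in> insert w S" "z3 \<in> insert w S" and t: "t \<in> insert y T"
      and ne: "?b (?F z1 t) \<noteq> ?b (?F z2 t)"
    show "?b (?F z3 t) = ?b (?F z1 t) \<or> ?b (?F z3 t) = ?b (?F z2 t)"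
    proof (cases "t = y")
      case True
      then show ?thesis using ne gnew z by (auto split: if_splits)
    next
      case False
      then have "t \<in> T" using t by auto
      then show ?thesis
        using ne side_two[OF \<pi>[OF z(1)] \<pi>[OF z(2)] \<pi>[OF z(3)]]
        by (simp only: old[OF z(1)] old[OF z(2)] old[OF z(3)])
    qed
  next
    fix z z' s t
    assume z: "z \<in> insert w S" "z' \<in> insert w S" and st: "s \<in> insert y T" "t \<in> insert y T" "s \<noteq> t"
    show "?b (?F (?F z s) t) = ?b (?F (?F z' s) t)"
    proof (cases "t = y")
      case True
      then have "s \<in> T" using st by auto
      then show ?thesis
        using gnew[OF \<pi>F(1)[OF z(1) st(1)]] gnew[OF \<pi>F(1)[OF z(2) st(1)]]
          FT(3)[OF z(1) \<open>s \<in> T\<close>] FT(3)[OF z(2) \<open>s \<in> T\<close>] True by (simp del: fun_upd_apply)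
    next
      case False
      then have "t \<in> T" using st by auto
      have "s = y \<or> s \<in> T \<and> s \<noteq> y" using st(1) tw by blast
      then show ?thesis
        using side_F[OF \<pi>[OF z(1)] \<pi>[OF z(2)] _ \<open>t \<in> T\<close> st(3)]
        unfolding old[OF \<pi>F(1)[OF z(1) st(1)] \<open>t \<in> T\<close>] \<pi>F(2)[OF z(1) st(1)]
            old[OF \<pi>F(1)[OF z(2) st(1)] \<open>t \<in> T\<close>] \<pi>F(2)[OF z(2) st(1)]
        by auto
    qed
  next
    fix z z1 z2 s t
    assume z: "z \<in> insert w S" "z1 \<in> insert w S" "z2 \<in> insert w S"
      and st: "s \<in> insert y T" "t \<in> insert y T" "s \<noteq> t"
    show "?b (?F z t) = ?b (?F (?F z1 s) t) \<or> ?b (?F z s) = ?b (?F (?F z2 t) s)"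
    \<comment> \<open>Suppose that one of the two is \<open>y\<close>. From \<open>z = w\<close> the
      other one looks as from the neighbours of \<open>y\<close>, all of which see it as
      \<open>x\<close> does. From an old \<open>z\<close> the block behind \<open>y\<close> is
      \<open>w\<close>, as it is for every old outer vertex, in particular for the neighbours of the
      other one.\<close>
    proof (cases "s = y \<or> t = y")
      case True
      show ?thesis
      proof (cases "s = y")
        case True
        then have t: "t \<in> T" using st by auto
        have "?b (?F z t) = ?b (?F (?F z1 s) t)" if "z = w"
          using old[OF z(1) t] old[OF \<pi>F(1)[OF z(2) st(1)] t] \<pi>F(2)[OF z(2) st(1)] True that
          by (simp add: \<pi>_def del: fun_upd_apply)
        moreover have "?b (?F z s) = ?b (?F (?F z2 t) s)" if "z \<noteq> w"
          using gnew[OF z(1)] gnew[OF \<pi>F(1)[OF z(3) st(2)]] FT(3)[OF z(3) t] True that by (simp del: fun_upd_apply)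
        ultimately show ?thesis by blast
      next
        case False
        then have ty: "t = y" and s: "s \<in> T" using True st by auto
        have "?b (?F z s) = ?b (?F (?F z2 t) s)" if "z = w"
          using old[OF z(1) s] old[OF \<pi>F(1)[OF z(3) st(2)] s] \<pi>F(2)[OF z(3) st(2)] ty that
          by (simp add: \<pi>_def del: fun_upd_apply)
        moreover have "?b (?F z t) = ?b (?F (?F z1 s) t)" if "z \<noteq> w"
          using gnew[OF z(1)] gnew[OF \<pi>F(1)[OF z(2) st(1)]] FT(3)[OF z(2) s] ty that by (simp del: fun_upd_apply)
        ultimately show ?thesis by blast
      qed
    next
      case False
      then have ST: "s \<in> T" "t \<in> T" using st by auto
      show ?thesis
        using side_or[OF \<pi>[OF z(1)] \<pi>[OF z(2)] \<pi>[OF z(3)] ST st(3)] False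
        by (simp add: old[OF z(1) ST(1)] old[OF z(1) ST(2)] old[OF \<pi>F(1)[OF z(2) st(1)] ST(2)]
          old[OF \<pi>F(1)[OF z(3) st(2)] ST(1)] \<pi>F(2)[OF z(2) st(1)] \<pi>F(2)[OF z(3) st(2)]
          del: fun_upd_apply)
    qed
  next
    fix z s t
    assume z: "z \<in> insert w S" and st: "s \<in> insert y T" "t \<in> insert y T"
      and eq: "?b (?F z s) = ?b (?F z t)"
    \<comment> \<open>Behind \<open>y\<close> lies \<open>w\<close>, whose name is new, or, for
      \<open>z = w\<close>, the block of \<open>x\<close>, to which no inner vertex seen from
      \<open>x\<close> leads.\<close>
    have new: "t' = y" if "t' \<in> insert y T" "?b (?F z t') = ?b (?F z y)" for t'
    proof (rule ccontr)
      assume "t' \<noteq> y"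
      then have t': "t' \<in> T" using that by auto
      have "blk (F (\<pi> z) t') = (if z = w then blk x else w)"
        using that(2) by (simp only: old[OF z t'] gnew[OF z])
      then show False
        using side_ne[OF x t'] bw[OF F_T[OF \<pi>[OF z] t']] by (auto simp: \<pi>_def split: if_splits)
    qed
    show "s = t"
    proof (cases "s = y \<or> t = y")
      case True
      then show ?thesis using new[OF st(1)] new[OF st(2)] eq by metis
    next
      case False
      then have "s \<in> T" "t \<in> T" using st by auto
      then show ?thesis
        using eq side_inj[OF \<pi>[OF z], of s t] by (simp only: old[OF z])
    qed
  next
    show "insert w S \<subseteq> {..<N}" "insert y T \<subseteq> {..<N}" using S_sub T_sub wN y(1) by auto
    show "insert w S \<inter> insert y T = {}" using disj wS y(2) wy by auto
    show "?b z \<in> insert w S" if "z \<in> insert w S" for z using that blk_S by auto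
    show "?F z z = z" if "z \<in> insert w S" for z using that F_self wy xw by auto
    show "?F z t \<in> insert w S" if "z \<in> insert w S" "t \<in> insert y T" for z t
      by (rule \<pi>F(1)[OF that])
  qed
qed

text \<open>Progress of a merge: \<open>F x\<close> must leave the odd block of \<open>y\<close>,
  and the inner vertex through which it does so has the block of \<open>y\<close> behind it for
  \<open>x\<close> but not for \<open>y\<close>.\<close>

lemma merge_blocks_ne:
  assumes "x \<in> S" "y \<in> S" "blk x \<noteq> blk y"
  shows "{t \<in> T. blk (F x t) \<noteq> blk (F y t)} \<noteq> {}"
proof -
  have *: "F x (F x v) = v \<and> F x v \<noteq> v \<and> (F x v \<in> T \<or> F x v \<in> S \<and> blk (F x v) = blk y)"
    if "v \<in> S" "blk v = blk y" for v
    using F_S[OF assms(1) that(1)] F_inv[OF assms(1) lt_S[OF that(1)]] that assms by auto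
  obtain v where v: "v \<in> S" "blk v = blk y" "F x v \<in> T"
    using block_leaves[OF assms(2), of "F x"] * by blast
  have "blk (F y (F x v)) \<noteq> blk (F x (F x v))"
    using side_ne[OF assms(2) v(3)] *[OF v(1,2)] v(2) by simp
  then show ?thesis using v(3) by auto
qed

text \<open>\<open>P\<close> collects the inner vertices that separate \<open>x\<close> from
  \<open>y\<close>, that is, those on the tree path between their blocks, and \<open>B\<close> the
  blocks on this path; all of them collapse into one block named \<open>blk x\<close>. For
  \<open>t\<close> in \<open>P\<close> the rows of \<open>x\<close> and \<open>y\<close> are cut at
  \<open>t\<close>: each matches \<open>t\<close> across to the other side, so restricted to their
  own sides they leave \<open>t\<close>, \<open>x\<close> and \<open>y\<close> free.\<close>

lemma merge:
  assumes x: "x \<in> S" and y: "y \<in> S" and E: "E x y" "E y x" and xy: "blk x \<noteq> blk y"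
  defines "P \<equiv> {t \<in> T. blk (F x t) \<noteq> blk (F y t)}"
  defines "B \<equiv> {blk x, blk y} \<union> (\<lambda>t. blk (F x t)) ` P \<union> (\<lambda>t. blk (F y t)) ` P"
  assumes blk': "\<And>v. v \<in> S \<union> P \<Longrightarrow> blk' v = (if v \<in> P \<or> blk v \<in> B then blk x else blk v)"
    and F'_old: "\<And>z v. z \<in> S \<Longrightarrow> v < N \<Longrightarrow> F' z v = F z v"
    and F'_new: "\<And>t v. t \<in> P \<Longrightarrow> v < N \<Longrightarrow> F' t v =
      (if v = t then t else if v = x then y else if v = y then x
       else if v \<in> S \<and> blk (F v t) = blk (F x t) \<or> v \<in> T \<and> blk (F (F x v) t) = blk (F x t)
       then F x v else F y v)"
  shows "search E N M (S \<union> P) (T - P) blk' F'"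
proof -
  have PT: "P \<subseteq> T" and PS: "P \<inter> S = {}" using disj by (auto simp: P_def)
  have P_eq: "blk (F y s) = blk (F x s)" if "s \<in> T - P" for s using that by (simp add: P_def)
  have xyN: "x < N" "y < N" using lt_S x y by auto
  have xyne: "x \<noteq> y" using xy by auto
  \<comment> \<open>The side of \<open>t\<close> that contains \<open>x\<close>. An inner
    \<open>v\<close> is located by its partner under \<open>F x\<close>, and by
    \<open>side_F\<close> any other neighbour would give the same answer. Unreached vertices count
    as far; there \<open>F y\<close> agrees with \<open>M\<close>.\<close>
  define near where "near t v \<longleftrightarrow>
      v \<in> S \<and> blk (F v t) = blk (F x t) \<or> v \<in> T \<and> blk (F (F x v) t) = blk (F x t)" for t v
  have nearS: "near t v \<longleftrightarrow> blk (F v t) = blk (F x t)" if "v \<in> S" for t v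
    using that disj by (auto simp: near_def)
  have nearT: "near t v \<longleftrightarrow> near t (F z v)" if "v \<in> T" "z \<in> S" "t \<in> P" "v \<noteq> t" for t v z
  proof -
    have "near t v \<longleftrightarrow> blk (F (F x v) t) = blk (F x t)"
      using that disj by (auto simp: near_def)
    also have "blk (F (F x v) t) = blk (F (F z v) t)"
      using side_F[OF x that(2,1)] that PT by blast
    finally show ?thesis using nearS[OF F_T[OF that(2,1)]] by simp
  qed
  have near_blk: "near t u = near t v" if "u \<in> S" "v \<in> S" "blk u = blk v" "t \<in> P" for t u v
    using side_blk[OF that(1-3), of t] that PT nearS by auto
  have near_x: "near t x" and near_y: "\<not> near t y"
    and near_Fx: "\<not> near t (F x t)" and near_Fy: "near t (F y t)" if "t \<in> P" for t
  proof -
    have t: "t \<in> T" "blk (F x t) \<noteq> blk (F y t)" using that by (auto simp: P_def)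
    show "near t x" "\<not> near t y" using nearS x y t by auto
    show "\<not> near t (F x t)"
      using nearS[OF F_T[OF x t(1)]] side_ne[OF F_T[OF x t(1)] t(1)] by simp
    show "near t (F y t)"
      using nearS[OF F_T[OF y t(1)]] side_ne[OF F_T[OF y t(1)] t(1)]
        side_two[OF x y F_T[OF y t(1)] t(1) t(2)] by auto
  qed
  \<comment> \<open>On reached vertices \<open>F x\<close> moves within a block or between
    neighbours in the tree, so it could change sides only at \<open>t\<close>; but its partner of
    \<open>t\<close> is far. The far side with \<open>F y\<close> is symmetric.\<close>
  have near_step: "near t (F x v) \<and> F x v \<notin> {x, t, y}"
    if t: "t \<in> P" and v: "v < N" "near t v" "v \<noteq> x" "v \<noteq> t" for t v
  proof -
    have inv: "F x (F x v) = v" using F_inv[OF x v(1)] .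
    have 1: "near t (F x v)"
    proof (cases "v \<in> S")
      case True
      then consider "F x v \<in> T" | "F x v \<in> S" "blk (F x v) = blk v" using F_S[OF x] v by blast
      then show ?thesis
      proof cases
        case 1
        then have "F x v \<noteq> t" using near_Fx[OF t] inv v by auto
        then show ?thesis using nearT[OF 1 x t] inv v by simp
      next
        case 2
        then show ?thesis using near_blk[OF 2(1) True 2(2) t] v by simp
      qed
    next
      case False
      then show ?thesis using v nearT[OF _ x t, of v] by (auto simp: near_def)
    qed
    moreover have "F x v \<noteq> x" using inv F_self[OF x] v by auto
    moreover have "F x v \<noteq> t" using near_Fx[OF t] inv v by auto
    ultimately show ?thesis using near_y[OF t] by auto
  qed
  have far_step: "\<not> near t (F y v) \<and> F y v \<notin> {x, t, y}"
    if t: "t \<in> P" and v: "v < N" "\<not> near t v" "v \<noteq> y" "v \<noteq> t" for t v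
  proof -
    have inv: "F y (F y v) = v" using F_inv[OF y v(1)] .
    have 1: "\<not> near t (F y v)"
    proof (cases "v \<in> S")
      case True
      then consider "F y v \<in> T" | "F y v \<in> S" "blk (F y v) = blk v" using F_S[OF y] v by blast
      then show ?thesis
      proof cases
        case 1
        then have "F y v \<noteq> t" using near_Fy[OF t] inv v by auto
        then show ?thesis using nearT[OF 1 y t] inv v by simp
      next
        case 2
        then show ?thesis using near_blk[OF 2(1) True 2(2) t] v by simp
      qed
    next
      case False
      then show ?thesis
        using v nearT[OF _ y t, of v] F_R_closed[OF y v(1)] by (auto simp: near_def)
    qed
    moreover have "F y v \<noteq> y" using inv F_self[OF y] v by auto
    moreover have "F y v \<noteq> t" using near_Fy[OF t] inv v by auto
    ultimately show ?thesis using near_x[OF t] by auto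
  qed
  have F'_P: "F' t v = (if v = t then t else if v = x then y else if v = y then x
       else if near t v then F x v else F y v)" if "t \<in> P" "v < N" for t v
    using F'_new[OF that] by (simp add: near_def)
  have P_ne: "t \<noteq> x" "t \<noteq> y" "t < N" if "t \<in> P" for t using that PS PT x y lt_T by auto

  \<comment> \<open>All merged blocks see a remaining inner vertex \<open>s\<close> alike, which
    makes the collapsed tree consistent. If \<open>x\<close> did not see \<open>s\<close> as the
    neighbours of \<open>t\<close> do, then \<open>side_or\<close>, applied from \<open>x\<close>
    and from \<open>y\<close>, would put the same block behind \<open>t\<close> for both, against
    \<open>t \<in> P\<close>.\<close>
  have B_side: "blk (F u s) = blk (F x s)" if u: "u \<in> S" "blk u \<in> B" and s: "s \<in> T - P" for u s
  proof -
    have sT: "s \<in> T" using s by simp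
    have Fxt: "blk (F (F z t) s) = blk (F x s)" if t: "t \<in> P" and z: "z \<in> S" for t z
    proof -
      have tT: "t \<in> T" and ts: "t \<noteq> s" using t s PT by auto
      have "blk (F (F x t) s) = blk (F x s)"
        using side_or[OF x x x tT sT ts] side_or[OF y x x tT sT ts] t P_eq[OF s]
        unfolding P_def by auto
      then show ?thesis using side_F[OF z x tT sT ts] by simp
    qed
    consider "blk u = blk x" | "blk u = blk y" | z t where "t \<in> P" "z \<in> S" "blk u = blk (F z t)"
      using u(2) x y unfolding B_def by auto
    then show ?thesis
    proof cases
      case 1
      then show ?thesis using side_blk[OF u(1) x _ sT] by simp
    next
      case 2
      then show ?thesis using side_blk[OF u(1) y _ sT] P_eq[OF s] by simp
    next
      case 3
      then have "F z t \<in> S" using F_T PT by auto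
      then show ?thesis using side_blk[OF u(1) _ 3(3) sT] Fxt[OF 3(1,2)] by simp
    qed
  qed
  \<comment> \<open>Collapses the names in \<open>B\<close>; the axioms for the remaining inner
    vertices are first shown up to \<open>\<beta>\<close> for the old matchings.\<close>
  define \<beta> where "\<beta> b = (if b \<in> B then blk x else b)" for b
  have \<beta>: "\<beta> b = \<beta> c \<longleftrightarrow> b = c \<or> b \<in> B \<and> c \<in> B" for b c
    by (auto simp: \<beta>_def B_def)
  have \<beta>blk: "blk (F z s) = blk (F z' s)"
    if "z \<in> S" "z' \<in> S" "s \<in> T - P" "\<beta> (blk z) = \<beta> (blk z')" for z z' s
    using that side_blk[of z z' s] B_side[of z s] B_side[of z' s] unfolding \<beta> by auto
  have \<beta>ne: "\<beta> (blk (F z s)) \<noteq> \<beta> (blk z)" if "z \<in> S" "s \<in> T - P" for z s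
  proof
    assume eq: "\<beta> (blk (F z s)) = \<beta> (blk z)"
    have u: "F z s \<in> S" using F_T that by auto
    show False using \<beta>blk[OF u that(1,2) eq] side_ne[OF u, of s] that by auto
  qed
  \<comment> \<open>If the blocks behind \<open>s\<close> and \<open>t\<close> were identified, both
    would see \<open>s\<close> and \<open>t\<close> alike. By \<open>side_or\<close> the block
    behind \<open>t\<close>, say, would then have itself behind \<open>t\<close>, against
    \<open>side_ne\<close>.\<close>
  have \<beta>inj: "s = t" if z: "z \<in> S" and st: "s \<in> T - P" "t \<in> T - P"
    and eq: "\<beta> (blk (F z s)) = \<beta> (blk (F z t))" for z s t
  proof (rule ccontr)
    assume "s \<noteq> t"
    have T: "s \<in> T" "t \<in> T" using st by auto
    have u: "F z s \<in> S" "F z t \<in> S" using F_T[OF z] T by auto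
    show False
      using \<beta>blk[OF u(1,2) st(1) eq] \<beta>blk[OF u(1,2) st(2) eq] side_or[OF z z z T \<open>s \<noteq> t\<close>]
        side_ne[OF u(2) T(2)] side_ne[OF u(1) T(1)] by auto
  qed

  \<comment> \<open>A new outer vertex sees the remaining inner vertices as \<open>x\<close>
    does.\<close>
  define \<pi> where "\<pi> z = (if z \<in> P then x else z)" for z
  have \<pi>: "\<pi> z \<in> S" if "z \<in> S \<union> P" for z using that x by (auto simp: \<pi>_def)
  have bS: "blk' z = \<beta> (blk (\<pi> z))" if "z \<in> S \<union> P" for z
    using blk'[OF that] PS that by (auto simp: \<beta>_def \<pi>_def B_def)
  have F'T: "F' z s \<in> S" "blk (F' z s) = blk (F (\<pi> z) s)" if z: "z \<in> S \<union> P" and s: "s \<in> T - P" for z s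
  proof -
    have sN: "s < N" and ne: "s \<noteq> x" "s \<noteq> y" "s \<noteq> z" and sT: "s \<in> T"
      using s z lt_T x y disj by auto
    have "F' z s \<in> S \<and> blk (F' z s) = blk (F (\<pi> z) s)"
    proof (cases "z \<in> P")
      case True
      then show ?thesis using F'_P[OF True sN] ne F_T[OF x sT] F_T[OF y sT] P_eq[OF s]
        by (simp add: \<pi>_def)
    next
      case False
      then show ?thesis using z F'_old[OF _ sN, of z] F_T[OF _ sT, of z] by (simp add: \<pi>_def)
    qed
    then show "F' z s \<in> S" "blk (F' z s) = blk (F (\<pi> z) s)" by auto
  qed
  have gF: "blk' (F' z s) = \<beta> (blk (F (\<pi> z) s))" if "z \<in> S \<union> P" "s \<in> T - P" for z s
    using bS[of "F' z s"] F'T[OF that] PS by (auto simp: \<pi>_def)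
  have gFF: "blk' (F' (F' z s) t) = \<beta> (blk (F (F (\<pi> z) s) t))"
    if "z \<in> S \<union> P" "s \<in> T - P" "t \<in> T - P" for z s t
  proof -
    have "blk' (F' (F' z s) t) = \<beta> (blk (F (F' z s) t))"
      using gF[of "F' z s" t] F'T[OF that(1,2)] PS that(3) by (auto simp: \<pi>_def)
    also have "blk (F (F' z s) t) = blk (F (F (\<pi> z) s) t)"
      using side_blk[OF F'T(1)[OF that(1,2)] F_T[OF \<pi>[OF that(1)]] F'T(2)[OF that(1,2)]] that by auto
    finally show ?thesis .
  qed
  \<comment> \<open>By \<open>side_two\<close> only two blocks are next to \<open>t\<close>, and
    both were put into \<open>B\<close>.\<close>
  have FB: "F z t \<in> S \<and> blk (F z t) \<in> B" if "z \<in> S" "t \<in> P" for z t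
    using that F_T[OF that(1), of t] side_two[OF x y that(1), of t] PT
    unfolding B_def P_def by auto
  have F_S': "F z v \<noteq> v \<and> (F z v \<in> T - P \<or> F z v \<in> S \<union> P \<and> blk' (F z v) = blk' v)"
    if z: "z \<in> S" and v: "v \<in> S \<union> P" "v \<noteq> z" for z v
  proof (cases "v \<in> P")
    case True
    then show ?thesis using FB[OF z True] blk'[of v] blk'[of "F z v"] PS by auto
  next
    case False
    then have vS: "v \<in> S" using v by simp
    show ?thesis
    proof (cases "F z v \<in> P")
      case True
      then have "blk v \<in> B" using FB[OF z True] F_inv[OF z lt_S[OF vS]] by simp
      then show ?thesis using True blk'[of v] blk'[of "F z v"] v F_S[OF z vS v(2)] by simp
    next
      case False
      then show ?thesis
        using F_S[OF z vS v(2)] blk'[of v] blk'[of "F z v"] vS \<open>v \<notin> P\<close> by auto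
    qed
  qed
  show ?thesis
  proof unfold_locales
    show "S \<union> P \<subseteq> {..<N}" "T - P \<subseteq> {..<N}" "(S \<union> P) \<inter> (T - P) = {}"
      using S_sub T_sub PT disj by auto
    show "blk' z \<in> S \<union> P" if "z \<in> S \<union> P" for z
      using blk'[OF that] that blk_S x by auto
    fix z assume z: "z \<in> S \<union> P"
    have zN: "z < N" using z lt_S P_ne by auto
    show "F' z z = z"
      using z F'_old[OF _ zN, of z] F_self[of z] F'_P[OF _ zN, of z] by auto
    {
      fix v assume v: "v < N"
      show "F' z v < N"
        using z F'_old[OF _ v, of z] F'_P[OF _ v, of z] F_lt[OF _ v] x y xyN zN by auto
      show "F' z (F' z v) = v"
      proof (cases "z \<in> P")
        case True
        have "F' z v < N" by fact
        then show ?thesis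
          using F'_P[OF True v] F'_P[OF True, of "F' z v"] near_step[OF True v] far_step[OF True v]
            near_x[OF True] near_y[OF True] P_ne[OF True] xyne F_inv[OF x v] F_inv[OF y v] xyN
          by (auto split: if_splits)
      next
        case False
        then have "z \<in> S" using z by simp
        then show ?thesis using F'_old F_inv F_lt v by simp
      qed
      show "E v (F' z v)" if "F' z v \<noteq> v"
      proof (cases "z \<in> P")
        case True
        then show ?thesis using that F'_P[OF True v] F_E[OF x v] F_E[OF y v] E by (auto split: if_splits)
      next
        case False
        then show ?thesis using z that F'_old[OF _ v, of z] F_E[OF _ v, of z] by auto
      qed
      show "F' z v = M v" if "v \<notin> S \<union> P" "v \<notin> T - P"
      proof -
        have "v \<notin> S" "v \<notin> T" using that by auto
        then show ?thesis
          using z F'_old[OF _ v, of z] F'_P[OF _ v, of z] F_R[OF x v] F_R[OF y v] F_R[OF _ v, of z] x y that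
          by auto
      qed
    }
    {
      fix v assume v: "v \<in> S \<union> P" "v \<noteq> z"
      have vN: "v < N" using v lt_S P_ne by auto
      show "F' z v \<noteq> v \<and> (F' z v \<in> T - P \<or> F' z v \<in> S \<union> P \<and> blk' (F' z v) = blk' v)"
      proof (cases "z \<in> P")
        case True
        have "blk' x = blk x" "blk' y = blk x" using blk'[of x] blk'[of y] x y by (auto simp: B_def)
        then show ?thesis
          using F'_P[OF True vN] F_S'[OF x v(1)] F_S'[OF y v(1)] v(2) x y xyne by auto
      next
        case False
        then show ?thesis using z F'_old[OF _ vN, of z] F_S'[OF _ v] by auto
      qed
    }
    show "F' z t \<in> S \<union> P" if "t \<in> T - P" for t using F'T(1)[OF z that] by simp
    show "blk' (F' z t) \<noteq> blk' z" if "t \<in> T - P" for t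
      using \<beta>ne[OF \<pi>[OF z] that] by (simp only: gF[OF z that] bS[OF z] not_False_eq_True)
    show "blk' (F' z t) = blk' (F' z' t)"
      if "z' \<in> S \<union> P" "blk' z = blk' z'" "t \<in> T - P" for z' t
      using \<beta>blk[OF \<pi>[OF z] \<pi>[OF that(1)] that(3)] that(2)
      by (simp only: gF[OF z that(3)] gF[OF that(1,3)] bS[OF z] bS[OF that(1)])
    show "s = t" if "s \<in> T - P" "t \<in> T - P" "blk' (F' z s) = blk' (F' z t)" for s t
      using \<beta>inj[OF \<pi>[OF z] that(1,2)] that(3) by (simp only: gF[OF z that(1)] gF[OF z that(2)])
    show "blk' (F' z3 t) = blk' (F' z t) \<or> blk' (F' z3 t) = blk' (F' z2 t)"
      if "z2 \<in> S \<union> P" "z3 \<in> S \<union> P" "t \<in> T - P" "blk' (F' z t) \<noteq> blk' (F' z2 t)" for z2 z3 t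
      using side_two[OF \<pi>[OF z] \<pi>[OF that(1)] \<pi>[OF that(2)], of t] that(3,4)
      by (simp only: gF[OF z that(3)] gF[OF that(1,3)] gF[OF that(2,3)]) (metis DiffD1)
    show "blk' (F' (F' z s) t) = blk' (F' (F' z' s) t)"
      if "z' \<in> S \<union> P" "s \<in> T - P" "t \<in> T - P" "s \<noteq> t" for z' s t
      using side_F[OF \<pi>[OF z] \<pi>[OF that(1)], of s t] that
      by (simp only: gFF[OF z that(2,3)] gFF[OF that(1-3)]) simp
    show "blk' (F' z t) = blk' (F' (F' z1 s) t) \<or> blk' (F' z s) = blk' (F' (F' z2 t) s)"
      if "z1 \<in> S \<union> P" "z2 \<in> S \<union> P" "s \<in> T - P" "t \<in> T - P" "s \<noteq> t" for z1 z2 s t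
      using side_or[OF \<pi>[OF z] \<pi>[OF that(1)] \<pi>[OF that(2)], of s t] that(3-5)
      by (simp only: gF[OF z that(3)] gF[OF z that(4)] gFF[OF that(1,3,4)] gFF[OF that(2,4,3)]) auto
  qed
qed

end

section \<open>The gadget graph\<close>

definition color_adj :: "(nat \<times> nat \<times> nat) list \<Rightarrow> nat \<Rightarrow> nat \<Rightarrow> nat \<Rightarrow> bool" where
  "color_adj es c u v \<longleftrightarrow> (u, v, c) \<in> set es \<or> (v, u, c) \<in> set es"

definition in_color :: "(nat \<times> nat \<times> nat) list \<Rightarrow> nat \<Rightarrow> nat \<Rightarrow> bool" where
  "in_color es c u \<longleftrightarrow> (\<exists>v. color_adj es c u v)"

text \<open>In a complete multipartite class the part of \<open>u\<close> consists of its
  non-neighbours within the class. Their minimum names the part, so no list of parts has to be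
  computed.\<close>

definition part_rep :: "(nat \<times> nat \<times> nat) list \<Rightarrow> nat \<Rightarrow> nat \<Rightarrow> nat" where
  "part_rep es c u = (LEAST w. in_color es c w \<and> \<not> color_adj es c u w)"

text \<open>A port and a gate exist for every vertex \<open>w\<close>, not only for those that name
  a part, which gives all slots the same size. The port of a \<open>w\<close> that names no part has
  its gate as only neighbour, so the two are matched with each other.\<close>

datatype gvertex = Orig nat | Port nat nat nat | Gate nat nat nat | HubA nat nat | HubB nat nat | Dummy nat

lemma has_perfect_matching_bij:
  assumes c: "bij_betw c A B" and E: "\<And>x y. x \<in> A \<Longrightarrow> y \<in> A \<Longrightarrow> E x y \<longleftrightarrow> E' (c x) (c y)"
  shows "has_perfect_matching A E \<longleftrightarrow> has_perfect_matching B E'"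
proof
  define d where "d = inv_into A c"
  have d: "d x \<in> A" "c (d x) = x" if "x \<in> B" for x
    using that bij_betw_apply[OF bij_betw_inv_into[OF c]] bij_betw_inv_into_right[OF c]
    unfolding d_def by auto
  have dc: "d (c x) = x" "c x \<in> B" if "x \<in> A" for x
    using that bij_betw_inv_into_left[OF c] bij_betw_apply[OF c] unfolding d_def by auto
  {
    assume "has_perfect_matching A E"
    then obtain f where f: "\<And>v. v \<in> A \<Longrightarrow> f v \<in> A \<and> f (f v) = v \<and> f v \<noteq> v \<and> E v (f v)"
      unfolding has_perfect_matching_def by blast
    have "c (f (d v)) \<in> B \<and> c (f (d (c (f (d v))))) = v \<and> c (f (d v)) \<noteq> v \<and> E' v (c (f (d v)))"
      if "v \<in> B" for v
      using f[OF d(1)[OF that]] d[OF that] dc E[of "d v" "f (d v)"] by metis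
    then show "has_perfect_matching B E'" unfolding has_perfect_matching_def
      by (intro exI[of _ "\<lambda>v. c (f (d v))"]) blast
  next
    assume "has_perfect_matching B E'"
    then obtain f where f: "\<And>v. v \<in> B \<Longrightarrow> f v \<in> B \<and> f (f v) = v \<and> f v \<noteq> v \<and> E' v (f v)"
      unfolding has_perfect_matching_def by blast
    have "d (f (c v)) \<in> A \<and> d (f (c (d (f (c v))))) = v \<and> d (f (c v)) \<noteq> v \<and> E v (d (f (c v)))"
      if "v \<in> A" for v
      using f[OF dc(2)[OF that]] dc[OF that] d E[of v "d (f (c v))"] that by metis
    then show "has_perfect_matching A E" unfolding has_perfect_matching_def
      by (intro exI[of _ "\<lambda>v. d (f (c v))"]) blast
  }
qed

text \<open>\<open>part_trans\<close> is the form in which complete multipartiteness enters: within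
  a color class non-adjacency is transitive, and the parts are its equivalence classes.\<close>

locale gadget =
  fixes n K p :: nat and es :: "(nat \<times> nat \<times> nat) list" and m :: "nat \<Rightarrow> nat"
  assumes es_wf: "(u, v, c) \<in> set es \<Longrightarrow> u < n \<and> v < n \<and> u \<noteq> v \<and> c \<in> {1..K}"
    and part_trans: "\<lbrakk>c \<in> {1..K}; in_color es c u; in_color es c v; in_color es c w;
      \<not> color_adj es c u v; \<not> color_adj es c v w\<rbrakk> \<Longrightarrow> \<not> color_adj es c u w"
    and two_p: "2 * p \<le> n"
begin

text \<open>The index \<open>i < K\<close> stands for the color \<open>i + 1\<close>.\<close>

abbreviation adj :: "nat \<Rightarrow> nat \<Rightarrow> nat \<Rightarrow> bool" where "adj i \<equiv> color_adj es (Suc i)"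
abbreviation rep :: "nat \<Rightarrow> nat \<Rightarrow> nat" where "rep i \<equiv> part_rep es (Suc i)"

text \<open>Each color gets \<open>n\<close> slots whatever its bound, so the size does not depend
  on the possibly huge \<open>m i\<close>. A slot with \<open>m i \<le> k\<close> is closed because
  its ports have no edges to original vertices.\<close>

fun gvert :: "gvertex \<Rightarrow> bool" where
  "gvert (Orig u) \<longleftrightarrow> u < n"
| "gvert (Port i k w) \<longleftrightarrow> i < K \<and> k < n \<and> w < n"
| "gvert (Gate i k w) \<longleftrightarrow> i < K \<and> k < n \<and> w < n"
| "gvert (HubA i k) \<longleftrightarrow> i < K \<and> k < n"
| "gvert (HubB i k) \<longleftrightarrow> i < K \<and> k < n"
| "gvert (Dummy d) \<longleftrightarrow> d < n - 2 * p"

fun gedge :: "gvertex \<Rightarrow> gvertex \<Rightarrow> bool" where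
  "gedge (Port i k w) (Gate j l v) \<longleftrightarrow> i = j \<and> k = l \<and> w = v"
| "gedge (Gate i k w) (HubA j l) \<longleftrightarrow> i = j \<and> k = l"
| "gedge (Gate i k w) (HubB j l) \<longleftrightarrow> i = j \<and> k = l"
| "gedge (HubA i k) (HubB j l) \<longleftrightarrow> i = j \<and> k = l"
| "gedge (Orig u) (Port i k w) \<longleftrightarrow> k < m i \<and> in_color es (Suc i) u \<and> w = rep i u"
| "gedge (Dummy d) (Orig u) \<longleftrightarrow> True"
| "gedge _ _ \<longleftrightarrow> False"

definition gadj :: "gvertex \<Rightarrow> gvertex \<Rightarrow> bool" where
  "gadj x y \<longleftrightarrow> gedge x y \<or> gedge y x"

text \<open>The common middle between both matching problems: \<open>p\<close> disjoint edges, each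
  assigned to a slot of its color. Distinct slots below \<open>m i\<close> express the bound of the
  color.\<close>

definition slots :: "(nat \<times> nat) set \<Rightarrow> (nat \<times> nat \<Rightarrow> nat) \<Rightarrow> (nat \<times> nat \<Rightarrow> nat) \<Rightarrow> bool" where
  "slots X P Q \<longleftrightarrow> X \<subseteq> {..<K} \<times> {..<n} \<and> card X = p \<and>
     (\<forall>(i, k)\<in>X. k < m i \<and> adj i (P (i, k)) (Q (i, k))) \<and>
     (\<forall>s\<in>X. \<forall>t\<in>X. s \<noteq> t \<longrightarrow> {P s, Q s} \<inter> {P t, Q t} = {})"

section \<open>Parts of a color class, and perfect matchings of the gadget graph\<close>

lemma adj_sym: "color_adj es c u v \<Longrightarrow> color_adj es c v u"
  by (auto simp: color_adj_def)

lemma adj_D: "color_adj es c u v \<Longrightarrow> u < n \<and> v < n \<and> u \<noteq> v \<and> c \<in> {1..K}"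
  using es_wf by (fastforce simp: color_adj_def)

lemma adj_in_color: "color_adj es c u v \<Longrightarrow> in_color es c u \<and> in_color es c v"
  using adj_sym by (auto simp: in_color_def)

lemma in_color_D: "in_color es c u \<Longrightarrow> u < n \<and> c \<in> {1..K}"
  using adj_D by (auto simp: in_color_def)

lemma part_rep:
  assumes "in_color es c u"
  shows "in_color es c (part_rep es c u)" "\<not> color_adj es c u (part_rep es c u)" "part_rep es c u < n"
proof -
  have "in_color es c (part_rep es c u) \<and> \<not> color_adj es c u (part_rep es c u)"
    unfolding part_rep_def by (rule LeastI[of _ u]) (use assms adj_D in auto)
  then show "in_color es c (part_rep es c u)" "\<not> color_adj es c u (part_rep es c u)" "part_rep es c u < n"
    using in_color_D by auto
qed

text \<open>Non-adjacency is an equivalence on the class, so non-adjacent vertices have the same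
  non-neighbours. Hence two original vertices use different ports of a slot exactly when its color
  joins them.\<close>

lemma part_rep_eq_iff:
  assumes u: "in_color es c u" and v: "in_color es c v"
  shows "part_rep es c u = part_rep es c v \<longleftrightarrow> \<not> color_adj es c u v"
proof
  have c: "c \<in> {1..K}" using in_color_D u by blast
  show "\<not> color_adj es c u v" if "part_rep es c u = part_rep es c v"
    using part_rep[OF u] part_rep[OF v] part_trans[OF c u _ v] adj_sym that by metis
  assume "\<not> color_adj es c u v"
  then have "in_color es c w \<and> \<not> color_adj es c u w \<longleftrightarrow> in_color es c w \<and> \<not> color_adj es c v w" for w
    using part_trans[OF c u v] part_trans[OF c v u] adj_sym by metis
  then show "part_rep es c u = part_rep es c v" unfolding part_rep_def by presburger
qed

text \<open>In a used slot the hubs take the gates of the parts of \<open>P\<close> and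
  \<open>Q\<close>, whose ports become free for these two vertices; adjacency makes the parts
  different. This covers exactly \<open>2 * p\<close> original vertices, and the others are as many
  as the dummies.\<close>

lemma perfect_matching_of_slots:
  assumes "slots X P Q"
  shows "has_perfect_matching {x. gvert x} gadj"
proof -
  have X: "X \<subseteq> {..<K} \<times> {..<n}" and cX: "card X = p"
    and XD: "\<And>i k. (i, k) \<in> X \<Longrightarrow> k < m i \<and> adj i (P (i, k)) (Q (i, k))"
    and dis: "\<And>s t. s \<in> X \<Longrightarrow> t \<in> X \<Longrightarrow> s \<noteq> t \<Longrightarrow> {P s, Q s} \<inter> {P t, Q t} = {}"
    using assms unfolding slots_def by auto
  have finX: "finite X" using X by (rule finite_subset) auto
  define C where "C = (\<Union>s\<in>X. {P s, Q s})"
  have "card C = (\<Sum>s\<in>X. card {P s, Q s})"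
    unfolding C_def using finX dis by (intro card_UN_disjoint) auto
  also have "\<dots> = (\<Sum>s\<in>X. 2)"
    using XD adj_D by (intro sum.cong refl) (fastforce simp: card_2_iff)
  finally have cC: "card C = 2 * p" using cX by simp
  have Cn: "C \<subseteq> {..<n}" unfolding C_def using XD adj_D by force
  define U where "U = {..<n} - C"
  have "card U = n - 2 * p" unfolding U_def using cC Cn by (simp add: card_Diff_subset finite_subset)
  then obtain h where h: "bij_betw h U {..<n - 2 * p}"
    by (metis U_def card_lessThan finite_Diff finite_lessThan finite_same_card_bij)
  define g where "g = inv_into U h"
  have gh: "g (h u) = u" if "u \<in> U" for u
    using bij_betw_inv_into_left[OF h that] by (simp add: g_def)
  have hg: "h (g d) = d" if "d < n - 2 * p" for d
    using bij_betw_inv_into_right[OF h] that by (simp add: g_def)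
  have hU: "h u < n - 2 * p" if "u \<in> U" for u using bij_betw_apply[OF h that] by simp
  have gU: "g d \<in> U" if "d < n - 2 * p" for d
    using bij_betw_apply[OF bij_betw_inv_into[OF h]] that by (simp add: g_def)
  define sl where "sl u = (THE s. s \<in> X \<and> u \<in> {P s, Q s})" for u
  have sl: "sl (P s) = s" "sl (Q s) = s" if "s \<in> X" for s
    unfolding sl_def using dis that by (blast intro: the_equality)+
  define a where "a i k = rep i (P (i, k))" for i k
  define b where "b i k = rep i (Q (i, k))" for i k
  have ab: "a i k \<noteq> b i k" "a i k < n" "b i k < n" "P (i, k) \<in> C" "Q (i, k) \<in> C" "k < m i"
    "P (i, k) < n" "Q (i, k) < n" "in_color es (Suc i) (P (i, k))" "in_color es (Suc i) (Q (i, k))"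
    "i < K" "k < n" if "(i, k) \<in> X" for i k
    using part_rep_eq_iff[of "Suc i" "P (i, k)" "Q (i, k)"] XD[OF that] adj_in_color part_rep(3)
      adj_D X that unfolding a_def b_def C_def by (blast | force)+
  define f where "f x = (case x of
      Orig u \<Rightarrow> if u \<in> C then case sl u of (i, k) \<Rightarrow> Port i k (rep i u) else Dummy (h u)
    | Port i k w \<Rightarrow> if (i, k) \<in> X \<and> w = a i k then Orig (P (i, k))
        else if (i, k) \<in> X \<and> w = b i k then Orig (Q (i, k)) else Gate i k w
    | Gate i k w \<Rightarrow> if (i, k) \<in> X \<and> w = a i k then HubA i k
        else if (i, k) \<in> X \<and> w = b i k then HubB i k else Port i k w
    | HubA i k \<Rightarrow> if (i, k) \<in> X then Gate i k (a i k) else HubB i k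
    | HubB i k \<Rightarrow> if (i, k) \<in> X then Gate i k (b i k) else HubA i k
    | Dummy d \<Rightarrow> Orig (g d))" for x
  have CE: "\<exists>i k. (i, k) \<in> X \<and> (u = P (i, k) \<or> u = Q (i, k))" if "u \<in> C" for u
    using that unfolding C_def by auto
  have "gvert (f x) \<and> f (f x) = x \<and> f x \<noteq> x \<and> gadj x (f x)" if "gvert x" for x
  proof (cases x)
    case (Orig u)
    show ?thesis
    proof (cases "u \<in> C")
      case True
      then obtain i k where ik: "(i, k) \<in> X" "u = P (i, k) \<or> u = Q (i, k)" using CE by blast
      then have "sl u = (i, k)" using sl by auto
      then show ?thesis using Orig ik True ab[OF ik(1)]
        by (auto simp: f_def gadj_def a_def b_def)
    next
      case False
      then have "u \<in> U" using that Orig by (simp add: U_def)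
      then show ?thesis using Orig False gh hU by (auto simp: f_def gadj_def)
    qed
  next
    case (Port i k w)
    then show ?thesis using that ab[of i k] sl[of "(i, k)"] by (auto simp: f_def gadj_def a_def b_def)
  next
    case (Dummy d)
    then have "g d \<in> U" using gU that by simp
    then show ?thesis using Dummy that hg by (auto simp: f_def gadj_def U_def)
  qed (use that ab ab(1)[symmetric] in \<open>auto simp: f_def gadj_def\<close>)
  then show ?thesis unfolding has_perfect_matching_def by blast
qed

text \<open>A slot is used if its hubs are not matched with each other. Then both hubs take gates,
  and the ports of these gates are left to original vertices of two different parts. Conversely, an
  original vertex at a port pushes the gate to a hub, so every original vertex outside of the used
  slots meets a dummy.\<close>

lemma slots_of_perfect_matching:
  assumes "has_perfect_matching {x. gvert x} gadj"
  obtains X P Q where "slots X P Q"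
proof -
  obtain f where f: "\<And>x. gvert x \<Longrightarrow> gvert (f x) \<and> f (f x) = x \<and> f x \<noteq> x \<and> gadj x (f x)"
    using assms unfolding has_perfect_matching_def by auto
  have gnb: "f (HubA i k) = HubB i k \<or> (\<exists>w<n. f (HubA i k) = Gate i k w)"
    "f (HubB i k) = HubA i k \<or> (\<exists>w<n. f (HubB i k) = Gate i k w)" if "i < K" "k < n" for i k
    using f[of "HubA i k"] f[of "HubB i k"] that
    by (cases "f (HubA i k)"; cases "f (HubB i k)"; auto simp: gadj_def)+
  have pnb: "f (Port i k w) = Gate i k w \<or>
      (\<exists>u<n. f (Port i k w) = Orig u \<and> k < m i \<and> in_color es (Suc i) u \<and> w = rep i u)"
    if "i < K" "k < n" "w < n" for i k w
    using f[of "Port i k w"] that by (cases "f (Port i k w)") (auto simp: gadj_def)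
  have onb: "(\<exists>d<n - 2 * p. f (Orig u) = Dummy d) \<or>
     (\<exists>i k w. i < K \<and> k < n \<and> w < n \<and> f (Orig u) = Port i k w)" if "u < n" for u
    using f[of "Orig u"] that by (cases "f (Orig u)") (auto simp: gadj_def)
  have dnb: "\<exists>u<n. f (Dummy d) = Orig u" if "d < n - 2 * p" for d
    using f[of "Dummy d"] that by (cases "f (Dummy d)") (auto simp: gadj_def)
  have tnb: "f (Gate i k w) = Port i k w \<or> f (Gate i k w) = HubA i k \<or> f (Gate i k w) = HubB i k"
    if "i < K" "k < n" "w < n" for i k w
    using f[of "Gate i k w"] that by (cases "f (Gate i k w)") (auto simp: gadj_def)
  define X where "X = {(i, k). i < K \<and> k < n \<and> f (HubA i k) \<noteq> HubB i k}"
  have "\<exists>P Q. P < n \<and> Q < n \<and> k < m i \<and> in_color es (Suc i) P \<and> in_color es (Suc i) Q \<and>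
      rep i P \<noteq> rep i Q \<and> f (HubA i k) = Gate i k (rep i P) \<and> f (HubB i k) = Gate i k (rep i Q) \<and>
      f (Port i k (rep i P)) = Orig P \<and> f (Port i k (rep i Q)) = Orig Q"
    if "(i, k) \<in> X" for i k
  proof -
    have ik: "i < K" "k < n" "f (HubA i k) \<noteq> HubB i k" using that by (auto simp: X_def)
    then have "f (HubB i k) \<noteq> HubA i k" using f[of "HubB i k"] by auto
    then obtain w1 w2 where w: "w1 < n" "w2 < n" "f (HubA i k) = Gate i k w1" "f (HubB i k) = Gate i k w2"
      using gnb[OF ik(1,2)] ik(3) by auto
    then have fG: "f (Gate i k w1) = HubA i k" "f (Gate i k w2) = HubB i k"
      using f[of "HubA i k"] f[of "HubB i k"] ik by auto
    then have "f (Port i k w1) \<noteq> Gate i k w1" "f (Port i k w2) \<noteq> Gate i k w2"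
      using f[of "Port i k w1"] f[of "Port i k w2"] ik w by auto
    then obtain u1 u2 where "u1 < n" "f (Port i k w1) = Orig u1" "k < m i" "in_color es (Suc i) u1"
      "w1 = rep i u1" "u2 < n" "f (Port i k w2) = Orig u2" "in_color es (Suc i) u2" "w2 = rep i u2"
      using pnb[OF ik(1,2) w(1)] pnb[OF ik(1,2) w(2)] by auto
    moreover have "w1 \<noteq> w2" using fG by auto
    ultimately show ?thesis using w by metis
  qed
  then obtain P0 Q0 where PQ0: "\<And>i k. (i, k) \<in> X \<Longrightarrow> P0 i k < n \<and> Q0 i k < n \<and> k < m i \<and>
      in_color es (Suc i) (P0 i k) \<and> in_color es (Suc i) (Q0 i k) \<and> rep i (P0 i k) \<noteq> rep i (Q0 i k) \<and>
      f (HubA i k) = Gate i k (rep i (P0 i k)) \<and> f (HubB i k) = Gate i k (rep i (Q0 i k)) \<and>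
      f (Port i k (rep i (P0 i k))) = Orig (P0 i k) \<and> f (Port i k (rep i (Q0 i k))) = Orig (Q0 i k)"
    by metis
  define P where "P = case_prod P0"
  define Q where "Q = case_prod Q0"
  have PQ: "P (i, k) < n" "Q (i, k) < n" "k < m i"
      "in_color es (Suc i) (P (i, k))" "in_color es (Suc i) (Q (i, k))" "rep i (P (i, k)) \<noteq> rep i (Q (i, k))"
      "f (HubA i k) = Gate i k (rep i (P (i, k)))" "f (HubB i k) = Gate i k (rep i (Q (i, k)))"
      "f (Port i k (rep i (P (i, k)))) = Orig (P (i, k))" "f (Port i k (rep i (Q (i, k)))) = Orig (Q (i, k))"
      "i < K" "k < n"
    if "(i, k) \<in> X" for i k
    using PQ0[OF that] that unfolding P_def Q_def X_def by auto
  have adjX: "adj i (P (i, k)) (Q (i, k))" if "(i, k) \<in> X" for i k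
    using part_rep_eq_iff[OF PQ(4,5)[OF that]] PQ(6)[OF that] by blast
  have fO: "\<exists>w. f (Orig u) = Port i k w" if "(i, k) \<in> X" "u = P (i, k) \<or> u = Q (i, k)" for i k u
    using that f[of "Port i k (rep i u)"] PQ[OF that(1)] part_rep(3) by auto
  have dis: "{P s, Q s} \<inter> {P t, Q t} = {}" if "s \<in> X" "t \<in> X" "s \<noteq> t" for s t
  proof (rule ccontr)
    assume "{P s, Q s} \<inter> {P t, Q t} \<noteq> {}"
    then obtain u where u: "u = P s \<or> u = Q s" "u = P t \<or> u = Q t" by blast
    show False
      using fO[of "fst s" "snd s" u] fO[of "fst t" "snd t" u] u that by (auto simp: prod_eq_iff)
  qed
  have XS: "X \<subseteq> {..<K} \<times> {..<n}" by (auto simp: X_def)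
  then have finX: "finite X" by (rule finite_subset) auto
  define C where "C = (\<Union>s\<in>X. {P s, Q s})"
  have "card C = (\<Sum>s\<in>X. card {P s, Q s})"
    unfolding C_def using finX dis by (intro card_UN_disjoint) auto
  also have "\<dots> = (\<Sum>s\<in>X. 2)"
    using adjX adj_D by (intro sum.cong refl) (fastforce simp: card_2_iff)
  finally have cC: "card C = 2 * card X" by simp
  have Cn: "C \<subseteq> {..<n}" unfolding C_def using PQ(1,2) by force
  define U where "U = {..<n} - C"
  have outC: "\<exists>d<n - 2 * p. f (Orig u) = Dummy d" if u: "u < n" "u \<notin> C" for u
  proof (rule ccontr)
    assume "\<not> ?thesis"
    then obtain i k w where w: "i < K" "k < n" "w < n" "f (Orig u) = Port i k w" using onb[OF u(1)] by blast
    then have fP: "f (Port i k w) = Orig u" using f[of "Orig u"] u by auto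
    then have "f (Gate i k w) \<noteq> Port i k w" using f[of "Gate i k w"] w by auto
    then consider "f (Gate i k w) = HubA i k" | "f (Gate i k w) = HubB i k" using tnb[OF w(1-3)] by blast
    then show False
    proof cases
      case 1
      then have "f (HubA i k) = Gate i k w" using f[of "Gate i k w"] w by auto
      moreover from this have X: "(i, k) \<in> X" using w by (simp add: X_def)
      ultimately have "u = P (i, k)" using fP PQ[OF X] by auto
      then show False using u X unfolding C_def by blast
    next
      case 2
      then have *: "f (HubB i k) = Gate i k w" using f[of "Gate i k w"] w by auto
      then have X: "(i, k) \<in> X" using w f[of "HubA i k"] by (auto simp: X_def)
      then have "u = Q (i, k)" using fP * PQ[OF X] by auto
      then show False using u X unfolding C_def by blast
    qed
  qed
  \<comment> \<open>The uncovered original vertices and the dummies are exchanged by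
    \<open>f\<close>. The number \<open>n - 2 * p\<close> of dummies thereby determines the number
    of used slots.\<close>
  have "bij_betw f (Orig ` U) (Dummy ` {..<n - 2 * p})"
  proof (rule bij_betw_byWitness[where f' = f])
    show "\<forall>a\<in>Orig ` U. f (f a) = a" using f by (auto simp: U_def)
    show "\<forall>a\<in>Dummy ` {..<n - 2 * p}. f (f a) = a" using f by auto
    show "f ` Orig ` U \<subseteq> Dummy ` {..<n - 2 * p}" using outC by (auto simp: U_def)
    show "f ` Dummy ` {..<n - 2 * p} \<subseteq> Orig ` U"
    proof clarify
      fix d assume d: "d < n - 2 * p"
      then obtain u where u: "u < n" "f (Dummy d) = Orig u" using dnb by blast
      then have "f (Orig u) = Dummy d" using f[of "Dummy d"] d by auto
      then have "u \<notin> C" using fO unfolding C_def by fastforce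
      then show "f (Dummy d) \<in> Orig ` U" using u by (simp add: U_def)
    qed
  qed
  then have "card (Orig ` U) = card (Dummy ` {..<n - 2 * p})" by (rule bij_betw_same_card)
  then have "card U = n - 2 * p" by (simp add: card_image inj_on_def)
  moreover have "card U = n - card C"
    unfolding U_def using Cn by (simp add: card_Diff_subset finite_subset)
  moreover have "card C \<le> n" using card_mono[OF _ Cn] by simp
  ultimately have "card X = p" using cC two_p by simp
  then have "slots X P Q" unfolding slots_def using XS PQ(3) adjX dis by auto
  then show thesis by (rule that)
qed

lemma perfect_matching_iff_slots:
  "has_perfect_matching {x. gvert x} gadj \<longleftrightarrow> (\<exists>X P Q. slots X P Q)"
  using perfect_matching_of_slots slots_of_perfect_matching by metis

section \<open>Numbering of the gadget vertices\<close>

definition offset :: "nat \<Rightarrow> nat \<Rightarrow> nat" where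
  "offset i k = n + (i * n + k) * (2 * n + 2)"

definition dummy_offset :: nat where "dummy_offset = n + K * n * (2 * n + 2)"

definition gsize :: nat where "gsize = dummy_offset + (n - 2 * p)"

text \<open>A slot occupies \<open>2 * n + 2\<close> consecutive numbers for its ports, its gates
  and the two hubs. Slots follow each other by color and index, so a program reaches the next one by
  adding a constant.\<close>

fun code :: "gvertex \<Rightarrow> nat" where
  "code (Orig u) = u"
| "code (Port i k w) = offset i k + w"
| "code (Gate i k w) = offset i k + n + w"
| "code (HubA i k) = offset i k + 2 * n"
| "code (HubB i k) = offset i k + 2 * n + 1"
| "code (Dummy d) = dummy_offset + d"

definition decode :: "nat \<Rightarrow> gvertex" where
  "decode x = (if x < n then Orig x else if x < dummy_offset then
     (let q = (x - n) div (2 * n + 2); r = (x - n) mod (2 * n + 2); i = q div n; k = q mod n in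
      if r < n then Port i k r else if r < 2 * n then Gate i k (r - n)
      else if r = 2 * n then HubA i k else HubB i k)
     else Dummy (x - dummy_offset))"

lemma offset_bound:
  assumes "i < K" "k < n" "r < 2 * n + 2" shows "offset i k + r < dummy_offset"
proof -
  have "i * n + k < Suc i * n" using assms(2) by simp
  also have "\<dots> \<le> K * n" using assms(1) by (intro mult_le_mono1) simp
  finally have "i * n + k < K * n" .
  then have "(i * n + k + 1) * (2 * n + 2) \<le> K * n * (2 * n + 2)" by (intro mult_le_mono1) simp
  then show ?thesis using assms(3) by (simp add: offset_def dummy_offset_def)
qed

lemma decode_offset:
  assumes "i < K" "k < n" "r < 2 * n + 2"
  shows "decode (offset i k + r) = (if r < n then Port i k r else if r < 2 * n then Gate i k (r - n)
      else if r = 2 * n then HubA i k else HubB i k)"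
proof -
  have "offset i k + r - n = r + (i * n + k) * (2 * n + 2)" "\<not> offset i k + r < n"
    by (simp_all add: offset_def)
  moreover have "(r + (i * n + k) * (2 * n + 2)) div (2 * n + 2) = i * n + k"
    "(r + (i * n + k) * (2 * n + 2)) mod (2 * n + 2) = r"
    using assms(3) by (simp_all del: mult_Suc_right add_2_eq_Suc' add_2_eq_Suc)
  moreover have "(i * n + k) div n = i" "(i * n + k) mod n = k" using assms(2) by simp_all
  ultimately show ?thesis
    using offset_bound[OF assms] unfolding decode_def Let_def by presburger
qed

lemma bij_code: "bij_betw code {x. gvert x} {..<gsize}"
proof (rule bij_betw_byWitness[where f' = decode])
  show "\<forall>x\<in>{x. gvert x}. decode (code x) = x"
  proof clarify
    fix x assume "gvert x"
    then show "decode (code x) = x"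
    proof (cases x)
      case (Gate i k w)
      then show ?thesis using \<open>gvert x\<close> decode_offset[of i k "n + w"] by (simp add: add.assoc)
    next
      case (HubB i k)
      then show ?thesis using \<open>gvert x\<close> decode_offset[of i k "2 * n + 1"] by (simp add: add.assoc)
    next
      case (Port i k w)
      then show ?thesis using \<open>gvert x\<close> decode_offset[of i k w] by simp
    next
      case (HubA i k)
      then show ?thesis using \<open>gvert x\<close> decode_offset[of i k "2 * n"] by simp
    qed (auto simp: decode_def dummy_offset_def)
  qed
  have dec: "gvert (decode x) \<and> code (decode x) = x" if x: "x < gsize" for x
  proof -
    consider "x < n" | "n \<le> x" "x < dummy_offset" | "dummy_offset \<le> x" by linarith
    then show ?thesis
    proof cases
      case 2
      define q where "q = (x - n) div (2 * n + 2)"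
      define r where "r = (x - n) mod (2 * n + 2)"
      have "x - n < (K * n) * (2 * n + 2)" using 2 by (simp add: dummy_offset_def)
      then have q: "q < K * n" unfolding q_def by (rule less_mult_imp_div_less)
      then have n0: "0 < n" by (cases n) auto
      have ik: "q div n < K" "q mod n < n" using q n0 by (simp_all add: less_mult_imp_div_less)
      have r: "r < 2 * n + 2" by (simp add: r_def)
      have "x = n + q * (2 * n + 2) + r"
        using 2 unfolding q_def r_def by (metis add.assoc div_mult_mod_eq le_add_diff_inverse)
      then have "x = offset (q div n) (q mod n) + r" by (simp add: offset_def)
      then show ?thesis using decode_offset[OF ik r] ik r by auto
    qed (use x in \<open>auto simp: decode_def gsize_def dummy_offset_def\<close>)
  qed
  show "\<forall>x\<in>{..<gsize}. code (decode x) = x" using dec by auto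
  show "decode ` {..<gsize} \<subseteq> {x. gvert x}" using dec by auto
  show "code ` {x. gvert x} \<subseteq> {..<gsize}"
  proof (rule image_subsetI)
    fix x assume "x \<in> {x. gvert x}"
    then have "gvert x" by simp
    then show "code x \<in> {..<gsize}"
    proof (cases x)
      case (Gate i k w)
      then show ?thesis using \<open>gvert x\<close> offset_bound[of i k "n + w"] by (simp add: add.assoc gsize_def)
    next
      case (HubB i k)
      then show ?thesis using \<open>gvert x\<close> offset_bound[of i k "2 * n + 1"] by (simp add: add.assoc gsize_def)
    next
      case (Port i k w)
      then show ?thesis using \<open>gvert x\<close> offset_bound[of i k w] by (simp add: gsize_def)
    next
      case (HubA i k)
      then show ?thesis using \<open>gvert x\<close> offset_bound[of i k "2 * n"] by (simp add: gsize_def)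
    qed (auto simp: gsize_def dummy_offset_def)
  qed
qed

text \<open>One direction of each edge, relative to the base address \<open>a\<close> of the slot,
  in the shape in which the program writes them.\<close>

definition slot_edges :: "nat \<Rightarrow> nat \<Rightarrow> nat \<Rightarrow> (nat \<times> nat) set" where
  "slot_edges i k a = (\<Union>w\<in>{..<n}. {(a + w, a + n + w), (a + n + w, a + 2 * n), (a + n + w, a + 2 * n + 1)})
     \<union> {(a + 2 * n, a + 2 * n + 1)}
     \<union> (\<Union>u\<in>{u. u < n \<and> in_color es (Suc i) u \<and> k < m i}. {(u, a + rep i u)})"

definition all_edges :: "(nat \<times> nat) set" where
  "all_edges = (\<Union>i\<in>{..<K}. \<Union>k\<in>{..<n}. slot_edges i k (offset i k))
     \<union> (\<Union>d\<in>{..<n - 2 * p}. \<Union>u\<in>{..<n}. {(dummy_offset + d, u)})"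

lemma all_edges_eq: "all_edges = {(code x, code y) |x y. gvert x \<and> gvert y \<and> gedge x y}"
proof (intro equalityI subsetI)
  fix e assume "e \<in> {(code x, code y) |x y. gvert x \<and> gvert y \<and> gedge x y}"
  then obtain x y where "e = (code x, code y)" "gvert x" "gvert y" "gedge x y" by blast
  then show "e \<in> all_edges"
    by (cases "(x, y)" rule: gedge.cases) (auto simp: all_edges_def slot_edges_def)
next
  have I: "(code x, code y) \<in> {(code x, code y) |x y. gvert x \<and> gvert y \<and> gedge x y}"
    if "gvert x" "gvert y" "gedge x y" for x y using that by blast
  fix e assume "e \<in> all_edges"
  then consider
    i k w where "i < K" "k < n" "w < n" "e = (code (Port i k w), code (Gate i k w))"
    | i k w where "i < K" "k < n" "w < n" "e = (code (Gate i k w), code (HubA i k))"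
    | i k w where "i < K" "k < n" "w < n" "e = (code (Gate i k w), code (HubB i k))"
    | i k where "i < K" "k < n" "e = (code (HubA i k), code (HubB i k))"
    | i k u where "i < K" "k < n" "u < n" "in_color es (Suc i) u" "k < m i"
      "e = (code (Orig u), code (Port i k (rep i u)))"
    | d u where "d < n - 2 * p" "u < n" "e = (code (Dummy d), code (Orig u))"
    unfolding all_edges_def slot_edges_def by auto
  then show "e \<in> {(code x, code y) |x y. gvert x \<and> gvert y \<and> gedge x y}"
  proof cases
    case (5 i k u)
    then show ?thesis using I[of "Orig u" "Port i k (rep i u)"] part_rep(3) by simp
  next
    case (1 i k w) then show ?thesis using I[of "Port i k w" "Gate i k w"] by simp
  next
    case (2 i k w) then show ?thesis using I[of "Gate i k w" "HubA i k"] by simp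
  next
    case (3 i k w) then show ?thesis using I[of "Gate i k w" "HubB i k"] by simp
  next
    case (4 i k) then show ?thesis using I[of "HubA i k" "HubB i k"] by simp
  next
    case (6 d u) then show ?thesis using I[of "Dummy d" "Orig u"] by simp
  qed
qed

lemma has_perfect_matching_code:
  "has_perfect_matching {..<gsize} (\<lambda>x y. (x, y) \<in> all_edges \<union> all_edges\<inverse>) \<longleftrightarrow> (\<exists>X P Q. slots X P Q)"
proof -
  have inj: "gvert x \<Longrightarrow> gvert y \<Longrightarrow> code x = code y \<Longrightarrow> x = y" for x y
    using bij_code by (auto simp: bij_betw_def inj_on_def)
  have "gadj x y \<longleftrightarrow> (code x, code y) \<in> all_edges \<union> all_edges\<inverse>" if "gvert x" "gvert y" for x y
    unfolding all_edges_eq gadj_def using that inj by blast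
  then show ?thesis
    using has_perfect_matching_bij[OF bij_code, of gadj "\<lambda>x y. (x, y) \<in> all_edges \<union> all_edges\<inverse>"]
      perfect_matching_iff_slots by simp
qed

end

section \<open>From instances to slots\<close>

lemma color_class_graph_of:
  "adjacent (color_class (graph_of I) c) u v \<longleftrightarrow> color_adj (edge_list I) c u v"
  "verts (color_class (graph_of I) c) = {u. in_color (edge_list I) c u}"
proof -
  define a where "a j = fst (edge_list I ! j)" for j
  define b where "b j = fst (snd (edge_list I ! j))" for j
  define d where "d j = snd (snd (edge_list I ! j))" for j
  have nth: "edge_list I ! j = (a j, b j, d j)" for j by (simp add: a_def b_def d_def)
  have adj: "color_adj (edge_list I) c u v \<longleftrightarrow>
      (\<exists>j<length (edge_list I). d j = c \<and> {a j, b j} = {u, v})" for u v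
    unfolding color_adj_def in_set_conv_nth nth doubleton_eq_iff by auto
  show "adjacent (color_class (graph_of I) c) u v \<longleftrightarrow> color_adj (edge_list I) c u v"
    unfolding adj by (auto simp: adjacent_def color_class_def graph_of_def nth)
  show "verts (color_class (graph_of I) c) = {u. in_color (edge_list I) c u}"
    unfolding in_color_def adj by (auto simp: color_class_def graph_of_def nth doubleton_eq_iff)
qed

text \<open>Vertices of a class that are not adjacent lie in the same part, which yields
  \<open>part_trans\<close>; end point sets of size 2 exclude loops.\<close>

lemma gadget_of_instance:
  assumes I: "I \<in> grm_instances" "strictly_CM_colored (graph_of I)" and p: "2 * p \<le> nverts I"
  shows "gadget (nverts I) (length (bounds I)) p (edge_list I)"
proof
  show "u < nverts I \<and> v < nverts I \<and> u \<noteq> v \<and> c \<in> {1..length (bounds I)}"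
    if e: "(u, v, c) \<in> set (edge_list I)" for u v c
  proof -
    obtain j where j: "j < length (edge_list I)" "edge_list I ! j = (u, v, c)"
      using e by (metis in_set_conv_nth)
    have "\<forall>j\<in>edges (graph_of I). ends (graph_of I) j \<subseteq> verts (graph_of I) \<and> card (ends (graph_of I) j) = 2 \<and>
        col (graph_of I) j \<in> {1..ncolors (graph_of I)}"
      using I(1) by (simp add: grm_instances_def wf_ecgraph_def)
    from this[rule_format, of j] have "{u, v} \<subseteq> {..<nverts I} \<and> card {u, v} = 2 \<and> c \<in> {1..length (bounds I)}"
      using j by (simp add: graph_of_def)
    then show ?thesis by (cases "u = v") auto
  qed
  fix c u v w
  assume c: "c \<in> {1..length (bounds I)}"
    and uvw: "in_color (edge_list I) c u" "in_color (edge_list I) c v" "in_color (edge_list I) c w"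
    and n: "\<not> color_adj (edge_list I) c u v" "\<not> color_adj (edge_list I) c v w"
  have "complete_multipartite (color_class (graph_of I) c)"
    using I(2) c by (simp add: strictly_CM_colored_def graph_of_def)
  then obtain PP where PP: "partition_on {u. in_color (edge_list I) c u} PP"
    "\<forall>A\<in>PP. \<forall>u\<in>A. \<forall>v\<in>A. \<not> color_adj (edge_list I) c u v"
    "\<forall>A\<in>PP. \<forall>B\<in>PP. A \<noteq> B \<longrightarrow> (\<forall>u\<in>A. \<forall>v\<in>B. color_adj (edge_list I) c u v)"
    unfolding complete_multipartite_def color_class_graph_of by (elim exE conjE)
  have "\<exists>A\<in>PP. z \<in> A" if "in_color (edge_list I) c z" for z
    using partition_onD1[OF PP(1)] that by auto
  then obtain A B C where "A \<in> PP" "u \<in> A" "B \<in> PP" "v \<in> B" "C \<in> PP" "w \<in> C" using uvw by metis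
  then show "\<not> color_adj (edge_list I) c u w" using n PP(2,3) by metis
qed (rule p)

text \<open>The edges of a matching are numbered within their colors to obtain slots. Conversely an
  edge is picked for every slot: parallel edges make this a choice, and disjoint ends make it
  injective.\<close>

lemma grm_yes_iff_slots:
  assumes I: "I \<in> grm_instances" "strictly_CM_colored (graph_of I)" and p: "2 * p \<le> nverts I"
    and t: "target I = int p"
  shows "grm_yes I \<longleftrightarrow> (\<exists>X P Q. gadget.slots (nverts I) (length (bounds I)) p (edge_list I) ((!) (bounds I)) X P Q)"
proof -
  interpret gadget "nverts I" "length (bounds I)" p "edge_list I" "(!) (bounds I)"
    by (rule gadget_of_instance[OF I p])
  define a where "a j = fst (edge_list I ! j)" for j
  define b where "b j = fst (snd (edge_list I ! j))" for j
  define c where "c j = snd (snd (edge_list I ! j))" for j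
  have nth: "edge_list I ! j = (a j, b j, c j)" for j by (simp add: a_def b_def c_def)
  have ends: "ends (graph_of I) j = {a j, b j}" and col: "col (graph_of I) j = c j" for j
    by (simp_all add: graph_of_def nth)
  have E: "edges (graph_of I) = {..<length (edge_list I)}" and K: "ncolors (graph_of I) = length (bounds I)"
    by (simp_all add: graph_of_def)
  have wf: "a j < nverts I \<and> b j < nverts I \<and> a j \<noteq> b j \<and> c j \<in> {1..length (bounds I)}"
    and adj_ab: "color_adj (edge_list I) (c j) (a j) (b j)"
    if "j < length (edge_list I)" for j
    using es_wf[of "a j" "b j" "c j"] nth[of j] nth_mem[OF that] by (auto simp: color_adj_def)
  show ?thesis
  proof
    assume "grm_yes I"
    then obtain M where M: "matching (graph_of I) M" "p \<le> card M"
      "\<And>i. i \<in> {1..length (bounds I)} \<Longrightarrow> card {e \<in> M. c e = i} \<le> bounds I ! (i - 1)"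
      unfolding grm_yes_def has_generalized_rainbow_matching_def bound_of_def col K t by auto
    have MD: "M \<subseteq> {..<length (edge_list I)}" "disjoint_family_on (\<lambda>j. {a j, b j}) M"
      using M(1) unfolding matching_def E ends by (auto simp: disjoint_family_on_def ends)
    \<comment> \<open>The matching may be larger than \<open>p\<close>, but the dummies enforce
      exactly \<open>p\<close> edges; a subset still respects the bounds.\<close>
    obtain L where L: "L \<subseteq> M" "card L = p" "finite L" using M(2) by (rule obtain_subset_with_card_n)
    have finM: "finite M" using MD(1) by (rule finite_subset) simp
    have disL: "{a i, b i} \<inter> {a j, b j} = {}" if "i \<in> L" "j \<in> L" "i \<noteq> j" for i j
      using MD(2) that L(1) unfolding disjoint_family_on_def by blast
    define LC where "LC i = {e \<in> L. c e = i}" for i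
    have "\<exists>h. bij_betw h (LC i) {0..<card (LC i)}" for i
      using L(3) by (intro ex_bij_betw_finite_nat) (simp add: LC_def)
    then obtain h where h: "\<And>i. bij_betw (h i) (LC i) {0..<card (LC i)}" by metis
    \<comment> \<open>The \<open>n\<close> slots of a color are enough, as disjoint edges have
      distinct first end points.\<close>
    have Ln: "card (LC i) \<le> nverts I" for i
    proof -
      have "inj_on a (LC i)" using disL by (fastforce simp: inj_on_def LC_def)
      moreover have "a ` LC i \<subseteq> {..<nverts I}" using wf MD(1) L(1) by (auto simp: LC_def)
      ultimately show ?thesis by (metis card_inj_on_le card_lessThan finite_lessThan)
    qed
    have Lm: "card (LC i) \<le> bounds I ! (i - 1)" if "i \<in> {1..length (bounds I)}" for i
      using M(3)[OF that] card_mono[of "{e \<in> M. c e = i}" "LC i"] finM L(1)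
      by (force simp: LC_def)
    define \<phi> where "\<phi> e = (c e - 1, h (c e) e)" for e
    have Lwf: "a j < nverts I \<and> b j < nverts I \<and> a j \<noteq> b j \<and> c j \<in> {1..length (bounds I)}"
      if "j \<in> L" for j using wf that L(1) MD(1) by blast
    have inj: "inj_on \<phi> L"
    proof (rule inj_onI)
      fix e f assume ef: "e \<in> L" "f \<in> L" "\<phi> e = \<phi> f"
      then have c: "c e = c f" using Lwf[of e] Lwf[of f] by (auto simp: \<phi>_def)
      then have "e \<in> LC (c e)" "f \<in> LC (c e)" using ef by (auto simp: LC_def)
      then show "e = f" using h[of "c e"] ef(3) c by (auto simp: bij_betw_def inj_on_def \<phi>_def)
    qed
    have h_lt: "h (c e) e < card (LC (c e))" if "e \<in> L" for e
      using bij_betw_apply[OF h, of e "c e"] that by (simp add: LC_def)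
    define \<psi> where "\<psi> = inv_into L \<phi>"
    have \<psi>: "\<psi> (\<phi> e) = e" if "e \<in> L" for e using inj that by (simp add: \<psi>_def)
    have "slots (\<phi> ` L) (a \<circ> \<psi>) (b \<circ> \<psi>)"
      unfolding slots_def
    proof (intro conjI ballI impI)
      show "\<phi> ` L \<subseteq> {..<length (bounds I)} \<times> {..<nverts I}"
        using Lwf h_lt Ln by (fastforce simp: \<phi>_def intro: less_le_trans)
      show "card (\<phi> ` L) = p" using inj L(2) by (simp add: card_image)
    next
      fix s assume "s \<in> \<phi> ` L"
      then obtain e where e: "e \<in> L" "s = \<phi> e" by blast
      have "h (c e) e < bounds I ! (c e - 1)" using h_lt[OF e(1)] Lm Lwf[OF e(1)] less_le_trans by blast
      moreover have "color_adj (edge_list I) (Suc (c e - 1)) (a e) (b e)"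
        using adj_ab[of e] e(1) L(1) MD(1) Lwf[OF e(1)] by auto
      ultimately show "case s of (i, k) \<Rightarrow> k < bounds I ! i \<and> adj i ((a \<circ> \<psi>) (i, k)) ((b \<circ> \<psi>) (i, k))"
        using \<psi>[OF e(1)] e(2) by (simp add: \<phi>_def)
    next
      fix s t assume "s \<in> \<phi> ` L" "t \<in> \<phi> ` L" "s \<noteq> t"
      then show "{(a \<circ> \<psi>) s, (b \<circ> \<psi>) s} \<inter> {(a \<circ> \<psi>) t, (b \<circ> \<psi>) t} = {}"
        using \<psi> disL by fastforce
    qed
    then show "\<exists>X P Q. slots X P Q" by blast
  next
    assume "\<exists>X P Q. slots X P Q"
    then obtain X P Q where sl: "slots X P Q" by blast
    then have X: "X \<subseteq> {..<length (bounds I)} \<times> {..<nverts I}" "card X = p"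
      "\<And>i k. (i, k) \<in> X \<Longrightarrow> k < bounds I ! i \<and> adj i (P (i, k)) (Q (i, k))"
      "\<And>s t. s \<in> X \<Longrightarrow> t \<in> X \<Longrightarrow> s \<noteq> t \<Longrightarrow> {P s, Q s} \<inter> {P t, Q t} = {}"
      unfolding slots_def by auto
    have "\<exists>j<length (edge_list I). {a j, b j} = {P s, Q s} \<and> c j = Suc (fst s)" if s: "s \<in> X" for s
    proof -
      have "color_adj (edge_list I) (Suc (fst s)) (P s) (Q s)" using X(3)[of "fst s" "snd s"] s by simp
      then have "\<exists>j<length (edge_list I). edge_list I ! j = (P s, Q s, Suc (fst s)) \<or>
          edge_list I ! j = (Q s, P s, Suc (fst s))"
        unfolding color_adj_def in_set_conv_nth by blast
      then show ?thesis unfolding nth by auto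
    qed
    then obtain J where J: "\<And>s. s \<in> X \<Longrightarrow> J s < length (edge_list I) \<and>
        {a (J s), b (J s)} = {P s, Q s} \<and> c (J s) = Suc (fst s)" by metis
    have inj: "inj_on J X"
    proof (rule inj_onI)
      fix s t assume "s \<in> X" "t \<in> X" "J s = J t"
      then have "{P s, Q s} \<inter> {P t, Q t} \<noteq> {}" using J by (metis Int_absorb insert_not_empty)
      then show "s = t" using X(4) \<open>s \<in> X\<close> \<open>t \<in> X\<close> by blast
    qed
    have finX: "finite X" using X(1) by (rule finite_subset) simp
    have "matching (graph_of I) (J ` X)"
      unfolding matching_def E disjoint_family_on_def ends
    proof (intro conjI ballI impI)
      show "J ` X \<subseteq> {..<length (edge_list I)}" using J by auto
      fix i j assume "i \<in> J ` X" "j \<in> J ` X" "i \<noteq> j"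
      then obtain s t where "s \<in> X" "t \<in> X" "i = J s" "j = J t" "s \<noteq> t" by blast
      then show "{a i, b i} \<inter> {a j, b j} = {}" using X(4)[of s t] J[of s] J[of t] by simp
    qed
    moreover have "card (J ` X) = p" using inj X(2) by (simp add: card_image)
    moreover have "card {e \<in> J ` X. c e = i} \<le> bounds I ! (i - 1)" if "i \<in> {1..length (bounds I)}" for i
    proof -
      \<comment> \<open>The edges of color \<open>i\<close> come from the slots with color index
        \<open>i - 1\<close>, one for each admissible \<open>k\<close>.\<close>
      have "{e \<in> J ` X. c e = i} \<subseteq> (\<lambda>k. J (i - 1, k)) ` {..<bounds I ! (i - 1)}"
      proof
        fix e assume "e \<in> {e \<in> J ` X. c e = i}"
        then obtain j k where jk: "(j, k) \<in> X" "e = J (j, k)" "c e = i" by auto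
        then have "j = i - 1" using J[OF jk(1)] by simp
        then show "e \<in> (\<lambda>k. J (i - 1, k)) ` {..<bounds I ! (i - 1)}"
          using X(3)[OF jk(1)] jk(2) by auto
      qed
      then have "card {e \<in> J ` X. c e = i} \<le> card ((\<lambda>k. J (i - 1, k)) ` {..<bounds I ! (i - 1)})"
        by (intro card_mono) auto
      also have "\<dots> \<le> bounds I ! (i - 1)" using card_image_le[of "{..<bounds I ! (i - 1)}"] by simp
      finally show ?thesis .
    qed
    ultimately show "grm_yes I"
      unfolding grm_yes_def has_generalized_rainbow_matching_def bound_of_def col K t by auto
  qed
qed

section \<open>Bounded loop programs\<close>

text \<open>With bounded loops only, running times need no reasoning about particular programs:
  \<open>cost\<close> is read off the syntax, and correctness is proved for the function
  \<open>run\<close>.\<close>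

datatype prog =
    PSkip
  | PAssign string aexp aexp
  | PSeq prog prog
  | PCond bexp prog prog
  | PFor string string prog

abbreviation reg :: "string \<Rightarrow> aexp" where "reg x \<equiv> Read x (Const 0)"

primrec writes :: "prog \<Rightarrow> string set" where
  "writes PSkip = {}"
| "writes (PAssign x a e) = {x}"
| "writes (PSeq c d) = writes c \<union> writes d"
| "writes (PCond t c d) = writes c \<union> writes d"
| "writes (PFor i x c) = insert i (writes c)"

text \<open>The register \<open>b\<close> bounds the number of iterations of every loop and is never written, so that
  the running time is a polynomial in its value.\<close>

primrec wf_prog :: "string \<Rightarrow> prog \<Rightarrow> bool" where
  "wf_prog b PSkip \<longleftrightarrow> True"
| "wf_prog b (PAssign x a e) \<longleftrightarrow> x \<noteq> b"
| "wf_prog b (PSeq c d) \<longleftrightarrow> wf_prog b c \<and> wf_prog b d"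
| "wf_prog b (PCond t c d) \<longleftrightarrow> wf_prog b c \<and> wf_prog b d"
| "wf_prog b (PFor i x c) \<longleftrightarrow> wf_prog b c \<and> i \<noteq> b \<and> i \<noteq> x \<and> i \<notin> writes c \<and> x \<notin> writes c"

text \<open>The cut at register \<open>b\<close> ties all loops to one value. Correctness proofs
  show for each loop that its limit does not exceed this value, so that the cut has no effect
  there.\<close>

primrec run :: "string \<Rightarrow> prog \<Rightarrow> state \<Rightarrow> state" where
  "run b PSkip s = s"
| "run b (PAssign x a e) s = s(x := (s x)(aval a s := aval e s))"
| "run b (PSeq c d) s = run b d (run b c s)"
| "run b (PCond t c d) s = (if bval t s then run b c s else run b d s)"
| "run b (PFor i x c) s =
     fold (\<lambda>k s. (run b c s)(i := (run b c s i)(0 := Suc k))) [0..<min (s x 0) (s b 0)]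
       (s(i := (s i)(0 := 0)))"

primrec compile :: "string \<Rightarrow> prog \<Rightarrow> com" where
  "compile b PSkip = Skip"
| "compile b (PAssign x a e) = Assign x a e"
| "compile b (PSeq c d) = Seq (compile b c) (compile b d)"
| "compile b (PCond t c d) = Cond t (compile b c) (compile b d)"
| "compile b (PFor i x c) = Seq (Assign i (Const 0) (Const 0))
     (While (And (Less (reg i) (reg x)) (Less (reg i) (reg b)))
       (Seq (compile b c) (Assign i (Const 0) (Plus (reg i) (Const 1)))))"

text \<open>The argument is the value of the bound register. A round costs the body, one test and
  one increment; the initialization and the last test add 2, which is covered by the two extra
  rounds in \<open>[:2, 1:]\<close>.\<close>

primrec cost :: "prog \<Rightarrow> nat poly" where
  "cost PSkip = 1"
| "cost (PAssign x a e) = 1"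
| "cost (PSeq c d) = cost c + cost d"
| "cost (PCond t c d) = 1 + cost c + cost d"
| "cost (PFor i x c) = [:2, 1:] * (cost c + 2)"

lemma run_frame: "y \<notin> writes c \<Longrightarrow> run b c s y = s y"
proof (induction c arbitrary: s)
  case (PFor i x c)
  have "fold (\<lambda>k s. (run b c s)(i := (run b c s i)(0 := Suc k))) ks s y = s y" for ks s
    by (induction ks arbitrary: s) (use PFor in auto)
  then show ?case using PFor.prems by simp
qed auto

lemma wf_prog_writes: "wf_prog b c \<Longrightarrow> b \<notin> writes c"
  by (induction c) auto

text \<open>The induction rule for loops. The counter value and the arrays that the body does not
  write are supplied along with the invariant, so \<open>P\<close> can concentrate on what
  changes.\<close>

lemma run_For:
  assumes "wf_prog b (PFor i x c)"
    and "m = min (s x 0) (s b 0)"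
    and "P 0 (s(i := (s i)(0 := 0)))"
    and step: "\<And>k s'. \<lbrakk>k < m; P k s'; s' i 0 = k; \<And>y. y \<notin> insert i (writes c) \<Longrightarrow> s' y = s y\<rbrakk> \<Longrightarrow>
      P (Suc k) ((run b c s')(i := (run b c s' i)(0 := Suc k)))"
  shows "P m (run b (PFor i x c) s)"
proof -
  define f where "f = (\<lambda>k s. (run b c s)(i := (run b c s i)(0 := Suc k)))"
  have st: "P (Suc k) (f k s')"
    if "k < m" "P k s'" "s' i 0 = k" "\<And>y. y \<notin> insert i (writes c) \<Longrightarrow> s' y = s y" for k s'
    unfolding f_def by (rule step[OF that])
  define s0 where "s0 = s(i := (s i)(0 := 0))"
  have "P k (fold f [0..<k] s0) \<and> fold f [0..<k] s0 i 0 = k \<and>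
      (\<forall>y. y \<notin> insert i (writes c) \<longrightarrow> fold f [0..<k] s0 y = s y)" if "k \<le> m" for k
    using that
  proof (induction k)
    case 0
    then show ?case using assms(3) unfolding s0_def by (simp del: fun_upd_apply) simp
  next
    case (Suc k)
    let ?s = "fold f [0..<k] s0"
    have "fold f [0..<Suc k] s0 = f k ?s" by simp
    moreover have "P (Suc k) (f k ?s)" by (rule st) (use Suc in auto)
    moreover have "f k ?s y = ?s y" if "y \<notin> insert i (writes c)" for y
      using that by (auto simp: f_def run_frame)
    moreover have "f k ?s i 0 = Suc k" by (simp add: f_def)
    ultimately show ?case using Suc by auto
  qed
  from this[of m] show ?thesis using assms(2) unfolding run.simps f_def s0_def by blast
qed

text \<open>As \<open>b\<close> is never written, all subprograms and all rounds are charged with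
  the same value \<open>s b 0\<close>.\<close>

lemma exec_compile:
  "wf_prog b c \<Longrightarrow> \<exists>t. exec (compile b c) s t (run b c s) \<and> t \<le> poly (cost c) (s b 0)"
proof (induction c arbitrary: s)
  case (PSeq c d)
  then have "b \<notin> writes c" using wf_prog_writes by auto
  then have "run b c s b = s b" by (rule run_frame)
  then obtain t u where "exec (compile b c) s t (run b c s)" "t \<le> poly (cost c) (s b 0)"
    "exec (compile b d) (run b c s) u (run b d (run b c s))" "u \<le> poly (cost d) (s b 0)"
    using PSeq.IH(1)[of s] PSeq.IH(2)[of "run b c s"] PSeq.prems by auto
  then show ?case by (intro exI[of _ "t + u"]) (auto intro: exec_Seq)
next
  case (PCond t c d)
  show ?case
  proof (cases "bval t s")
    case True
    obtain u where "exec (compile b c) s u (run b c s)" "u \<le> poly (cost c) (s b 0)"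
      using PCond by auto
    then show ?thesis using exec_CondTrue[where c = "compile b c"] True by (intro exI[of _ "1 + u"]) auto
  next
    case False
    obtain u where "exec (compile b d) s u (run b d s)" "u \<le> poly (cost d) (s b 0)"
      using PCond by auto
    then show ?thesis using exec_CondFalse[where d = "compile b d"] False by (intro exI[of _ "1 + u"]) auto
  qed
next
  case (PFor i x c)
  have wf: "wf_prog b c" "i \<noteq> b" "i \<noteq> x" "i \<notin> writes c" "x \<notin> writes c" "b \<notin> writes c"
    using PFor.prems wf_prog_writes by auto
  define f where "f = (\<lambda>k s. (run b c s)(i := (run b c s i)(0 := Suc k)))"
  define w where "w = While (And (Less (reg i) (reg x)) (Less (reg i) (reg b)))
       (Seq (compile b c) (Assign i (Const 0) (Plus (reg i) (Const 1))))"
  define C where "C = poly (cost c) (s b 0) + 2"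
  define m where "m = min (s x 0) (s b 0)"
  have loop: "\<exists>t. exec w s' t (fold f [k..<m] s') \<and> t \<le> 1 + (m - k) * C"
    if "k \<le> m" "s' i 0 = k" "s' x = s x" "s' b = s b" for k s'
    using that
  proof (induction "m - k" arbitrary: k s')
    case 0
    then have "exec w s' 1 s'" unfolding w_def by (intro exec_WhileFalse) (auto simp: m_def)
    then show ?case using 0 by auto
  next
    case (Suc d)
    then have km: "k < m" by simp
    have fr: "run b c s' i = s' i" "run b c s' x = s' x" "run b c s' b = s' b"
      using wf run_frame by auto
    obtain t where t: "exec (compile b c) s' t (run b c s')" "t \<le> poly (cost c) (s' b 0)"
      using PFor.IH[OF wf(1)] by blast
    have "exec (Assign i (Const 0) (Plus (reg i) (Const 1))) (run b c s') 1 (f k s')"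
      using exec_Assign[of i "Const 0" "Plus (reg i) (Const 1)" "run b c s'"] Suc.prems(2) fr(1)
      by (simp add: f_def)
    with t(1) have body: "exec (Seq (compile b c) (Assign i (Const 0) (Plus (reg i) (Const 1)))) s' (t + 1) (f k s')"
      by (rule exec_Seq)
    have "\<exists>u. exec w (f k s') u (fold f [Suc k..<m] (f k s')) \<and> u \<le> 1 + (m - Suc k) * C"
      by (rule Suc.hyps(1)) (use Suc fr wf km in \<open>auto simp: f_def\<close>)
    then obtain u where u: "exec w (f k s') u (fold f [Suc k..<m] (f k s'))" "u \<le> 1 + (m - Suc k) * C"
      by blast
    have "exec w s' (1 + (t + 1) + u) (fold f [Suc k..<m] (f k s'))"
      unfolding w_def
      by (rule exec_WhileTrue[OF _ body u(1)[unfolded w_def]])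
        (use Suc.prems km in \<open>simp add: m_def\<close>)
    moreover have "1 + (t + 1) \<le> C" using t(2) Suc.prems(4) by (simp add: C_def)
    moreover have "m - k = Suc (m - Suc k)" using km by simp
    ultimately show ?case using u(2) km
      by (intro exI[of _ "1 + (t + 1) + u"]) (simp add: upt_conv_Cons)
  qed
  define s0 where "s0 = s(i := (s i)(0 := 0))"
  have "\<exists>t. exec w s0 t (fold f [0..<m] s0) \<and> t \<le> 1 + (m - 0) * C"
    by (rule loop) (use wf in \<open>auto simp: s0_def\<close>)
  then obtain t where t: "exec w s0 t (fold f [0..<m] s0)" "t \<le> 1 + m * C" by auto
  have "exec (Assign i (Const 0) (Const 0)) s 1 s0"
    using exec_Assign[of i "Const 0" "Const 0" s] by (simp add: s0_def)
  from exec_Seq[OF this t(1)]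
  have "exec (compile b (PFor i x c)) s (1 + t) (run b (PFor i x c) s)"
    unfolding compile.simps run.simps w_def f_def m_def s0_def .
  moreover have "m * C \<le> s b 0 * C" by (simp add: m_def)
  then have "1 + t \<le> poly (cost (PFor i x c)) (s b 0)"
    using t(2) by (simp add: C_def algebra_simps)
  ultimately show ?case by blast
qed (auto intro: exec.intros)

declare run.simps(5) [simp del]

lemma poly_nat_mono:
  fixes q :: "nat poly" assumes "m \<le> n" shows "poly q m \<le> poly q n"
  by (induction q) (use assms in \<open>auto intro: add_mono mult_mono\<close>)

section \<open>Derived tests and matrix addressing\<close>

definition Eq :: "aexp \<Rightarrow> aexp \<Rightarrow> bexp" where
  "Eq a b = And (Not (Less a b)) (Not (Less b a))"

definition Or :: "bexp \<Rightarrow> bexp \<Rightarrow> bexp" where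
  "Or a b = Not (And (Not a) (Not b))"

lemma bval_Eq [simp]: "bval (Eq a b) s \<longleftrightarrow> aval a s = aval b s"
  and bval_Or [simp]: "bval (Or c d) s \<longleftrightarrow> bval c s \<or> bval d s"
  by (auto simp: Eq_def Or_def)

abbreviation runB :: "prog \<Rightarrow> state \<Rightarrow> state" where "runB \<equiv> run ''B''"

lemma row_eq_iff:
  fixes N :: nat
  assumes "v < N" "v' < N" shows "u * N + v = u' * N + v' \<longleftrightarrow> u = u' \<and> v = v'"
proof
  assume eq: "u * N + v = u' * N + v'"
  have "u = (u * N + v) div N" "u' = (u' * N + v') div N" using assms by auto
  then have "u = u'" unfolding eq by simp
  then show "u = u' \<and> v = v'" using eq by simp
qed simp

definition env :: "nat \<Rightarrow> state \<Rightarrow> bool" where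
  "env N s \<longleftrightarrow> s ''N'' 0 = N \<and> N \<le> s ''B'' 0 \<and> (\<forall>u<N. s ''row'' u = u * N)"

abbreviation at2 :: "string \<Rightarrow> aexp \<Rightarrow> aexp \<Rightarrow> aexp" where
  "at2 X a c \<equiv> Read X (Plus (Read ''row'' a) c)"

abbreviation set2 :: "string \<Rightarrow> aexp \<Rightarrow> aexp \<Rightarrow> aexp \<Rightarrow> prog" where
  "set2 X a c e \<equiv> PAssign X (Plus (Read ''row'' a) c) e"

abbreviation setr :: "string \<Rightarrow> aexp \<Rightarrow> prog" where
  "setr x e \<equiv> PAssign x (Const 0) e"

abbreviation (input) pseq :: "prog \<Rightarrow> prog \<Rightarrow> prog" (infixr \<open>;;\<close> 60) where
  "c ;; d \<equiv> PSeq c d"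

section \<open>Programs of the matching search\<close>

text \<open>For loops in which round \<open>k\<close> writes just the entry \<open>A k\<close> of
  \<open>X\<close>. The body may rely on old values in entries not yet written or never written,
  which is enough for updates in place.\<close>

lemma run_fill:
  fixes b i x c s m A g
  defines "s' \<equiv> run b (PFor i x c) s"
  assumes wf: "wf_prog b (PFor i x c)"
    and m: "m = min (s x 0) (s b 0)"
    and inj: "inj_on A {..<m}"
    and X: "X \<noteq> i"
    and body: "\<And>k s'. \<lbrakk>k < m; s' i 0 = k; \<And>y. y \<notin> insert i (writes c) \<Longrightarrow> s' y = s y;
        \<And>j. k \<le> j \<Longrightarrow> j < m \<Longrightarrow> s' X (A j) = s X (A j); \<And>a. a \<notin> A ` {..<m} \<Longrightarrow> s' X a = s X a\<rbrakk> \<Longrightarrow>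
        run b c s' X (A k) = g k \<and> (\<forall>a. a \<noteq> A k \<longrightarrow> run b c s' X a = s' X a)"
  shows "k < m \<Longrightarrow> s' X (A k) = g k" "a \<notin> A ` {..<m} \<Longrightarrow> s' X a = s X a"
proof -
  define P where "P k s' \<longleftrightarrow> (\<forall>j<m. s' X (A j) = (if j < k then g j else s X (A j))) \<and>
      (\<forall>a. a \<notin> A ` {..<m} \<longrightarrow> s' X a = s X a)" for k s'
  have "P m s'"
    unfolding s'_def
  proof (rule run_For[where P = P, OF wf])
    show "m = min (s x 0) (s b 0)" by (rule m)
    show "P 0 (s(i := (s i)(0 := 0)))" using X by (simp add: P_def)
  next
    fix k t
    assume k: "k < m" and P: "P k t" and t: "t i 0 = k" "\<And>y. y \<notin> insert i (writes c) \<Longrightarrow> t y = s y"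
    have *: "run b c t X (A k) = g k \<and> (\<forall>a. a \<noteq> A k \<longrightarrow> run b c t X a = t X a)"
      by (rule body[OF k t]) (use P in \<open>auto simp: P_def\<close>)
    have "A j = A k \<longleftrightarrow> j = k" if "j < m" for j using inj that k by (auto simp: inj_on_def)
    then show "P (Suc k) ((run b c t)(i := (run b c t i)(0 := Suc k)))"
      using * P X k unfolding P_def by (auto simp: less_Suc_eq)
  qed
  then show "k < m \<Longrightarrow> s' X (A k) = g k" "a \<notin> A ` {..<m} \<Longrightarrow> s' X a = s X a"
    by (auto simp: P_def)
qed

lemma envD: "env N s \<Longrightarrow> s ''N'' 0 = N" "env N s \<Longrightarrow> min N (s ''B'' 0) = N"
  "env N s \<Longrightarrow> u < N \<Longrightarrow> s ''row'' u = u * N"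
  by (auto simp: env_def)

text \<open>Matrices are stored by rows: entry \<open>(u, v)\<close> has the address \<open>row[u] + v\<close>. In \<open>st\<close>, the values 0, 1, 2 mean
  unreached, outer, inner. A fixed point of the involution \<open>M\<close> is an unmatched vertex. The flag \<open>dn\<close>
  ends a phase; \<open>mk\<close> and \<open>pb\<close> mark the inner vertices and the blocks to be merged.\<close>

abbreviation root_body :: prog where
  "root_body \<equiv> PCond (Eq (Read ''M'' (reg ''v'')) (reg ''v''))
       (setr ''dn'' (Const 0) ;; setr ''r'' (reg ''v'')) PSkip"

definition find_root :: prog where
  "find_root = setr ''dn'' (Const 1) ;;
     PFor ''v'' ''N'' root_body"

definition init_search :: prog where
  "init_search = PFor ''v'' ''N'' (PAssign ''st'' (reg ''v'') (Const 0)) ;;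
     PFor ''v'' ''N'' (set2 ''F'' (reg ''r'') (reg ''v'') (Read ''M'' (reg ''v''))) ;;
     PAssign ''st'' (reg ''r'') (Const 1) ;; PAssign ''blk'' (reg ''r'') (reg ''r'')"

abbreviation edge_body :: prog where
  "edge_body \<equiv> PCond
       (And (And (Eq (Read ''st'' (reg ''u'')) (Const 1)) (Not (Eq (at2 ''adj'' (reg ''u'') (reg ''v'')) (Const 0))))
         (And (Not (Eq (Read ''st'' (reg ''v'')) (Const 2)))
           (Not (And (Eq (Read ''st'' (reg ''v'')) (Const 1))
              (Eq (Read ''blk'' (reg ''u'')) (Read ''blk'' (reg ''v'')))))))
       (setr ''fd'' (Const 1) ;; setr ''x'' (reg ''u'') ;; setr ''y'' (reg ''v'')) PSkip"

text \<open>There is no early exit: the last suitable pair remains in \<open>x\<close> and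
  \<open>y\<close>.\<close>

definition find_edge :: prog where
  "find_edge = setr ''fd'' (Const 0) ;;
     PFor ''u'' ''N'' (PFor ''v'' ''N'' edge_body)"

definition augment_prog :: prog where
  "augment_prog = PFor ''v'' ''N'' (PAssign ''M'' (reg ''v'') (at2 ''F'' (reg ''x'') (reg ''v''))) ;;
     PAssign ''M'' (reg ''x'') (reg ''y'') ;; PAssign ''M'' (reg ''y'') (reg ''x'') ;; setr ''dn'' (Const 1)"

definition grow_prog :: prog where
  "grow_prog = PFor ''v'' ''N'' (set2 ''F'' (reg ''w'') (reg ''v'') (at2 ''F'' (reg ''x'') (reg ''v''))) ;;
     set2 ''F'' (reg ''w'') (reg ''w'') (reg ''w'') ;;
     set2 ''F'' (reg ''w'') (reg ''x'') (reg ''y'') ;;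
     set2 ''F'' (reg ''w'') (reg ''y'') (reg ''x'') ;;
     PAssign ''st'' (reg ''w'') (Const 1) ;; PAssign ''st'' (reg ''y'') (Const 2) ;;
     PAssign ''blk'' (reg ''w'') (reg ''w'')"

abbreviation "blkF a c \<equiv> Read ''blk'' (at2 ''F'' a c)"

abbreviation near_test :: bexp where
  "near_test \<equiv> Or (And (Eq (Read ''st'' (reg ''v'')) (Const 1))
              (Eq (blkF (reg ''v'') (reg ''t'')) (blkF (reg ''x'') (reg ''t''))))
           (And (Eq (Read ''st'' (reg ''v'')) (Const 2))
              (Eq (blkF (at2 ''F'' (reg ''x'') (reg ''v'')) (reg ''t'')) (blkF (reg ''x'') (reg ''t''))))"

abbreviation row_body :: prog where
  "row_body \<equiv> PCond near_test
       (set2 ''F'' (reg ''t'') (reg ''v'') (at2 ''F'' (reg ''x'') (reg ''v'')))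
       (set2 ''F'' (reg ''t'') (reg ''v'') (at2 ''F'' (reg ''y'') (reg ''v'')))"

text \<open>The loop treats \<open>x\<close>, \<open>y\<close> and \<open>t\<close> like any other
  column; their entries are corrected afterwards.\<close>

definition new_row :: prog where
  "new_row = PFor ''v'' ''N'' row_body ;;
     set2 ''F'' (reg ''t'') (reg ''y'') (reg ''x'') ;;
     set2 ''F'' (reg ''t'') (reg ''x'') (reg ''y'') ;;
     set2 ''F'' (reg ''t'') (reg ''t'') (reg ''t'')"

abbreviation mark_body :: prog where
  "mark_body \<equiv> PCond
       (And (Eq (Read ''st'' (reg ''t'')) (Const 2))
         (Not (Eq (blkF (reg ''x'') (reg ''t'')) (blkF (reg ''y'') (reg ''t'')))))
       (PAssign ''mk'' (reg ''t'') (Const 1)) (PAssign ''mk'' (reg ''t'') (Const 0))"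

definition mark_prog :: prog where
  "mark_prog = PFor ''t'' ''N'' mark_body"

abbreviation blocks_body :: prog where
  "blocks_body \<equiv> PCond (Eq (Read ''mk'' (reg ''t'')) (Const 0)) PSkip
       (PAssign ''pb'' (blkF (reg ''x'') (reg ''t'')) (Const 1) ;;
        PAssign ''pb'' (blkF (reg ''y'') (reg ''t'')) (Const 1))"

definition blocks_prog :: prog where
  "blocks_prog = PFor ''v'' ''N'' (PAssign ''pb'' (reg ''v'') (Const 0)) ;;
     PAssign ''pb'' (Read ''blk'' (reg ''x'')) (Const 1) ;;
     PAssign ''pb'' (Read ''blk'' (reg ''y'')) (Const 1) ;;
     PFor ''t'' ''N'' blocks_body"

abbreviation rows_body :: prog where
  "rows_body \<equiv> PCond (Eq (Read ''mk'' (reg ''t'')) (Const 0)) PSkip new_row"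

definition rows_prog :: prog where
  "rows_prog = PFor ''t'' ''N'' rows_body"

abbreviation relabel_blk :: prog where
  "relabel_blk \<equiv> PFor ''v'' ''N'' (PCond
       (Or (Not (Eq (Read ''mk'' (reg ''v'')) (Const 0)))
           (And (Eq (Read ''st'' (reg ''v'')) (Const 1))
              (Not (Eq (Read ''pb'' (Read ''blk'' (reg ''v''))) (Const 0)))))
       (PAssign ''blk'' (reg ''v'') (reg ''q'')) PSkip)"

abbreviation relabel_st :: prog where
  "relabel_st \<equiv> PFor ''v'' ''N'' (PCond (Eq (Read ''mk'' (reg ''v'')) (Const 0)) PSkip
       (PAssign ''st'' (reg ''v'') (Const 1)))"

definition relabel_prog :: prog where
  "relabel_prog = setr ''q'' (Read ''blk'' (reg ''x'')) ;;
     relabel_blk ;;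
     relabel_st"

definition merge_prog :: prog where
  "merge_prog = mark_prog ;; blocks_prog ;; rows_prog ;; relabel_prog"

definition step_prog :: prog where
  "step_prog = find_edge ;;
     PCond (And (Not (Eq (reg ''fd'') (Const 0))) (Eq (reg ''dn'') (Const 0)))
       (PCond (Eq (Read ''st'' (reg ''y'')) (Const 1)) merge_prog
         (setr ''w'' (at2 ''F'' (reg ''x'') (reg ''y'')) ;;
          PCond (Eq (reg ''w'') (reg ''y'')) augment_prog grow_prog))
       PSkip"

text \<open>A step that finds an edge either ends the phase or adds an outer vertex, so
  \<open>N\<close> rounds suffice. Once \<open>dn\<close> is set, the remaining rounds leave the
  matching and the search structure alone.\<close>

definition phase_prog :: prog where
  "phase_prog = find_root ;; init_search ;; PFor ''i'' ''N'' step_prog"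

text \<open>A failing phase is not detected: it leaves \<open>M\<close> unchanged, and the final
  scan for an unmatched vertex tells the outcome.\<close>

definition match_prog :: prog where
  "match_prog = PFor ''v'' ''N'' (PAssign ''M'' (reg ''v'') (reg ''v'')) ;;
     PFor ''k'' ''N'' phase_prog ;;
     setr ''output'' (Const 1) ;;
     PFor ''v'' ''N'' (PCond (Eq (Read ''M'' (reg ''v'')) (reg ''v'')) (setr ''output'' (Const 0)) PSkip)"

lemmas prog_defs = find_root_def init_search_def find_edge_def augment_prog_def grow_prog_def new_row_def
  mark_prog_def blocks_prog_def rows_prog_def relabel_prog_def merge_prog_def step_prog_def phase_prog_def
  match_prog_def

lemma wf_match_prog: "wf_prog ''B'' match_prog"
  by (simp add: prog_defs)

lemma writes_progs:
  "writes find_root = {''dn'', ''v'', ''r''}"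
  "writes init_search = {''v'', ''st'', ''F'', ''blk''}"
  "writes find_edge = {''fd'', ''u'', ''v'', ''x'', ''y''}"
  "writes augment_prog = {''v'', ''M'', ''dn''}"
  "writes grow_prog = {''v'', ''F'', ''st'', ''blk''}"
  "writes new_row = {''v'', ''F''}"
  "writes mark_prog = {''t'', ''mk''}"
  "writes blocks_prog = {''v'', ''t'', ''pb''}"
  "writes rows_prog = {''t'', ''v'', ''F''}"
  "writes relabel_prog = {''q'', ''v'', ''blk'', ''st''}"
  by (auto simp: prog_defs)

section \<open>Effect of the search programs on the memory\<close>

lemma find_root:
  assumes env: "env N s"
  defines "s' \<equiv> runB find_root s"
  shows "(if s' ''dn'' 0 = 0 then s' ''r'' 0 < N \<and> s ''M'' (s' ''r'' 0) = s' ''r'' 0 else \<forall>v<N. s ''M'' v \<noteq> v)"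
proof -
  define P where "P k t \<longleftrightarrow> (if t ''dn'' 0 = 0 then t ''r'' 0 < N \<and> s ''M'' (t ''r'' 0) = t ''r'' 0
      else \<forall>v<k. s ''M'' v \<noteq> v)" for k and t :: state
  have "P N s'"
    unfolding s'_def find_root_def run.simps(3)
  proof (rule run_For[where P = P])
    fix k t
    assume "k < N" "P k t" "t ''v'' 0 = k" and
      "\<And>y. y \<notin> insert ''v'' (writes root_body) \<Longrightarrow> t y = runB (setr ''dn'' (Const 1)) s y"
    moreover from this(4)[of "''M''"] have "t ''M'' = s ''M''" by simp
    ultimately show "P (Suc k) ((runB root_body t)
       (''v'' := (runB root_body t ''v'')(0 := Suc k)))"
      by (simp add: P_def less_Suc_eq)
  qed (use envD[OF env] in \<open>auto simp: P_def\<close>)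
  then show ?thesis by (simp add: P_def)
qed

lemma init_search:
  assumes env: "env N s" and r: "s ''r'' 0 < N"
  defines "s' \<equiv> runB init_search s"
  shows "v < N \<Longrightarrow> s' ''st'' v = (if v = s ''r'' 0 then 1 else 0)"
    "v < N \<Longrightarrow> s' ''F'' (s ''r'' 0 * N + v) = s ''M'' v"
    "s' ''blk'' (s ''r'' 0) = s ''r'' 0"
proof -
  let ?c1 = "PFor ''v'' ''N'' (PAssign ''st'' (reg ''v'') (Const 0))"
  let ?c2 = "PFor ''v'' ''N'' (set2 ''F'' (reg ''r'') (reg ''v'') (Read ''M'' (reg ''v'')))"
  define s1 where "s1 = runB ?c1 s"
  have fr1: "y \<notin> {''v'', ''st''} \<Longrightarrow> s1 y = s y" for y unfolding s1_def by (rule run_frame) simp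
  have env1: "env N s1" using env fr1 by (simp add: env_def)
  have st: "s1 ''st'' v = 0" if "v < N" for v
    unfolding s1_def by (rule run_fill(1)[where A = "\<lambda>k. k"]) (use envD[OF env] that in auto)
  define s2 where "s2 = runB ?c2 s1"
  have fr2: "y \<notin> {''v'', ''F''} \<Longrightarrow> s2 y = s1 y" for y unfolding s2_def by (rule run_frame) simp
  have F: "s2 ''F'' (s ''r'' 0 * N + v) = s ''M'' v" if "v < N" for v
    unfolding s2_def by (rule run_fill(1)[where A = "\<lambda>k. s ''r'' 0 * N + k" and m = N and g = "s ''M''"])
     (use envD[OF env1] envD[OF env] that fr1 r in \<open>auto simp: inj_on_def\<close>)
  have s': "s' = s2(''st'' := (s2 ''st'')(s ''r'' 0 := 1), ''blk'' := (s2 ''blk'')(s ''r'' 0 := s ''r'' 0))"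
    unfolding s'_def init_search_def using fr1 fr2 by (simp add: s1_def[symmetric] s2_def[symmetric])
  show "v < N \<Longrightarrow> s' ''st'' v = (if v = s ''r'' 0 then 1 else 0)" using s' st fr2 by auto
  show "v < N \<Longrightarrow> s' ''F'' (s ''r'' 0 * N + v) = s ''M'' v" using s' F by auto
  show "s' ''blk'' (s ''r'' 0) = s ''r'' 0" using s' by auto
qed

text \<open>If no pair qualifies, the hypothesis \<open>stuck\<close> of
  \<open>stuck_no_perfect_matching\<close> holds. Otherwise an outer \<open>v\<close> calls for a
  merge, and an unreached one for growing or augmenting.\<close>

definition actionable :: "nat \<Rightarrow> state \<Rightarrow> nat \<Rightarrow> nat \<Rightarrow> bool" where
  "actionable N s u v \<longleftrightarrow> u < N \<and> v < N \<and> s ''st'' u = 1 \<and> s ''adj'' (u * N + v) \<noteq> 0 \<and> s ''st'' v \<noteq> 2 \<and>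
     \<not> (s ''st'' v = 1 \<and> s ''blk'' u = s ''blk'' v)"

lemma find_edge:
  assumes env: "env N s"
  defines "s' \<equiv> runB find_edge s"
  shows "(if s' ''fd'' 0 = 0 then \<forall>u<N. \<forall>v<N. \<not> actionable N s u v
     else actionable N s (s' ''x'' 0) (s' ''y'' 0))"
proof -
  \<comment> \<open>Pairs are scanned in lexicographic order, and \<open>Q k l\<close> speaks about
    those before \<open>(k, l)\<close>.\<close>
  define Q where "Q k l t \<longleftrightarrow> (if t ''fd'' 0 = 0 then \<forall>u<N. \<forall>v<N. u < k \<or> u = k \<and> v < l \<longrightarrow> \<not> actionable N s u v
     else actionable N s (t ''x'' 0) (t ''y'' 0))" for k l and t :: state
  let ?inner = "PFor ''v'' ''N'' edge_body"
  have inner: "Q k N (runB ?inner t)"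
    if k: "k < N" and Q: "Q k 0 t" and t: "t ''u'' 0 = k"
      "\<And>y. y \<notin> {''fd'', ''u'', ''v'', ''x'', ''y''} \<Longrightarrow> t y = s y" for k t
  proof (rule run_For)
    show "N = min (t ''N'' 0) (t ''B'' 0)" using t envD[OF env] by simp
    show "Q k 0 (t(''v'' := (t ''v'')(0 := 0)))" using Q by (simp add: Q_def)
    fix l t'
    assume l: "l < N" "Q k l t'" "t' ''v'' 0 = l" and t': "\<And>y. y \<notin> insert ''v'' (writes edge_body) \<Longrightarrow> t' y = t y"
    have fr: "y \<notin> {''fd'', ''u'', ''v'', ''x'', ''y''} \<Longrightarrow> t' y = s y" for y using t'[of y] t(2)[of y] by simp
    have u: "t' ''u'' 0 = k" using t'[of "''u''"] t(1) by simp
    have row: "t' ''row'' k = k * N" using fr[of "''row''"] envD(3)[OF env k] by simp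
    have "actionable N s k l \<longleftrightarrow> t' ''st'' k = 1 \<and> t' ''adj'' (k * N + l) \<noteq> 0 \<and> t' ''st'' l \<noteq> 2 \<and>
       \<not> (t' ''st'' l = 1 \<and> t' ''blk'' k = t' ''blk'' l)"
      using k l fr by (simp add: actionable_def)
    then show "Q k (Suc l) ((runB edge_body t')(''v'' := (runB edge_body t' ''v'')(0 := Suc l)))"
      using l u row k unfolding Q_def by (auto simp: less_Suc_eq)
  qed simp
  have "Q N 0 s'"
    unfolding s'_def find_edge_def run.simps(3)
  proof (rule run_For[where P = "\<lambda>k. Q k 0"])
    fix k t
    assume k: "k < N" "Q k 0 t" "t ''u'' 0 = k" and
      t: "\<And>y. y \<notin> insert ''u'' (writes ?inner) \<Longrightarrow> t y = runB (setr ''fd'' (Const 0)) s y"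
    have "Q k N (runB ?inner t)" by (rule inner[OF k]) (use t in auto)
    then show "Q (Suc k) 0 ((runB ?inner t)(''u'' := (runB ?inner t ''u'')(0 := Suc k)))"
      by (auto simp: Q_def less_Suc_eq simp del: run.simps)
  qed (use envD[OF env] in \<open>auto simp: Q_def\<close>)
  then show ?thesis by (auto simp: Q_def)
qed

lemma augment_prog:
  assumes env: "env N s" and xy: "s ''x'' 0 < N"
  defines "s' \<equiv> runB augment_prog s"
  shows "v < N \<Longrightarrow> s' ''M'' v = (if v = s ''y'' 0 then s ''x'' 0 else if v = s ''x'' 0 then s ''y'' 0
      else s ''F'' (s ''x'' 0 * N + v))"
    "s' ''dn'' 0 = 1"
proof -
  let ?c = "PFor ''v'' ''N'' (PAssign ''M'' (reg ''v'') (at2 ''F'' (reg ''x'') (reg ''v'')))"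
  define s1 where "s1 = runB ?c s"
  have fr: "y \<notin> {''v'', ''M''} \<Longrightarrow> s1 y = s y" for y unfolding s1_def by (rule run_frame) simp
  have M: "s1 ''M'' v = s ''F'' (s ''x'' 0 * N + v)" if "v < N" for v
    unfolding s1_def
    by (rule run_fill(1)[where A = "\<lambda>k. k" and m = N and g = "\<lambda>v. s ''F'' (s ''x'' 0 * N + v)"])
      (use envD[OF env] that xy in auto)
  have s': "s' = s1(''M'' := (s1 ''M'')(s ''x'' 0 := s ''y'' 0, s ''y'' 0 := s ''x'' 0), ''dn'' := (s1 ''dn'')(0 := 1))"
    unfolding s'_def augment_prog_def using fr by (simp add: s1_def[symmetric])
  show "v < N \<Longrightarrow> s' ''M'' v = (if v = s ''y'' 0 then s ''x'' 0 else if v = s ''x'' 0 then s ''y'' 0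
      else s ''F'' (s ''x'' 0 * N + v))" "s' ''dn'' 0 = 1"
    using s' M by auto
qed

lemma grow_prog:
  assumes env: "env N s" and N: "s ''x'' 0 < N" "s ''w'' 0 < N" "s ''y'' 0 < N" and wx: "s ''w'' 0 \<noteq> s ''x'' 0"
  defines "s' \<equiv> runB grow_prog s"
  shows "v < N \<Longrightarrow> s' ''F'' (s ''w'' 0 * N + v) =
      ((\<lambda>v. s ''F'' (s ''x'' 0 * N + v))(s ''w'' 0 := s ''w'' 0, s ''x'' 0 := s ''y'' 0, s ''y'' 0 := s ''x'' 0)) v"
    "v < N \<Longrightarrow> z \<noteq> s ''w'' 0 \<Longrightarrow> s' ''F'' (z * N + v) = s ''F'' (z * N + v)"
    "s' ''st'' = (s ''st'')(s ''w'' 0 := 1, s ''y'' 0 := 2)"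
    "s' ''blk'' = (s ''blk'')(s ''w'' 0 := s ''w'' 0)"
proof -
  let ?w = "s ''w'' 0" and ?x = "s ''x'' 0" and ?y = "s ''y'' 0"
  let ?c = "PFor ''v'' ''N'' (set2 ''F'' (reg ''w'') (reg ''v'') (at2 ''F'' (reg ''x'') (reg ''v'')))"
  define s1 where "s1 = runB ?c s"
  have fr: "y \<notin> {''v'', ''F''} \<Longrightarrow> s1 y = s y" for y unfolding s1_def by (rule run_frame) simp
  have inj: "inj_on (\<lambda>k. ?w * N + k) {..<N}" by (simp add: inj_on_def)
  have notin: "z * N + v \<notin> (\<lambda>k. ?w * N + k) ` {..<N}" if "v < N" "z \<noteq> ?w" for z v
    using that by (auto simp: row_eq_iff)
  have "(k < N \<longrightarrow> s1 ''F'' (?w * N + k) = s ''F'' (?x * N + k)) \<and>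
     (a \<notin> (\<lambda>k. ?w * N + k) ` {..<N} \<longrightarrow> s1 ''F'' a = s ''F'' a)" for k a
    unfolding s1_def
    by (intro conjI impI; rule run_fill[where A = "\<lambda>k. ?w * N + k" and m = N
          and g = "\<lambda>v. s ''F'' (?x * N + v)"])
      (use envD[OF env] N inj notin[OF _ wx[symmetric]] in auto)
  then have F: "v < N \<Longrightarrow> s1 ''F'' (?w * N + v) = s ''F'' (?x * N + v)"
    "v < N \<Longrightarrow> z \<noteq> ?w \<Longrightarrow> s1 ''F'' (z * N + v) = s ''F'' (z * N + v)" for z v
    using notin by blast+
  have "s' = s1(''F'' := (s1 ''F'')(?w * N + ?w := ?w, ?w * N + ?x := ?y, ?w * N + ?y := ?x),
      ''st'' := (s ''st'')(?w := 1, ?y := 2), ''blk'' := (s ''blk'')(?w := ?w))"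
    unfolding s'_def grow_prog_def using fr envD(3)[OF env] N by (simp add: s1_def[symmetric])
  then show "v < N \<Longrightarrow> s' ''F'' (?w * N + v) =
      ((\<lambda>v. s ''F'' (?x * N + v))(?w := ?w, ?x := ?y, ?y := ?x)) v"
    "v < N \<Longrightarrow> z \<noteq> ?w \<Longrightarrow> s' ''F'' (z * N + v) = s ''F'' (z * N + v)"
    "s' ''st'' = (s ''st'')(?w := 1, ?y := 2)" "s' ''blk'' = (s ''blk'')(?w := ?w)"
    using F N by (auto simp: row_eq_iff)
qed

definition split_by :: "nat \<Rightarrow> state \<Rightarrow> nat \<Rightarrow> bool" where
  "split_by N s t \<longleftrightarrow> s ''st'' t = 2 \<and>
     s ''blk'' (s ''F'' (s ''x'' 0 * N + t)) \<noteq> s ''blk'' (s ''F'' (s ''y'' 0 * N + t))"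

lemma mark_prog:
  assumes env: "env N s" and N: "s ''x'' 0 < N" "s ''y'' 0 < N" and v: "v < N"
  shows "runB mark_prog s ''mk'' v = (if split_by N s v then 1 else 0)"
proof -
  have body: "runB mark_body s' ''mk'' k = (if split_by N s k then 1 else 0) \<and>
      (\<forall>a. a \<noteq> k \<longrightarrow> runB mark_body s' ''mk'' a = s' ''mk'' a)"
    if k: "k < N" "s' ''t'' 0 = k" and fr: "\<And>y. y \<notin> insert ''t'' (writes mark_body) \<Longrightarrow> s' y = s y" for k s'
  proof -
    have fr': "s' ''st'' = s ''st''" "s' ''blk'' = s ''blk''" "s' ''F'' = s ''F''" "s' ''row'' = s ''row''"
      "s' ''x'' = s ''x''" "s' ''y'' = s ''y''"
      using fr by simp_all
    show ?thesis by (simp add: fr' k split_by_def envD(3)[OF env] N)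
  qed
  show ?thesis
    unfolding mark_prog_def
    by (rule run_fill(1)[where A = "\<lambda>k. k" and m = N and g = "\<lambda>v. if split_by N s v then 1 else 0"])
      ((rule body; assumption) | simp add: envD[OF env] v)+
qed

lemma blocks_prog:
  assumes env: "env N s" and N: "s ''x'' 0 < N" "s ''y'' 0 < N" and b: "b < N"
  defines "s' \<equiv> runB blocks_prog s"
  shows "s' ''pb'' b \<noteq> 0 \<longleftrightarrow> b = s ''blk'' (s ''x'' 0) \<or> b = s ''blk'' (s ''y'' 0) \<or>
     (\<exists>t<N. s ''mk'' t \<noteq> 0 \<and> (b = s ''blk'' (s ''F'' (s ''x'' 0 * N + t)) \<or> b = s ''blk'' (s ''F'' (s ''y'' 0 * N + t))))"
proof -
  let ?x = "s ''x'' 0" and ?y = "s ''y'' 0"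
  let ?c = "PFor ''v'' ''N'' (PAssign ''pb'' (reg ''v'') (Const 0))"
  define s1 where "s1 = runB ?c s"
  have fr1: "y \<notin> {''v'', ''pb''} \<Longrightarrow> s1 y = s y" for y unfolding s1_def by (rule run_frame) simp
  have pb: "s1 ''pb'' v = 0" if "v < N" for v
    unfolding s1_def by (rule run_fill(1)[where A = "\<lambda>k. k"]) (use envD[OF env] that in auto)
  define s2 where "s2 = s1(''pb'' := (s1 ''pb'')(s ''blk'' ?x := 1, s ''blk'' ?y := 1))"
  have fr2: "y \<notin> {''v'', ''pb''} \<Longrightarrow> s2 y = s y" for y using fr1 by (simp add: s2_def)
  have s': "s' = runB (PFor ''t'' ''N'' blocks_body) s2"
    unfolding s'_def blocks_prog_def using fr1 by (simp add: s1_def[symmetric] s2_def)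
  define P where "P k t \<longleftrightarrow> (t ''pb'' b \<noteq> 0 \<longleftrightarrow> b = s ''blk'' ?x \<or> b = s ''blk'' ?y \<or>
     (\<exists>t<k. s ''mk'' t \<noteq> 0 \<and> (b = s ''blk'' (s ''F'' (?x * N + t)) \<or> b = s ''blk'' (s ''F'' (?y * N + t)))))"
    for k and t :: state
  have "P N s'"
    unfolding s'
  proof (rule run_For[where P = P])
    show "N = min (s2 ''N'' 0) (s2 ''B'' 0)" using envD[OF env] fr2 by simp
    show "P 0 (s2(''t'' := (s2 ''t'')(0 := 0)))" using b pb by (auto simp: P_def s2_def)
    fix k t
    assume k: "k < N" and P: "P k t" "t ''t'' 0 = k" and t: "\<And>y. y \<notin> insert ''t'' (writes blocks_body) \<Longrightarrow> t y = s2 y"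
    have fr: "y \<notin> {''v'', ''pb'', ''t''} \<Longrightarrow> t y = s y" for y using t[of y] fr2[of y] by simp
    show "P (Suc k) ((runB blocks_body t)(''t'' := (runB blocks_body t ''t'')(0 := Suc k)))"
    proof -
      have fr': "t ''mk'' = s ''mk''" "t ''blk'' = s ''blk''" "t ''F'' = s ''F''" "t ''row'' = s ''row''"
        "t ''x'' = s ''x''" "t ''y'' = s ''y''"
        using fr by simp_all
      have "runB blocks_body t ''pb'' b \<noteq> 0 \<longleftrightarrow> t ''pb'' b \<noteq> 0 \<or>
         s ''mk'' k \<noteq> 0 \<and> (b = s ''blk'' (s ''F'' (?x * N + k)) \<or> b = s ''blk'' (s ''F'' (?y * N + k)))"
        by (simp add: fr' P(2) envD(3)[OF env] N)
      then show ?thesis using P(1) unfolding P_def less_Suc_eq by (simp del: run.simps) blast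
    qed
  qed simp
  then show ?thesis by (simp add: P_def)
qed

text \<open>The right-hand side of \<open>F'_new\<close> in \<open>merge\<close>, read from the
  memory.\<close>

definition new_match :: "nat \<Rightarrow> state \<Rightarrow> nat \<Rightarrow> nat \<Rightarrow> nat" where
  "new_match N s t v = (let x = s ''x'' 0; y = s ''y'' 0; F = (\<lambda>z v. s ''F'' (z * N + v)); b = s ''blk'' in
     if v = t then t else if v = x then y else if v = y then x
     else if s ''st'' v = 1 \<and> b (F v t) = b (F x t) \<or> s ''st'' v = 2 \<and> b (F (F x v) t) = b (F x t)
     then F x v else F y v)"

text \<open>The row of \<open>t\<close> is computed from the rows of \<open>x\<close>, of
  \<open>y\<close>, of outer vertices and of partners of inner vertices under \<open>F x\<close>.
  The assumptions make all of these different from \<open>t\<close>, so no row that is read is being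
  overwritten.\<close>

lemma new_row:
  assumes env: "env N s" and N: "s ''x'' 0 < N" "s ''y'' 0 < N" and t: "s ''t'' 0 = t" "t < N"
    and xy: "s ''x'' 0 \<noteq> t" "s ''y'' 0 \<noteq> t" and st: "s ''st'' t \<noteq> 1"
    and Fx: "\<And>v. v < N \<Longrightarrow> s ''st'' v = 2 \<Longrightarrow>
      s ''F'' (s ''x'' 0 * N + v) < N \<and> s ''F'' (s ''x'' 0 * N + v) \<noteq> t"
  defines "s' \<equiv> runB new_row s"
  shows "v < N \<Longrightarrow> s' ''F'' (t * N + v) = new_match N s t v"
    "v < N \<Longrightarrow> z \<noteq> t \<Longrightarrow> s' ''F'' (z * N + v) = s ''F'' (z * N + v)"
proof -
  let ?x = "s ''x'' 0" and ?y = "s ''y'' 0"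
  define g where "g v = (if s ''st'' v = 1 \<and> s ''blk'' (s ''F'' (v * N + t)) = s ''blk'' (s ''F'' (?x * N + t)) \<or>
      s ''st'' v = 2 \<and> s ''blk'' (s ''F'' (s ''F'' (?x * N + v) * N + t)) = s ''blk'' (s ''F'' (?x * N + t))
     then s ''F'' (?x * N + v) else s ''F'' (?y * N + v))" for v
  define s1 where "s1 = runB (PFor ''v'' ''N'' row_body) s"
  have fr: "y \<notin> {''v'', ''F''} \<Longrightarrow> s1 y = s y" for y unfolding s1_def by (rule run_frame) simp
  have inj: "inj_on (\<lambda>k. t * N + k) {..<N}" by (simp add: inj_on_def)
  have notin: "z * N + v \<notin> (\<lambda>k. t * N + k) ` {..<N}" if "v < N" "z \<noteq> t" for z v
    using that by (auto simp: row_eq_iff)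
  have body: "runB row_body s' ''F'' (t * N + k) = g k \<and> (\<forall>a. a \<noteq> t * N + k \<longrightarrow> runB row_body s' ''F'' a = s' ''F'' a)"
    if k: "k < N" "s' ''v'' 0 = k" and fr: "\<And>y. y \<notin> insert ''v'' (writes row_body) \<Longrightarrow> s' y = s y"
      and F: "\<And>a. a \<notin> (\<lambda>k. t * N + k) ` {..<N} \<Longrightarrow> s' ''F'' a = s ''F'' a" for k s'
  proof -
    have F': "s' ''F'' (z * N + v) = s ''F'' (z * N + v)" if "v < N" "z \<noteq> t" for z v
      using F notin that by blast
    have fr': "y \<notin> {''v'', ''F''} \<Longrightarrow> s' y = s y" for y using fr[of y] by simp
    have fr'': "s' ''st'' = s ''st''" "s' ''blk'' = s ''blk''" "s' ''row'' = s ''row''"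
        "s' ''x'' = s ''x''" "s' ''y'' = s ''y''" "s' ''t'' = s ''t''"
      using fr' by simp_all
    have 1: "s ''st'' k = 1 \<Longrightarrow> s' ''F'' (k * N + t) = s ''F'' (k * N + t)"
      using F'[OF t(2), of k] st by auto
    have 2: "s ''st'' k = 2 \<Longrightarrow> s' ''F'' (s ''F'' (?x * N + k) * N + t) = s ''F'' (s ''F'' (?x * N + k) * N + t)"
      "s ''st'' k = 2 \<Longrightarrow> s ''row'' (s ''F'' (?x * N + k)) = s ''F'' (?x * N + k) * N"
      using F'[OF t(2)] Fx[OF k(1)] envD(3)[OF env] by auto
    have 3: "s' ''F'' (?x * N + v) = s ''F'' (?x * N + v)" "s' ''F'' (?y * N + v) = s ''F'' (?y * N + v)"
      if "v < N" for v using F'[OF that] xy by auto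
    have "bval near_test s' \<longleftrightarrow>
      s ''st'' k = 1 \<and> s ''blk'' (s ''F'' (k * N + t)) = s ''blk'' (s ''F'' (?x * N + t)) \<or>
      s ''st'' k = 2 \<and> s ''blk'' (s ''F'' (s ''F'' (?x * N + k) * N + t)) = s ''blk'' (s ''F'' (?x * N + t))"
      by (simp add: fr'' k(2) t envD(3)[OF env] N 3 k(1) 1 2 cong: conj_cong)
    then show ?thesis
      unfolding run.simps(4) g_def
      by (simp add: fr'' k(2) t envD(3)[OF env] N 3 k(1) del: bval_Or)
  qed
  have "(k < N \<longrightarrow> s1 ''F'' (t * N + k) = g k) \<and>
     (a \<notin> (\<lambda>k. t * N + k) ` {..<N} \<longrightarrow> s1 ''F'' a = s ''F'' a)" for k a
    unfolding s1_def
    by (intro conjI impI; rule run_fill[where A = "\<lambda>k. t * N + k" and m = N and g = g])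
      ((rule body; assumption) | simp add: envD[OF env] inj)+
  then have F: "v < N \<Longrightarrow> s1 ''F'' (t * N + v) = g v"
    "v < N \<Longrightarrow> z \<noteq> t \<Longrightarrow> s1 ''F'' (z * N + v) = s ''F'' (z * N + v)" for z v
    using notin by blast+
  have "s' = s1(''F'' := (s1 ''F'')(t * N + ?y := ?x, t * N + ?x := ?y, t * N + t := t))"
    unfolding s'_def new_row_def run.simps(3) s1_def[symmetric] using fr envD(3)[OF env] N t by simp
  then have *: "s' ''F'' = (s1 ''F'')(t * N + ?y := ?x, t * N + ?x := ?y, t * N + t := t)" by simp
  show "s' ''F'' (t * N + v) = new_match N s t v" if "v < N"
    unfolding * using F(1)[OF that] N t(2) that
    by (simp add: row_eq_iff new_match_def g_def Let_def)
  show "s' ''F'' (z * N + v) = s ''F'' (z * N + v)" if "v < N" "z \<noteq> t"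
    unfolding * using F(2)[OF that] N t(2) that by (simp add: row_eq_iff)
qed

text \<open>New rows are written in place, one after the other. All rows that are read belong to
  unmarked vertices and hence keep their old values, so \<open>new_match\<close> may refer to the
  state before the loop.\<close>

lemma rows_prog:
  assumes env: "env N s" and N: "s ''x'' 0 < N" "s ''y'' 0 < N"
    and mk: "s ''mk'' (s ''x'' 0) = 0" "s ''mk'' (s ''y'' 0) = 0"
      "\<And>v. v < N \<Longrightarrow> s ''st'' v = 1 \<Longrightarrow> s ''mk'' v = 0"
    and Fx: "\<And>v. v < N \<Longrightarrow> s ''st'' v = 2 \<Longrightarrow>
      s ''F'' (s ''x'' 0 * N + v) < N \<and> s ''mk'' (s ''F'' (s ''x'' 0 * N + v)) = 0"
    and z: "z < N" and v: "v < N"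
  defines "s' \<equiv> runB rows_prog s"
  shows "s' ''F'' (z * N + v) = (if s ''mk'' z \<noteq> 0 then new_match N s z v else s ''F'' (z * N + v))"
proof -
  define P where "P k u \<longleftrightarrow> (\<forall>z<N. \<forall>v<N. u ''F'' (z * N + v) =
    (if z < k \<and> s ''mk'' z \<noteq> 0 then new_match N s z v else s ''F'' (z * N + v)))" for k and u :: state
  have "P N s'"
    unfolding s'_def rows_prog_def
  proof (rule run_For[where P = P])
    show "wf_prog ''B'' (PFor ''t'' ''N'' rows_body)" using wf_match_prog
      by (simp add: match_prog_def phase_prog_def step_prog_def merge_prog_def rows_prog_def)
    show "N = min (s ''N'' 0) (s ''B'' 0)" using envD[OF env] by simp
    show "P 0 (s(''t'' := (s ''t'')(0 := 0)))" by (simp add: P_def)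
    fix k u
    assume k: "k < N" and P: "P k u" and ut: "u ''t'' 0 = k" and u: "\<And>y. y \<notin> insert ''t'' (writes rows_body) \<Longrightarrow> u y = s y"
    have fr: "y \<notin> {''v'', ''F'', ''t''} \<Longrightarrow> u y = s y" for y using u[of y] by (simp add: writes_progs)
    have env': "env N u" using env fr by (simp add: env_def)
    show "P (Suc k) ((runB rows_body u)(''t'' := (runB rows_body u ''t'')(0 := Suc k)))"
    proof (cases "s ''mk'' k = 0")
      case True
      have "runB rows_body u = u" using True ut fr[of "''mk''"] by simp
      moreover have "P (Suc k) (u(''t'' := w))" for w
        unfolding P_def
      proof (intro allI impI)
        fix z v assume "z < N" "v < N"
        with P have "u ''F'' (z * N + v) =
            (if z < k \<and> s ''mk'' z \<noteq> 0 then new_match N s z v else s ''F'' (z * N + v))" by (simp add: P_def)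
        then show "(u(''t'' := w)) ''F'' (z * N + v) =
            (if z < Suc k \<and> s ''mk'' z \<noteq> 0 then new_match N s z v else s ''F'' (z * N + v))"
          using True by (auto simp: less_Suc_eq)
      qed
      ultimately show ?thesis by metis
    next
      case False
      have fr': "u ''st'' = s ''st''" "u ''blk'' = s ''blk''" "u ''x'' = s ''x''" "u ''y'' = s ''y''" "u ''mk'' = s ''mk''"
        using fr by simp_all
      have uF: "u ''F'' (z * N + v) = s ''F'' (z * N + v)" if "z < N" "v < N" "s ''mk'' z = 0" for z v
        using P that by (simp add: P_def)
      have nm: "new_match N u k v = new_match N s k v" if "v < N" for v
        unfolding new_match_def Let_def
        using uF[OF N(1) that mk(1)] uF[OF N(2) that mk(2)] uF[OF N(1) k mk(1)] uF[OF that k mk(3)[OF that]]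
          uF[OF _ k, of "s ''F'' (s ''x'' 0 * N + v)"] Fx[OF that] by (simp add: fr' cong: conj_cong)
      have row: "v < N \<Longrightarrow> runB new_row u ''F'' (k * N + v) = new_match N u k v"
        "v < N \<Longrightarrow> z \<noteq> k \<Longrightarrow> runB new_row u ''F'' (z * N + v) = u ''F'' (z * N + v)" for z v
      proof -
        have 1: "u ''x'' 0 < N" "u ''y'' 0 < N" "u ''x'' 0 \<noteq> k" "u ''y'' 0 \<noteq> k" "u ''st'' k \<noteq> 1"
          using N mk False k by (auto simp: fr')
        have 2: "u ''F'' (u ''x'' 0 * N + v) < N \<and> u ''F'' (u ''x'' 0 * N + v) \<noteq> k"
          if "v < N" "u ''st'' v = 2" for v
          using Fx[of v] that uF[OF N(1) that(1) mk(1)] False by (auto simp: fr')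
        show "v < N \<Longrightarrow> runB new_row u ''F'' (k * N + v) = new_match N u k v"
          "v < N \<Longrightarrow> z \<noteq> k \<Longrightarrow> runB new_row u ''F'' (z * N + v) = u ''F'' (z * N + v)"
          using new_row[OF env' 1(1,2) ut k 1(3-5) 2] by blast+
      qed
      have "runB rows_body u = runB new_row u" using False ut fr' by simp
      moreover have "P (Suc k) ((runB new_row u)(''t'' := w))" for w
        unfolding P_def
      proof (intro allI impI)
        fix z v assume zv: "z < N" "v < N"
        with P have "u ''F'' (z * N + v) =
            (if z < k \<and> s ''mk'' z \<noteq> 0 then new_match N s z v else s ''F'' (z * N + v))" by (simp add: P_def)
        then show "((runB new_row u)(''t'' := w)) ''F'' (z * N + v) =
            (if z < Suc k \<and> s ''mk'' z \<noteq> 0 then new_match N s z v else s ''F'' (z * N + v))"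
          using False row(1)[OF zv(2)] row(2)[OF zv(2), of z] nm[OF zv(2)] by (cases "z = k") (simp_all add: less_Suc_eq)
      qed
      ultimately show ?thesis by metis
    qed
  qed
  then show ?thesis using z v by (simp add: P_def)
qed

lemma relabel_prog:
  assumes env: "env N s" and N: "s ''x'' 0 < N" and v: "v < N"
  defines "s' \<equiv> runB relabel_prog s"
  shows "s' ''blk'' v = (if s ''mk'' v \<noteq> 0 \<or> s ''st'' v = 1 \<and> s ''pb'' (s ''blk'' v) \<noteq> 0
      then s ''blk'' (s ''x'' 0) else s ''blk'' v)" (is "_ = ?g v")
    "s' ''st'' v = (if s ''mk'' v \<noteq> 0 then 1 else s ''st'' v)"
proof -
  define s0 where "s0 = runB (setr ''q'' (Read ''blk'' (reg ''x''))) s"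
  define s1 where "s1 = runB relabel_blk s0"
  have fr0: "y \<noteq> ''q'' \<Longrightarrow> s0 y = s y" "s0 ''q'' 0 = s ''blk'' (s ''x'' 0)" for y by (simp_all add: s0_def)
  have fr1: "y \<notin> {''v'', ''blk'', ''q''} \<Longrightarrow> s1 y = s y" for y
    unfolding s1_def using run_frame[of y relabel_blk "''B''" s0] fr0(1)[of y] by simp
  have s': "s' = runB relabel_st s1" unfolding s'_def relabel_prog_def s1_def s0_def by simp
  have "s1 ''blk'' v = ?g v"
    unfolding s1_def
    by (rule run_fill(1)[where A = "\<lambda>k. k" and m = N and g = ?g]) (use envD[OF env] v fr0 in auto)
  then show "s' ''blk'' v = ?g v" unfolding s' using run_frame[of "''blk''" relabel_st "''B''" s1] by simp
  show "s' ''st'' v = (if s ''mk'' v \<noteq> 0 then 1 else s ''st'' v)"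
    unfolding s' by (rule run_fill(1)[where A = "\<lambda>k. k" and m = N
          and g = "\<lambda>v. if s ''mk'' v \<noteq> 0 then 1 else s ''st'' v"]) (use envD[OF env] v fr1 in auto)
qed

section \<open>Correctness of the matching search\<close>

definition edge_in :: "nat \<Rightarrow> state \<Rightarrow> nat \<Rightarrow> nat \<Rightarrow> bool" where
  "edge_in N s u v \<longleftrightarrow> s ''adj'' (u * N + v) \<noteq> 0"

definition outer :: "nat \<Rightarrow> state \<Rightarrow> nat set" where "outer N s = {v. v < N \<and> s ''st'' v = 1}"

definition inner :: "nat \<Rightarrow> state \<Rightarrow> nat set" where "inner N s = {v. v < N \<and> s ''st'' v = 2}"

text \<open>The root is kept because \<open>augment\<close> measures its progress at an outer vertex
  missed by \<open>M\<close>.\<close>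

definition good :: "nat \<Rightarrow> state \<Rightarrow> bool" where
  "good N s \<longleftrightarrow>
     search (edge_in N s) N (s ''M'') (outer N s) (inner N s) (s ''blk'') (\<lambda>z v. s ''F'' (z * N + v)) \<and>
     s ''r'' 0 \<in> outer N s \<and> s ''M'' (s ''r'' 0) = s ''r'' 0"

definition fixed :: "nat \<Rightarrow> (nat \<Rightarrow> nat) \<Rightarrow> nat set" where "fixed N M = {v. v < N \<and> M v = v}"

definition sym_adj :: "nat \<Rightarrow> state \<Rightarrow> bool" where
  "sym_adj N s \<longleftrightarrow> (\<forall>u<N. \<forall>v<N. edge_in N s u v \<longleftrightarrow> edge_in N s v u)"

lemma merge_prog:
  assumes env: "env N s" and good: "good N s" and sym: "sym_adj N s"
    and act: "actionable N s (s ''x'' 0) (s ''y'' 0)" and y1: "s ''st'' (s ''y'' 0) = 1"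
  defines "s' \<equiv> runB merge_prog s"
  shows "good N s'" "card (outer N s) < card (outer N s')"
proof -
  define x where "x = s ''x'' 0"
  define y where "y = s ''y'' 0"
  define F where "F z v = s ''F'' (z * N + v)" for z v
  interpret search "edge_in N s" N "s ''M''" "outer N s" "inner N s" "s ''blk''" F
    using good by (simp add: good_def F_def[abs_def])
  have xy: "x < N" "y < N" "x \<in> outer N s" "y \<in> outer N s" "edge_in N s x y" "edge_in N s y x"
    "s ''blk'' x \<noteq> s ''blk'' y" "s ''x'' 0 = x" "s ''y'' 0 = y"
    using act y1 sym by (auto simp: actionable_def outer_def edge_in_def x_def y_def sym_adj_def)
  define P where "P = {t \<in> inner N s. s ''blk'' (F x t) \<noteq> s ''blk'' (F y t)}"
  define B where "B = {s ''blk'' x, s ''blk'' y} \<union> (\<lambda>t. s ''blk'' (F x t)) ` P \<union> (\<lambda>t. s ''blk'' (F y t)) ` P"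
  have PN: "v < N" "s ''st'' v = 2" if "v \<in> P" for v using that by (auto simp: P_def inner_def)
  define s1 where "s1 = runB mark_prog s"
  define s2 where "s2 = runB blocks_prog s1"
  define s3 where "s3 = runB rows_prog s2"
  have s': "s' = runB relabel_prog s3"
    by (simp add: s'_def merge_prog_def s1_def s2_def s3_def)
  have fr1: "s1 a = s a" if "a \<notin> {''t'', ''mk''}" for a
    unfolding s1_def using that by (intro run_frame) (simp add: writes_progs)
  have fr2: "s2 a = s1 a" if "a \<notin> {''v'', ''t'', ''pb''}" for a
    unfolding s2_def using that by (intro run_frame) (simp add: writes_progs)
  have fr3: "s3 a = s2 a" if "a \<notin> {''v'', ''t'', ''F''}" for a
    unfolding s3_def using that by (intro run_frame) (simp add: writes_progs)
  have fr4: "s' a = s3 a" if "a \<notin> {''q'', ''v'', ''blk'', ''st''}" for a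
    unfolding s' using that by (intro run_frame) (simp add: writes_progs)
  have env1: "env N s1" and env2: "env N s2" and env3: "env N s3"
    using env fr1 fr2 fr3 by (simp_all add: env_def)
  have mk: "s1 ''mk'' v = (if v \<in> P then 1 else 0)" if "v < N" for v
    using mark_prog[OF env, of v] that xy
    by (simp add: s1_def split_by_def P_def inner_def F_def)
  have pb: "s2 ''pb'' b \<noteq> 0 \<longleftrightarrow> b \<in> B" if "b < N" for b
  proof -
    have "s2 ''pb'' b \<noteq> 0 \<longleftrightarrow> b = s ''blk'' x \<or> b = s ''blk'' y \<or>
       (\<exists>t<N. s1 ''mk'' t \<noteq> 0 \<and> (b = s ''blk'' (F x t) \<or> b = s ''blk'' (F y t)))"
      using blocks_prog[OF env1, of b] that xy unfolding s2_def[symmetric] F_def by (simp add: fr1)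
    also have "\<dots> \<longleftrightarrow> b = s ''blk'' x \<or> b = s ''blk'' y \<or>
       (\<exists>t\<in>P. b = s ''blk'' (F x t) \<or> b = s ''blk'' (F y t))"
      using mk PN(1) by (metis zero_neq_one)
    also have "\<dots> \<longleftrightarrow> b \<in> B" unfolding B_def by auto
    finally show ?thesis .
  qed
  have F3: "s3 ''F'' (z * N + v) = (if z \<in> P then new_match N s z v else F z v)" if zv: "z < N" "v < N" for z v
  proof -
    have mk2: "s2 ''mk'' v = (if v \<in> P then 1 else 0)" if "v < N" for v
      using mk[OF that] fr2[of "''mk''"] by simp
    have fr: "s2 ''x'' = s ''x''" "s2 ''y'' = s ''y''" "s2 ''st'' = s ''st''" "s2 ''F'' = s ''F''" "s2 ''blk'' = s ''blk''"
      using fr1 fr2 by simp_all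
    have nP: "v \<notin> P" if "v \<in> outer N s" for v using that disj by (auto simp: P_def)
    have Fx: "s2 ''F'' (s2 ''x'' 0 * N + v) < N \<and> s2 ''mk'' (s2 ''F'' (s2 ''x'' 0 * N + v)) = 0"
      if "v < N" "s2 ''st'' v = 2" for v
    proof -
      have "F x v \<in> outer N s" using F_T[OF xy(3), of v] that by (simp add: fr inner_def)
      then show ?thesis using nP mk2 lt_S by (simp add: fr xy F_def)
    qed
    have "s2 ''x'' 0 < N" "s2 ''y'' 0 < N" "s2 ''mk'' (s2 ''x'' 0) = 0" "s2 ''mk'' (s2 ''y'' 0) = 0"
      using xy nP mk2 by (simp_all add: fr)
    moreover have "s2 ''mk'' v = 0" if "v < N" "s2 ''st'' v = 1" for v
      using that nP[of v] mk2 by (simp add: fr outer_def)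
    ultimately have "s3 ''F'' (z * N + v) = (if s2 ''mk'' z \<noteq> 0 then new_match N s2 z v else s2 ''F'' (z * N + v))"
      unfolding s3_def using Fx zv by (intro rows_prog[OF env2])
    moreover have "new_match N s2 z v = new_match N s z v"
      unfolding new_match_def fr ..
    ultimately show ?thesis using mk2[OF zv(1)] by (simp add: fr F_def)
  qed
  have fr3': "s3 ''x'' = s ''x''" "s3 ''st'' = s ''st''" "s3 ''blk'' = s ''blk''" "s3 ''mk'' = s1 ''mk''" "s3 ''pb'' = s2 ''pb''"
    using fr1 fr2 fr3 by simp_all
  have blk': "s' ''blk'' v = (if v \<in> P \<or> v \<in> outer N s \<and> s ''blk'' v \<in> B then s ''blk'' x else s ''blk'' v)"
    if "v < N" for v
  proof -
    have "s ''blk'' v < N" if "v \<in> outer N s" using blk_S[OF that] lt_S by simp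
    then show ?thesis
      using relabel_prog(1)[OF env3 _ that] mk[OF that] pb[of "s ''blk'' v"] xy that
      unfolding s'[symmetric] by (auto simp: fr3' outer_def)
  qed
  have st': "s' ''st'' v = (if v \<in> P then 1 else s ''st'' v)" if "v < N" for v
    using relabel_prog(2)[OF env3 _ that] mk[OF that] xy unfolding s'[symmetric] by (simp add: fr3')
  have out: "outer N s' = outer N s \<union> P" and inn: "inner N s' = inner N s - P"
    using st' PN by (auto simp: outer_def inner_def split: if_splits)
  have fr: "s' ''adj'' = s ''adj''" "s' ''M'' = s ''M''" "s' ''r'' = s ''r''" "s' ''F'' = s3 ''F''"
    using fr1 fr2 fr3 fr4 by simp_all
  have nP: "z \<notin> P" if "z \<in> outer N s" for z using that disj by (auto simp: P_def)
  have "search (edge_in N s) N (s ''M'') (outer N s \<union> P) (inner N s - P) (s' ''blk'') (\<lambda>z v. s' ''F'' (z * N + v))"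
    unfolding P_def
  proof (rule merge[OF xy(3-7)], fold P_def, fold B_def)
    show "s' ''blk'' v = (if v \<in> P \<or> s ''blk'' v \<in> B then s ''blk'' x else s ''blk'' v)"
      if "v \<in> outer N s \<union> P" for v using that blk'[of v] lt_S PN by auto
    show "s' ''F'' (z * N + v) = F z v" if "z \<in> outer N s" "v < N" for z v
      using F3[of z v] that lt_S nP by (simp add: fr)
    show "s' ''F'' (t * N + v) = (if v = t then t else if v = x then y else if v = y then x
       else if v \<in> outer N s \<and> s ''blk'' (F v t) = s ''blk'' (F x t) \<or>
          v \<in> inner N s \<and> s ''blk'' (F (F x v) t) = s ''blk'' (F x t) then F x v else F y v)"
      if "t \<in> P" "v < N" for t v
      using F3[of t v] that PN(1)[OF that(1)] unfolding fr new_match_def Let_def F_def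
      by (simp add: outer_def inner_def xy)
  qed
  moreover have "edge_in N s' = edge_in N s" by (intro ext) (simp add: edge_in_def fr)
  ultimately show "good N s'" using good by (simp add: good_def fr out inn)
  have "P \<noteq> {}" unfolding P_def by (rule merge_blocks_ne[OF xy(3,4,7)])
  then show "card (outer N s) < card (outer N s')"
    unfolding out using fin_S PN nP by (intro psubset_card_mono) (auto intro: finite_subset[of _ "{..<N}"])
qed

lemma grow_step:
  assumes env: "env N s" and good: "good N s" and sym: "sym_adj N s"
    and act: "actionable N s (s ''x'' 0) (s ''y'' 0)" and y1: "s ''st'' (s ''y'' 0) \<noteq> 1"
    and w: "s ''w'' 0 = s ''F'' (s ''x'' 0 * N + s ''y'' 0)" and wy: "s ''w'' 0 \<noteq> s ''y'' 0"
  defines "s' \<equiv> runB grow_prog s"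
  shows "good N s'" "card (outer N s) < card (outer N s')"
proof -
  define x where "x = s ''x'' 0"
  define y where "y = s ''y'' 0"
  define w where "w = s ''w'' 0"
  define F where "F z v = s ''F'' (z * N + v)" for z v
  interpret search "edge_in N s" N "s ''M''" "outer N s" "inner N s" "s ''blk''" F
    using good by (simp add: good_def F_def[abs_def])
  have xy: "x < N" "y < N" "x \<in> outer N s" "y \<notin> outer N s" "y \<notin> inner N s" "edge_in N s x y" "edge_in N s y x"
    "s ''x'' 0 = x" "s ''y'' 0 = y" "w = F x y" "w \<noteq> y" "s ''w'' 0 = w"
    using act y1 sym w wy by (auto simp: actionable_def outer_def inner_def edge_in_def x_def y_def w_def F_def sym_adj_def)
  have wN: "w < N" and wO: "w \<notin> outer N s" "w \<notin> inner N s"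
    using F_lt[OF xy(3,2)] F_R_closed[OF xy(3,2,4,5)] xy(10) by auto
  then have wx: "w \<noteq> x" using xy by auto
  note g = grow_prog[OF env, folded s'_def, unfolded xy(8,9,12), OF xy(1) wN xy(2) wx]
  have fr: "s' ''adj'' = s ''adj''" "s' ''M'' = s ''M''" "s' ''r'' = s ''r''"
    unfolding s'_def by (simp_all add: run_frame writes_progs)
  have "search (edge_in N s) N (s ''M'') (insert w (outer N s)) (insert y (inner N s)) (s' ''blk'') (\<lambda>z v. s' ''F'' (z * N + v))"
  \<comment> \<open>As functions both sides may differ: in the array, a column from \<open>N\<close>
    on runs into the addresses of another row.\<close>
  proof (rule search_cong[OF grow[OF xy(3,2,4,5) _ xy(6,7,10)]])
    show "F x y \<noteq> y" using xy by simp
    show "s' ''blk'' v = ((s ''blk'')(w := w)) v" for v using g(4) by simp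
    show "s' ''F'' (z * N + v) = (F(w := (F x)(w := w, x := y, y := x))) z v"
      if "z \<in> insert w (outer N s)" "v < N" for z v
      using g(1)[OF that(2)] g(2)[OF that(2), of z] that by (simp add: F_def)
  qed
  moreover have "edge_in N s' = edge_in N s" by (intro ext) (simp add: edge_in_def fr)
  moreover have out: "outer N s' = insert w (outer N s)" and inn: "inner N s' = insert y (inner N s)"
    unfolding outer_def inner_def g(3) using wN xy wO by (auto simp: outer_def inner_def)
  ultimately show "good N s'" using good by (simp add: good_def fr)
  show "card (outer N s) < card (outer N s')" unfolding out using fin_S wO by simp
qed

lemma augment_step:
  assumes env: "env N s" and good: "good N s" and sym: "sym_adj N s"
    and act: "actionable N s (s ''x'' 0) (s ''y'' 0)" and y1: "s ''st'' (s ''y'' 0) \<noteq> 1"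
    and Fy: "s ''F'' (s ''x'' 0 * N + s ''y'' 0) = s ''y'' 0"
  defines "s' \<equiv> runB augment_prog s"
  shows "matching_fun (edge_in N s) N (s' ''M'')" "card (fixed N (s' ''M'')) < card (fixed N (s ''M''))"
    "s' ''dn'' 0 = 1"
proof -
  define x where "x = s ''x'' 0"
  define y where "y = s ''y'' 0"
  define F where "F z v = s ''F'' (z * N + v)" for z v
  interpret search "edge_in N s" N "s ''M''" "outer N s" "inner N s" "s ''blk''" F
    using good by (simp add: good_def F_def[abs_def])
  have xy: "x < N" "y < N" "x \<in> outer N s" "y \<notin> outer N s" "y \<notin> inner N s" "edge_in N s x y" "edge_in N s y x"
    "s ''x'' 0 = x" "s ''y'' 0 = y" "F x y = y"
    using act y1 sym Fy by (auto simp: actionable_def outer_def inner_def edge_in_def x_def y_def F_def sym_adj_def)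
  note g = augment_prog[OF env, folded s'_def, unfolded xy(8,9), OF xy(1)]
  have r: "s ''r'' 0 \<in> outer N s" "s ''M'' (s ''r'' 0) = s ''r'' 0" using good by (auto simp: good_def)
  have "x \<noteq> y" using xy by auto
  then have M': "s' ''M'' v = (if v = x then y else if v = y then x else F x v)" if "v < N" for v
    using g(1)[OF that] by (simp add: F_def)
  show "matching_fun (edge_in N s) N (s' ''M'')" "card (fixed N (s' ''M'')) < card (fixed N (s ''M''))"
    using augment[OF xy(3,2,4,5,10,6,7) r M'] by (auto simp: fixed_def)
  show "s' ''dn'' 0 = 1" by (rule g(2))
qed

text \<open>While the phase runs, \<open>j\<close> rounds have made more than \<open>j\<close>
  vertices outer, unless no perfect matching exists. After \<open>N\<close> rounds this count is
  impossible, so with a perfect matching the phase has ended by then. The last alternative belongs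
  to a phase that finds no root.\<close>

definition phase_inv :: "nat \<Rightarrow> (nat \<Rightarrow> nat) \<Rightarrow> nat \<Rightarrow> state \<Rightarrow> bool" where
  "phase_inv N M j s \<longleftrightarrow> matching_fun (edge_in N s) N (s ''M'') \<and>
     (if s ''dn'' 0 = 0 then good N s \<and> s ''M'' = M \<and>
        (has_perfect_matching {..<N} (edge_in N s) \<longrightarrow> j < card (outer N s))
      else card (fixed N (s ''M'')) < card (fixed N M) \<or> fixed N (s ''M'') = {})"

lemma step_prog:
  assumes env: "env N s" and sym: "sym_adj N s" and inv: "phase_inv N M j s"
  shows "phase_inv N M (Suc j) (runB step_prog s)"
proof -
  define s1 where "s1 = runB find_edge s"
  define s2 where "s2 = s1(''w'' := (s1 ''w'')(0 := s1 ''F'' (s1 ''x'' 0 * N + s1 ''y'' 0)))"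
  have fr1: "a \<notin> {''fd'', ''u'', ''v'', ''x'', ''y''} \<Longrightarrow> s1 a = s a" for a
    unfolding s1_def by (rule run_frame) (simp add: writes_progs)
  have fr2: "a \<notin> {''fd'', ''u'', ''v'', ''x'', ''y'', ''w''} \<Longrightarrow> s2 a = s a" for a
    using fr1 by (simp add: s2_def)
  have eq: "edge_in N s1 = edge_in N s" "edge_in N s2 = edge_in N s"
    by (intro ext; simp add: edge_in_def fr1 fr2)+
  have out: "outer N s1 = outer N s" "outer N s2 = outer N s" "inner N s1 = inner N s" "inner N s2 = inner N s"
    by (simp_all add: outer_def inner_def fr1 fr2)
  have g: "good N s1 \<longleftrightarrow> good N s" "good N s2 \<longleftrightarrow> good N s"
    by (simp_all add: good_def eq out fr1 fr2)
  have e: "env N s1" "env N s2" using env by (simp_all add: env_def fr1 fr2)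
  have sy: "sym_adj N s1" "sym_adj N s2" using sym by (simp_all add: sym_adj_def eq)
  have act: "actionable N s1 = actionable N s" "actionable N s2 = actionable N s"
    by (intro ext; simp add: actionable_def fr1 fr2)+
  note fe = find_edge[OF env, folded s1_def]
  show ?thesis
  proof (cases "s1 ''fd'' 0 \<noteq> 0 \<and> s ''dn'' 0 = 0")
    case False
    then have "runB step_prog s = s1" by (auto simp: step_prog_def s1_def[symmetric] fr1)
    moreover have "phase_inv N M (Suc j) s1"
    \<comment> \<open>If the phase still runs and no pair was found, the search is stuck. This
      excludes a perfect matching, so the claimed growth holds vacuously.\<close>
    proof (cases "s ''dn'' 0 = 0 \<and> has_perfect_matching {..<N} (edge_in N s)")
      case True
      then have "good N s" using inv by (auto simp: phase_inv_def)
      then interpret search "edge_in N s" N "s ''M''" "outer N s" "inner N s" "s ''blk''" "\<lambda>z v. s ''F'' (z * N + v)"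
        by (simp add: good_def)
      have "y \<in> inner N s \<or> y \<in> outer N s \<and> s ''blk'' y = s ''blk'' x"
        if "x \<in> outer N s" "y < N" "edge_in N s x y" for x y
      proof -
        have "\<not> actionable N s x y" using fe False True that by (auto simp: outer_def)
        then show ?thesis using that by (auto simp: actionable_def outer_def inner_def edge_in_def)
      qed
      moreover have "outer N s \<noteq> {}" using \<open>good N s\<close> by (auto simp: good_def)
      ultimately show ?thesis using stuck_no_perfect_matching True by blast
    next
      case False
      then show ?thesis using inv by (auto simp: phase_inv_def eq g fr1)
    qed
    ultimately show ?thesis by simp
  next
    case True
    then have a: "actionable N s (s1 ''x'' 0) (s1 ''y'' 0)" using fe by simp
    have "s1 ''row'' (s1 ''x'' 0) = s1 ''x'' 0 * N" using a envD(3)[OF e(1)] by (simp add: actionable_def)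
    then have run: "runB step_prog s = (if s1 ''st'' (s1 ''y'' 0) = 1 then runB merge_prog s1 else
       if s2 ''w'' 0 = s2 ''y'' 0 then runB augment_prog s2 else runB grow_prog s2)"
      using True by (simp add: step_prog_def s1_def[symmetric] fr1 s2_def)
    define s' where "s' = runB step_prog s"
    have gs: "good N s" "s ''M'' = M" "has_perfect_matching {..<N} (edge_in N s) \<Longrightarrow> j < card (outer N s)"
      and mf: "matching_fun (edge_in N s) N M"
      using inv True by (auto simp: phase_inv_def)
    have g1: "good N s1" and g2: "good N s2" using gs(1) by (simp_all add: g)
    have xy2: "s2 ''x'' = s1 ''x''" "s2 ''y'' = s1 ''y''" by (simp_all add: s2_def)
    have a1: "actionable N s1 (s1 ''x'' 0) (s1 ''y'' 0)" and a2: "actionable N s2 (s2 ''x'' 0) (s2 ''y'' 0)"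
      using a by (simp_all add: act xy2)
    have adj: "s' ''adj'' = s ''adj''" unfolding s'_def by (rule run_frame) (simp add: prog_defs)
    have eq': "edge_in N s' = edge_in N s" by (intro ext) (simp add: edge_in_def adj)
    have grown: ?thesis if "good N s'" "card (outer N s) < card (outer N s')" "s' ''M'' = s ''M''" "s' ''dn'' = s ''dn''"
      unfolding s'_def[symmetric] phase_inv_def using that gs mf True by (auto simp: eq')
    consider "s1 ''st'' (s1 ''y'' 0) = 1" | "s1 ''st'' (s1 ''y'' 0) \<noteq> 1" "s2 ''w'' 0 = s2 ''y'' 0"
      | "s1 ''st'' (s1 ''y'' 0) \<noteq> 1" "s2 ''w'' 0 \<noteq> s2 ''y'' 0" by blast
    then show ?thesis
    proof cases
      case 1
      then have s': "s' = runB merge_prog s1" using run by (simp add: s'_def)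
      have "s' ''M'' = s ''M''" "s' ''dn'' = s ''dn''"
        unfolding s' by (simp_all add: run_frame merge_prog_def writes_progs fr1)
      then show ?thesis
        using merge_prog[OF e(1) g1 sy(1) a1 1, folded s'] unfolding out by (intro grown)
    next
      case 3
      then have s': "s' = runB grow_prog s2" using run by (simp add: s'_def)
      have "s' ''M'' = s ''M''" "s' ''dn'' = s ''dn''"
        unfolding s' by (simp_all add: run_frame writes_progs fr2)
      moreover have "s2 ''st'' (s2 ''y'' 0) \<noteq> 1" "s2 ''w'' 0 = s2 ''F'' (s2 ''x'' 0 * N + s2 ''y'' 0)"
        using 3 by (simp_all add: s2_def)
      ultimately show ?thesis
        using grow_step[OF e(2) g2 sy(2) a2 _ _ 3(2), folded s'] unfolding out by (intro grown)
    next
      case 2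
      then have s': "s' = runB augment_prog s2" using run by (simp add: s'_def)
      have "s2 ''st'' (s2 ''y'' 0) \<noteq> 1" "s2 ''F'' (s2 ''x'' 0 * N + s2 ''y'' 0) = s2 ''y'' 0"
        using 2 by (simp_all add: s2_def)
      note aug = augment_step[OF e(2) g2 sy(2) a2 this, folded s']
      show ?thesis
        unfolding s'_def[symmetric] phase_inv_def using aug gs(2) by (simp add: eq eq' fr2)
    qed
  qed
qed

lemma phase_prog:
  assumes env: "env N s" and sym: "sym_adj N s" and mf: "matching_fun (edge_in N s) N (s ''M'')"
  defines "s' \<equiv> runB phase_prog s"
  shows "matching_fun (edge_in N s) N (s' ''M'')"
    "has_perfect_matching {..<N} (edge_in N s) \<Longrightarrow>
      card (fixed N (s' ''M'')) < card (fixed N (s ''M'')) \<or> fixed N (s' ''M'') = {}"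
proof -
  define s1 where "s1 = runB find_root s"
  define s2 where "s2 = runB init_search s1"
  have fr1: "a \<notin> {''dn'', ''v'', ''r''} \<Longrightarrow> s1 a = s a" for a
    unfolding s1_def by (rule run_frame) (simp add: writes_progs)
  have fr2: "a \<notin> {''v'', ''st'', ''F'', ''blk''} \<Longrightarrow> s2 a = s1 a" for a
    unfolding s2_def by (rule run_frame) (simp add: writes_progs)
  have env1: "env N s1" using env by (simp add: env_def fr1)
  have fr12: "s2 ''M'' = s ''M''" "s2 ''adj'' = s ''adj''" "s2 ''dn'' = s1 ''dn''" "s2 ''r'' = s1 ''r''" "s1 ''M'' = s ''M''"
     "s2 ''N'' = s ''N''" "s2 ''B'' = s ''B''" "s2 ''row'' = s ''row''"
    by (simp_all add: fr1 fr2)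
  have eq: "edge_in N t = edge_in N s" if "t ''adj'' = s ''adj''" for t
    using that by (intro ext) (simp add: edge_in_def)
  have eq2: "edge_in N s2 = edge_in N s" by (rule eq[of s2, OF fr12(2)])
  note root = find_root[OF env, folded s1_def]
  have inv0: "phase_inv N (s ''M'') 0 s2"
  proof (cases "s1 ''dn'' 0 = 0")
    case True
    define r where "r = s1 ''r'' 0"
    have r: "r < N" "s ''M'' r = r" using root True by (auto simp: r_def)
    note ini = init_search[OF env1, folded r_def, OF r(1), folded s2_def]
    have o: "outer N s2 = {r}" "inner N s2 = {}" using ini(1) r by (auto simp: outer_def inner_def split: if_splits)
    have "search (edge_in N s) N (s ''M'') {r} {} (s2 ''blk'') (\<lambda>z v. s2 ''F'' (z * N + v))"
      using mf r ini(3) by (rule search_init) (simp add: ini(2) fr12)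
    then have "good N s2" using r by (simp add: good_def o fr12 eq2 r_def[symmetric])
    then show ?thesis using True mf o by (simp add: phase_inv_def fr12 eq2)
  next
    case False
    then have "fixed N (s ''M'') = {}" using root by (auto simp: fixed_def)
    then show ?thesis using False mf by (simp add: phase_inv_def fr12 eq2)
  qed
  have "phase_inv N (s ''M'') N s' \<and> s' ''adj'' = s ''adj''"
  proof -
    have s': "s' = runB (PFor ''i'' ''N'' step_prog) s2" by (simp add: s'_def phase_prog_def s1_def s2_def)
    define P where "P j t \<longleftrightarrow> phase_inv N (s ''M'') j t \<and> t ''adj'' = s ''adj''" for j t
    have i: "phase_inv N M j (t(''i'' := w)) \<longleftrightarrow> phase_inv N M j t" for M j t w
      by (simp add: phase_inv_def good_def outer_def inner_def edge_in_def[abs_def])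
    have "P N s'"
      unfolding s'
    proof (rule run_For[where P = P])
      show "wf_prog ''B'' (PFor ''i'' ''N'' step_prog)" using wf_match_prog by (simp add: match_prog_def phase_prog_def)
      show "N = min (s2 ''N'' 0) (s2 ''B'' 0)" using envD[OF env] by (simp add: fr12)
      show "P 0 (s2(''i'' := (s2 ''i'')(0 := 0)))" using inv0 unfolding P_def i by (simp add: fr12)
      fix k t
      assume k: "k < N" "P k t" and t: "\<And>y. y \<notin> insert ''i'' (writes step_prog) \<Longrightarrow> t y = s2 y"
      have w: "''N'' \<notin> writes step_prog" "''B'' \<notin> writes step_prog" "''row'' \<notin> writes step_prog" "''adj'' \<notin> writes step_prog"
        by (simp_all add: prog_defs)
      have "env N t" using env t w by (simp add: env_def fr12)
      moreover have "sym_adj N t" using sym t w by (simp add: sym_adj_def edge_in_def fr12)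
      ultimately have "phase_inv N (s ''M'') (Suc k) (runB step_prog t)"
        using step_prog k(2) unfolding P_def by blast
      then show "P (Suc k) ((runB step_prog t)(''i'' := (runB step_prog t ''i'')(0 := Suc k)))"
        using k(2) w unfolding P_def i by (simp add: run_frame)
    qed
    then show ?thesis by (simp add: P_def)
  qed
  then have fin: "phase_inv N (s ''M'') N s'" "edge_in N s' = edge_in N s" using eq[of s'] by auto
  then show "matching_fun (edge_in N s) N (s' ''M'')" by (simp add: phase_inv_def)
  have "card (outer N s') \<le> N" using card_mono[of "{..<N}" "outer N s'"] by (auto simp: outer_def)
  then show "has_perfect_matching {..<N} (edge_in N s) \<Longrightarrow>
      card (fixed N (s' ''M'')) < card (fixed N (s ''M'')) \<or> fixed N (s' ''M'') = {}"
    using fin by (auto simp: phase_inv_def split: if_splits)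
qed

text \<open>Given a perfect matching, each phase lowers the number of fixed points or leaves none,
  and it is at most \<open>N\<close> at the start, so none survives \<open>N\<close> phases.
  Conversely, an involution along edges without fixed points is itself a perfect matching.\<close>

lemma match_prog:
  assumes env: "env N s" and sym: "sym_adj N s"
  shows "runB match_prog s ''output'' 0 \<noteq> 0 \<longleftrightarrow> has_perfect_matching {..<N} (edge_in N s)"
proof -
  let ?c1 = "PFor ''v'' ''N'' (PAssign ''M'' (reg ''v'') (reg ''v''))"
  let ?c2 = "PFor ''k'' ''N'' phase_prog"
  let ?d = "PCond (Eq (Read ''M'' (reg ''v'')) (reg ''v'')) (setr ''output'' (Const 0)) PSkip"
  define s1 where "s1 = runB ?c1 s"
  define s2 where "s2 = runB ?c2 s1"
  define s3 where "s3 = runB (setr ''output'' (Const 1)) s2"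
  define s4 where "s4 = runB (PFor ''v'' ''N'' ?d) s3"
  have s4: "runB match_prog s = s4" by (simp add: match_prog_def s1_def s2_def s3_def s4_def)
  have fr1: "a \<notin> {''v'', ''M''} \<Longrightarrow> s1 a = s a" for a unfolding s1_def by (rule run_frame) simp
  have M1: "s1 ''M'' v = v" if "v < N" for v
    unfolding s1_def by (rule run_fill(1)[where A = "\<lambda>k. k"]) (use envD[OF env] that in auto)
  have eq: "edge_in N t = edge_in N s" if "t ''adj'' = s ''adj''" for t
    using that by (intro ext) (simp add: edge_in_def)
  have w: "''N'' \<notin> writes phase_prog" "''B'' \<notin> writes phase_prog" "''row'' \<notin> writes phase_prog" "''adj'' \<notin> writes phase_prog"
    by (simp_all add: prog_defs)
  define P where "P k t \<longleftrightarrow> matching_fun (edge_in N s) N (t ''M'') \<and>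
      (has_perfect_matching {..<N} (edge_in N s) \<longrightarrow> card (fixed N (t ''M'')) \<le> N - k)" for k and t :: state
  have "P N s2"
    unfolding s2_def
  proof (rule run_For[where P = P])
    show "wf_prog ''B'' ?c2" using wf_match_prog by (simp add: match_prog_def)
    show "N = min (s1 ''N'' 0) (s1 ''B'' 0)" using envD[OF env] by (simp add: fr1)
    have "card (fixed N (s1 ''M'')) \<le> N" using card_mono[of "{..<N}" "fixed N (s1 ''M'')"] by (auto simp: fixed_def)
    then show "P 0 (s1(''k'' := (s1 ''k'')(0 := 0)))" using M1 by (auto simp: P_def matching_fun_def)
    fix k t
    assume k: "k < N" "P k t" and t: "\<And>y. y \<notin> insert ''k'' (writes phase_prog) \<Longrightarrow> t y = s1 y"
    have "env N t" using env t w by (simp add: env_def fr1)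
    moreover have a: "t ''adj'' = s ''adj''" using t w fr1 by simp
    moreover have "sym_adj N t" using sym by (simp add: sym_adj_def eq[of t, OF a])
    moreover have "matching_fun (edge_in N t) N (t ''M'')" using k(2) by (simp add: P_def eq[of t, OF a])
    ultimately have "matching_fun (edge_in N s) N (runB phase_prog t ''M'')"
      "has_perfect_matching {..<N} (edge_in N s) \<Longrightarrow> card (fixed N (runB phase_prog t ''M'')) < card (fixed N (t ''M'')) \<or>
         fixed N (runB phase_prog t ''M'') = {}"
      using phase_prog[of N t] by (simp_all add: eq[of t, OF a])
    then show "P (Suc k) ((runB phase_prog t)(''k'' := (runB phase_prog t ''k'')(0 := Suc k)))"
      using k by (auto simp: P_def)
  qed
  then have mf: "matching_fun (edge_in N s) N (s2 ''M'')"
    and pm: "has_perfect_matching {..<N} (edge_in N s) \<Longrightarrow> fixed N (s2 ''M'') = {}"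
    by (auto simp: P_def fixed_def)
  have pm': "has_perfect_matching {..<N} (edge_in N s)" if "fixed N (s2 ''M'') = {}"
    unfolding has_perfect_matching_def using mf that
    by (intro exI[of _ "s2 ''M''"]) (auto simp: matching_fun_def fixed_def)
  have fr3: "s3 a = s1 a" if "a \<notin> {''output'', ''k''} \<union> writes phase_prog" for a
    using that run_frame[of a ?c2 "''B''" s1] by (simp add: s3_def s2_def)
  define Q where "Q k t \<longleftrightarrow> (t ''output'' 0 \<noteq> 0 \<longleftrightarrow> (\<forall>v<k. s2 ''M'' v \<noteq> v))" for k and t :: state
  have "Q N s4"
    unfolding s4_def
  proof (rule run_For[where P = Q])
    show "N = min (s3 ''N'' 0) (s3 ''B'' 0)" using envD[OF env] w by (simp add: fr1 fr3)
    show "Q 0 (s3(''v'' := (s3 ''v'')(0 := 0)))" by (simp add: Q_def s3_def)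
    fix k t
    assume k: "k < N" "Q k t" "t ''v'' 0 = k" and t: "\<And>y. y \<notin> insert ''v'' (writes ?d) \<Longrightarrow> t y = s3 y"
    have "t ''M'' = s2 ''M''" using t[of "''M''"] by (simp add: s3_def)
    then show "Q (Suc k) ((runB ?d t)(''v'' := (runB ?d t ''v'')(0 := Suc k)))"
      using k by (auto simp: Q_def less_Suc_eq)
  qed simp
  then show ?thesis unfolding s4 using pm pm' by (auto simp: Q_def fixed_def)
qed

section \<open>Building the gadget graph\<close>

text \<open>The addresses of an edge are evaluated again for its second entry; \<open>reads\<close>
  serves to show that writing the first entry has not changed them.\<close>

primrec reads :: "aexp \<Rightarrow> string set" where
  "reads (Const n) = {}"
| "reads (Read x a) = insert x (reads a)"
| "reads (Plus a b) = reads a \<union> reads b"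
| "reads (Minus a b) = reads a \<union> reads b"

lemma aval_upd: "x \<notin> reads e \<Longrightarrow> aval e (s(x := f)) = aval e s"
  by (induction e) auto

text \<open>As a set of pairs the matrix turns edge-writing programs into unions, which compose
  along loops. Below \<open>N\<close>, pairs and addresses correspond one to one.\<close>

definition graph_in :: "nat \<Rightarrow> state \<Rightarrow> (nat \<times> nat) set" where
  "graph_in N s = {(a, b). a < N \<and> b < N \<and> s ''adj'' (a * N + b) \<noteq> 0}"

lemma graph_in_cong: "s' ''adj'' = s ''adj'' \<Longrightarrow> graph_in N s' = graph_in N s"
  by (simp add: graph_in_def)

definition link :: "aexp \<Rightarrow> aexp \<Rightarrow> prog" where
  "link e f = set2 ''adj'' e f (Const 1) ;; set2 ''adj'' f e (Const 1)"

lemma writes_link [simp]: "writes (link e f) = {''adj''}" and wf_link [simp]: "wf_prog ''B'' (link e f)"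
  by (auto simp: link_def)

lemma link:
  assumes "env N s" "aval e s < N" "aval f s < N" "''adj'' \<notin> reads e" "''adj'' \<notin> reads f"
  shows "graph_in N (runB (link e f) s) = graph_in N s \<union> {(aval e s, aval f s), (aval f s, aval e s)}"
  using assms by (auto simp: link_def graph_in_def aval_upd envD(3) row_eq_iff split: if_splits)

lemma graph_in_For:
  assumes "wf_prog b (PFor i x c)" and m: "m = min (s x 0) (s b 0)" and i: "i \<noteq> ''adj''"
    and step: "\<And>k t. k < m \<Longrightarrow> t i 0 = k \<Longrightarrow> (\<And>y. y \<notin> insert i (writes c) \<Longrightarrow> t y = s y) \<Longrightarrow>
      graph_in N (run b c t) = graph_in N t \<union> A k"
  shows "graph_in N (run b (PFor i x c) s) = graph_in N s \<union> (\<Union>k<m. A k)"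
proof -
  define P where "P k t \<longleftrightarrow> graph_in N t = graph_in N s \<union> (\<Union>k<k. A k)" for k t
  have "P m (run b (PFor i x c) s)"
  proof (rule run_For[where P = P, OF assms(1)])
    show "m = min (s x 0) (s b 0)" by (rule m)
    show "P 0 (s(i := (s i)(0 := 0)))" using i by (simp add: P_def graph_in_def)
    fix k t
    assume "k < m" "P k t" "t i 0 = k" "\<And>y. y \<notin> insert i (writes c) \<Longrightarrow> t y = s y"
    then show "P (Suc k) ((run b c t)(i := (run b c t i)(0 := Suc k)))"
      using step[of k t] i unfolding P_def by (subst graph_in_cong[of _ "run b c t"]) (auto simp: less_Suc_eq)
  qed
  then show ?thesis by (simp add: P_def)
qed

text \<open>The bound \<open>B\<close> of all later loops depends on \<open>N\<close>, whose formula
  contains products. These are formed by loops bounded by the register \<open>length\<close>, as the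
  input has at least \<open>n\<close> and at least \<open>K\<close> words; hence there are two
  programs with different bound registers.\<close>

definition size_prog :: prog where
  "size_prog = setr ''n'' (Read ''input'' (Const 0)) ;; setr ''ne'' (Read ''input'' (Const 1)) ;;
     setr ''K'' (Read ''input'' (Const 2)) ;; setr ''sg'' (Read ''input'' (Const 3)) ;;
     setr ''p'' (Read ''input'' (Const 4)) ;; setr ''N'' (reg ''n'') ;;
     PFor ''i'' ''K'' (PFor ''k'' ''n''
       (setr ''N'' (Plus (reg ''N'') (Plus (Plus (reg ''n'') (reg ''n'')) (Const 2))))) ;;
     setr ''z'' (Minus (Minus (reg ''n'') (reg ''p'')) (reg ''p'')) ;;
     setr ''N'' (Plus (reg ''N'') (reg ''z'')) ;;
     setr ''B'' (Plus (reg ''N'') (reg ''length''))"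

definition rows_init :: prog where
  "rows_init = setr ''o'' (Const 0) ;;
     PFor ''u'' ''N'' (PAssign ''row'' (reg ''u'') (reg ''o'') ;; setr ''o'' (Plus (reg ''o'') (reg ''N'')))"

abbreviation inp :: "nat \<Rightarrow> aexp" where "inp d \<equiv> Read ''input'' (Plus (reg ''a'') (Const d))"

text \<open>One color is handled at a time: \<open>ca\<close> is its adjacency matrix and
  \<open>ic\<close> marks its vertices. The \<open>row\<close> table is shared with the gadget
  graph, hence the stride \<open>N\<close> for a matrix with \<open>n\<close> columns.\<close>

definition clear_prog :: prog where
  "clear_prog = PFor ''u'' ''n'' (PAssign ''ic'' (reg ''u'') (Const 0)) ;;
     PFor ''u'' ''n'' (PFor ''v'' ''n'' (set2 ''ca'' (reg ''u'') (reg ''v'') (Const 0)))"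

abbreviation load_body :: prog where
  "load_body \<equiv> PCond (Eq (inp 2) (Plus (reg ''i'') (Const 1)))
        (set2 ''ca'' (inp 0) (inp 1) (Const 1) ;; set2 ''ca'' (inp 1) (inp 0) (Const 1) ;;
         PAssign ''ic'' (inp 0) (Const 1) ;; PAssign ''ic'' (inp 1) (Const 1)) PSkip ;;
       setr ''a'' (Plus (reg ''a'') (Const 3))"

definition load_prog :: prog where
  "load_prog = setr ''a'' (reg ''eb'') ;;
     PFor ''j'' ''ne'' load_body"

abbreviation rep_test :: bexp where
  "rep_test \<equiv> And (Not (Eq (Read ''ic'' (reg ''v'')) (Const 0)))
         (And (Eq (at2 ''ca'' (reg ''u'') (reg ''v'')) (Const 0)) (Less (reg ''v'') (Read ''rep'' (reg ''u''))))"

abbreviation rep_body :: prog where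
  "rep_body \<equiv> PCond rep_test (PAssign ''rep'' (reg ''u'') (reg ''v'')) PSkip"

text \<open>Starting from \<open>u\<close> is sound, as no vertex is adjacent to itself.\<close>

definition rep_prog :: prog where
  "rep_prog = PFor ''u'' ''n'' (PAssign ''rep'' (reg ''u'') (reg ''u'') ;;
     PFor ''v'' ''n'' rep_body)"

abbreviation "port_reg \<equiv> Plus (reg ''o'') (reg ''w'')"
abbreviation "gate_reg \<equiv> Plus (Plus (reg ''o'') (reg ''n'')) (reg ''w'')"
abbreviation "hubA_reg \<equiv> Plus (reg ''o'') (Plus (reg ''n'') (reg ''n''))"
abbreviation "hubB_reg \<equiv> Plus hubA_reg (Const 1)"

abbreviation gate_body :: prog where
  "gate_body \<equiv> link port_reg gate_reg ;; link gate_reg hubA_reg ;; link gate_reg hubB_reg"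

abbreviation port_body :: prog where
  "port_body \<equiv> PCond (Eq (Read ''ic'' (reg ''u'')) (Const 0)) PSkip
          (link (reg ''u'') (Plus (reg ''o'') (Read ''rep'' (reg ''u''))))"

text \<open>Five header words and \<open>n\<close> vertex names precede the bounds in the input. The
  base address \<open>o\<close> finally moves on by the size of a slot.\<close>

definition slot_prog :: prog where
  "slot_prog =
     PFor ''w'' ''n'' gate_body ;;
     link hubA_reg hubB_reg ;;
     PCond (Less (reg ''k'') (Read ''input'' (Plus (Plus (Const 5) (reg ''n'')) (reg ''i''))))
       (PFor ''u'' ''n'' port_body)
       PSkip ;;
     setr ''o'' (Plus hubA_reg (Const 2))"

definition color_prog :: prog where
  "color_prog = clear_prog ;; load_prog ;; rep_prog ;; PFor ''k'' ''n'' slot_prog"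

definition build_prog :: prog where
  "build_prog = rows_init ;; setr ''o'' (reg ''n'') ;;
     setr ''eb'' (Plus (Plus (Const 5) (reg ''n'')) (reg ''K'')) ;;
     PFor ''i'' ''K'' color_prog ;;
     PFor ''d'' ''z'' (PFor ''u'' ''n'' (link (Plus (reg ''o'') (reg ''d'')) (reg ''u'')))"

text \<open>A target that is not positive is met by the empty matching. With
  \<open>n < 2 * p\<close> the answer is no, and \<open>output\<close> keeps its initial value 0.
  The remaining case is the one in which \<open>two_p\<close> holds.\<close>

definition main_prog :: prog where
  "main_prog = PCond (Or (Not (Eq (reg ''sg'') (Const 0))) (Eq (reg ''p'') (Const 0)))
     (setr ''output'' (Const 1))
     (PCond (Less (reg ''n'') (Plus (reg ''p'') (reg ''p''))) PSkip (build_prog ;; match_prog))"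

lemmas build_defs = rows_init_def clear_prog_def load_prog_def rep_prog_def slot_prog_def color_prog_def build_prog_def

lemma wf_main_prog: "wf_prog ''B'' main_prog" and wf_size_prog: "wf_prog ''length'' size_prog"
  using wf_match_prog by (simp_all add: main_prog_def size_prog_def build_defs)

lemma wf_color_prog: "wf_prog ''B'' color_prog"
  by (simp add: build_defs)

lemma writes_build:
  "writes rows_init = {''o'', ''u'', ''row''}"
  "writes clear_prog = {''u'', ''v'', ''ic'', ''ca''}"
  "writes load_prog = {''a'', ''j'', ''ic'', ''ca''}"
  "writes rep_prog = {''u'', ''v'', ''rep''}"
  "writes slot_prog = {''w'', ''u'', ''o'', ''adj''}"
  by (auto simp: build_defs)

definition input_vars :: "string set" where
  "input_vars = {''N'', ''B'', ''row'', ''n'', ''ne'', ''K'', ''z'', ''eb'', ''input''}"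

section \<open>Correctness of the construction of the gadget graph\<close>

context gadget
begin

text \<open>What the construction expects of the input and never alters: it depends on the arrays in
  \<open>input_vars\<close> only, so \<open>loaded_frame\<close> carries it across programs that
  write other arrays.\<close>

definition loaded :: "state \<Rightarrow> bool" where
  "loaded s \<longleftrightarrow> env gsize s \<and> s ''n'' 0 = n \<and> s ''ne'' 0 = length es \<and> s ''K'' 0 = K \<and>
     s ''z'' 0 = n - 2 * p \<and> s ''eb'' 0 = 5 + n + K \<and>
     n \<le> s ''B'' 0 \<and> length es \<le> s ''B'' 0 \<and> K \<le> s ''B'' 0 \<and>
     (\<forall>i<K. s ''input'' (5 + n + i) = m i) \<and>
     (\<forall>j<length es. (s ''input'' (5 + n + K + 3 * j), s ''input'' (5 + n + K + 3 * j + 1),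
        s ''input'' (5 + n + K + 3 * j + 2)) = es ! j)"

lemma loaded_frame: "loaded s \<Longrightarrow> (\<And>x. x \<notin> W \<Longrightarrow> s' x = s x) \<Longrightarrow> W \<inter> input_vars = {} \<Longrightarrow> loaded s'"
  by (simp add: loaded_def env_def input_vars_def)

lemma loadedD:
  assumes "loaded s"
  shows "env gsize s" "s ''n'' 0 = n" "s ''ne'' 0 = length es" "s ''K'' 0 = K" "s ''z'' 0 = n - 2 * p"
    "s ''eb'' 0 = 5 + n + K" "min n (s ''B'' 0) = n" "min (length es) (s ''B'' 0) = length es" "min K (s ''B'' 0) = K"
    "min (n - 2 * p) (s ''B'' 0) = n - 2 * p"
    "u < gsize \<Longrightarrow> s ''row'' u = u * gsize"
    "i < K \<Longrightarrow> s ''input'' (5 + n + i) = m i"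
    "j < length es \<Longrightarrow> (s ''input'' (5 + n + K + 3 * j), s ''input'' (5 + n + K + 3 * j + 1),
        s ''input'' (5 + n + K + 3 * j + 2)) = es ! j"
  using assms by (auto simp: loaded_def env_def)

lemma n_le_gsize: "n \<le> gsize"
  by (simp add: gsize_def dummy_offset_def)

lemma clear_prog:
  assumes "loaded s" "u < n"
  shows "runB clear_prog s ''ic'' u = 0"
    "v < n \<Longrightarrow> runB clear_prog s ''ca'' (u * gsize + v) = 0"
proof -
  let ?c1 = "PFor ''u'' ''n'' (PAssign ''ic'' (reg ''u'') (Const 0))"
  let ?d = "PFor ''v'' ''n'' (set2 ''ca'' (reg ''u'') (reg ''v'') (Const 0))"
  define s1 where "s1 = runB ?c1 s"
  have fr1: "a \<notin> {''u'', ''ic''} \<Longrightarrow> s1 a = s a" for a unfolding s1_def by (rule run_frame) simp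
  have ic: "s1 ''ic'' u = 0"
    unfolding s1_def by (rule run_fill(1)[where A = "\<lambda>k. k" and m = n]) (use loadedD[OF assms(1)] assms(2) in auto)
  have l1: "loaded s1" by (rule loaded_frame[OF assms(1)], rule fr1, assumption, simp add: input_vars_def)
  define P where "P k t \<longleftrightarrow> (\<forall>u<k. \<forall>v<n. t ''ca'' (u * gsize + v) = 0)" for k and t :: state
  have P: "P n (runB (PFor ''u'' ''n'' ?d) s1)"
  proof (rule run_For[where P = P])
    show "n = min (s1 ''n'' 0) (s1 ''B'' 0)" using loadedD[OF l1] by simp
    show "P 0 (s1(''u'' := (s1 ''u'')(0 := 0)))" by (simp add: P_def)
    fix k t
    assume k: "k < n" "P k t" "t ''u'' 0 = k" and t: "\<And>y. y \<notin> insert ''u'' (writes ?d) \<Longrightarrow> t y = s1 y"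
    have l: "loaded t" by (rule loaded_frame[OF l1], rule t, assumption, simp add: input_vars_def)
    have kN: "k < gsize" using k n_le_gsize by simp
    have inj: "inj_on (\<lambda>v. k * gsize + v) {..<n}" by (simp add: inj_on_def)
    have "(v < n \<longrightarrow> runB ?d t ''ca'' (k * gsize + v) = 0) \<and>
        (a \<notin> (\<lambda>v. k * gsize + v) ` {..<n} \<longrightarrow> runB ?d t ''ca'' a = t ''ca'' a)" for v a
      by (intro conjI impI; rule run_fill[where A = "\<lambda>v. k * gsize + v" and m = n and g = "\<lambda>_. 0"])
        (use loadedD[OF l] k inj kN in auto)
    moreover have "u * gsize + v \<notin> (\<lambda>v. k * gsize + v) ` {..<n}" if "u < k" "v < n" for u v
      using that n_le_gsize by (auto simp: row_eq_iff)
    ultimately show "P (Suc k) ((runB ?d t)(''u'' := (runB ?d t ''u'')(0 := Suc k)))"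
      using k(2) unfolding P_def by (auto simp: less_Suc_eq)
  qed simp
  have eq: "runB clear_prog s = runB (PFor ''u'' ''n'' ?d) s1" by (simp add: clear_prog_def s1_def)
  show "runB clear_prog s ''ic'' u = 0" unfolding eq using ic by (simp add: run_frame)
  show "v < n \<Longrightarrow> runB clear_prog s ''ca'' (u * gsize + v) = 0" unfolding eq using P assms(2) by (simp add: P_def)
qed

lemma color_adj_take_Suc:
  assumes "j < length es" "es ! j = (a, b, d)"
  shows "color_adj (take (Suc j) es) c u v \<longleftrightarrow>
    color_adj (take j es) c u v \<or> d = c \<and> (u = a \<and> v = b \<or> u = b \<and> v = a)"
  using assms by (auto simp: color_adj_def take_Suc_conv_app_nth)

lemma load_prog:
  assumes l: "loaded s" and i: "s ''i'' 0 = i"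
    and ic: "\<And>u. u < n \<Longrightarrow> s ''ic'' u = 0" and ca: "\<And>u v. u < n \<Longrightarrow> v < n \<Longrightarrow> s ''ca'' (u * gsize + v) = 0"
  defines "s' \<equiv> runB load_prog s"
  shows "u < n \<Longrightarrow> s' ''ic'' u \<noteq> 0 \<longleftrightarrow> in_color es (Suc i) u"
    "u < n \<Longrightarrow> v < n \<Longrightarrow> s' ''ca'' (u * gsize + v) \<noteq> 0 \<longleftrightarrow> adj i u v"
proof -
  define s0 where "s0 = runB (setr ''a'' (reg ''eb'')) s"
  \<comment> \<open>After \<open>j\<close> triples the arrays describe the color class within the
    first \<open>j\<close> edges; for \<open>j = 0\<close> this is the cleared state.\<close>
  define P where "P j t \<longleftrightarrow> t ''a'' 0 = 5 + n + K + 3 * j \<and>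
     (\<forall>u<n. t ''ic'' u \<noteq> 0 \<longleftrightarrow> in_color (take j es) (Suc i) u) \<and>
     (\<forall>u<n. \<forall>v<n. t ''ca'' (u * gsize + v) \<noteq> 0 \<longleftrightarrow> color_adj (take j es) (Suc i) u v)" for j and t :: state
  have fr0: "a \<noteq> ''a'' \<Longrightarrow> s0 a = s a" for a by (simp add: s0_def)
  have l0: "loaded s0" by (rule loaded_frame[OF l, where W = "{''a''}"]) (auto simp: input_vars_def fr0)
  have "P (length es) (runB (PFor ''j'' ''ne'' load_body) s0)"
  proof (rule run_For[where P = P])
    show "length es = min (s0 ''ne'' 0) (s0 ''B'' 0)" using loadedD[OF l0] by simp
    show "P 0 (s0(''j'' := (s0 ''j'')(0 := 0)))"
      using loadedD(6)[OF l] ic ca by (simp add: P_def s0_def in_color_def color_adj_def)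
    fix j t
    assume j: "j < length es" "P j t" "t ''j'' 0 = j" and t: "\<And>y. y \<notin> insert ''j'' (writes load_body) \<Longrightarrow> t y = s0 y"
    have lt: "loaded t" by (rule loaded_frame[OF l0], rule t, assumption, simp add: input_vars_def)
    have ti: "t ''i'' 0 = i" using t[of "''i''"] i by (simp add: fr0)
    obtain a b d where e: "es ! j = (a, b, d)" by (cases "es ! j")
    have abd: "t ''input'' (5 + n + K + 3 * j) = a" "t ''input'' (5 + n + K + 3 * j + 1) = b"
        "t ''input'' (5 + n + K + 3 * j + 2) = d"
      using loadedD(13)[OF lt j(1)] e by auto
    have ta: "t ''a'' 0 = 5 + n + K + 3 * j" using j(2) by (simp add: P_def)
    have ab: "a < n" "b < n" "a < gsize" "b < gsize"
      using es_wf[of a b d] nth_mem[OF j(1)] e n_le_gsize by auto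
    define t' where "t' = runB load_body t"
    have t': "t' ''a'' 0 = 5 + n + K + 3 * Suc j"
      "t' ''ic'' = (if d = Suc i then (t ''ic'')(a := 1, b := 1) else t ''ic'')"
      "t' ''ca'' = (if d = Suc i then (t ''ca'')(a * gsize + b := 1, b * gsize + a := 1) else t ''ca'')"
      unfolding t'_def using abd ta ti loadedD(11)[OF lt] ab by (simp_all add: add.assoc)
    have adj: "color_adj (take (Suc j) es) (Suc i) u v \<longleftrightarrow>
       color_adj (take j es) (Suc i) u v \<or> d = Suc i \<and> (u = a \<and> v = b \<or> u = b \<and> v = a)" for u v
      by (rule color_adj_take_Suc[OF j(1) e])
    have "P (Suc j) t'"
      unfolding P_def
    proof (intro conjI allI impI)
      show "t' ''a'' 0 = 5 + n + K + 3 * Suc j" by (rule t'(1))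
      fix u assume u: "u < n"
      show "t' ''ic'' u \<noteq> 0 \<longleftrightarrow> in_color (take (Suc j) es) (Suc i) u"
        using j(2) u unfolding P_def t' in_color_def adj by auto
      fix v assume v: "v < n"
      have "u < gsize" "v < gsize" using u v n_le_gsize by auto
      then show "t' ''ca'' (u * gsize + v) \<noteq> 0 \<longleftrightarrow> color_adj (take (Suc j) es) (Suc i) u v"
        using j(2) u v ab unfolding P_def t' adj by (auto simp: row_eq_iff)
    qed
    then show "P (Suc j) ((runB load_body t)(''j'' := (runB load_body t ''j'')(0 := Suc j)))"
      unfolding t'_def[symmetric] by (simp add: P_def)
  qed simp
  then have "P (length es) s'" by (simp add: s'_def load_prog_def s0_def)
  then show "u < n \<Longrightarrow> s' ''ic'' u \<noteq> 0 \<longleftrightarrow> in_color es (Suc i) u"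
    "u < n \<Longrightarrow> v < n \<Longrightarrow> s' ''ca'' (u * gsize + v) \<noteq> 0 \<longleftrightarrow> adj i u v"
    by (simp_all add: P_def)
qed

lemma rep_prog:
  assumes l: "loaded s"
    and ic: "\<And>u. u < n \<Longrightarrow> s ''ic'' u \<noteq> 0 \<longleftrightarrow> in_color es (Suc i) u"
    and ca: "\<And>u v. u < n \<Longrightarrow> v < n \<Longrightarrow> s ''ca'' (u * gsize + v) \<noteq> 0 \<longleftrightarrow> adj i u v"
    and u: "in_color es (Suc i) u"
  shows "runB rep_prog s ''rep'' u = rep i u"
proof -
  let ?c = "PAssign ''rep'' (reg ''u'') (reg ''u'') ;; PFor ''v'' ''n'' rep_body"
  define ok where "ok u w \<longleftrightarrow> in_color es (Suc i) w \<and> \<not> adj i u w" for u w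
  have okn: "w < n" if "ok u w" for u w using that in_color_D by (auto simp: ok_def)
  have body: "(in_color es (Suc i) k \<longrightarrow> runB ?c t ''rep'' k = rep i k) \<and>
      (\<forall>w. w \<noteq> k \<longrightarrow> runB ?c t ''rep'' w = t ''rep'' w)"
    if k: "k < n" "t ''u'' 0 = k" and t: "\<And>y. y \<notin> insert ''u'' (writes ?c) \<Longrightarrow> t y = s y" for k t
  proof -
    define t0 where "t0 = t(''rep'' := (t ''rep'')(k := k))"
    define P where "P j r \<longleftrightarrow> (in_color es (Suc i) k \<longrightarrow> ok k (r ''rep'' k) \<and> (\<forall>w<j. ok k w \<longrightarrow> r ''rep'' k \<le> w)) \<and>
       (\<forall>w. w \<noteq> k \<longrightarrow> r ''rep'' w = t ''rep'' w)" for j and r :: state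
    have lt: "loaded t" by (rule loaded_frame[OF l], rule t, assumption, simp add: input_vars_def)
    have l0: "loaded t0"
      by (rule loaded_frame[OF lt, where W = "{''rep''}"]) (simp_all add: t0_def input_vars_def)
    have "P n (runB (PFor ''v'' ''n'' rep_body) t0)"
    proof (rule run_For[where P = P])
      show "n = min (t0 ''n'' 0) (t0 ''B'' 0)" using loadedD[OF l0] by simp
      show "P 0 (t0(''v'' := (t0 ''v'')(0 := 0)))"
        using adj_D by (auto simp: P_def t0_def ok_def)
      fix j r
      assume j: "j < n" "P j r" "r ''v'' 0 = j" and r: "\<And>y. y \<notin> insert ''v'' (writes rep_body) \<Longrightarrow> r y = t0 y"
      have fr: "r ''ic'' = s ''ic''" "r ''ca'' = s ''ca''" "r ''row'' = s ''row''" "r ''u'' 0 = k"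
        using r t k(2) by (simp_all add: t0_def)
      have "k < gsize" using k n_le_gsize by simp
      then have "bval rep_test r
         \<longleftrightarrow> ok k j \<and> j < r ''rep'' k"
        using ic[OF j(1)] ca[OF k(1) j(1)] loadedD(11)[OF l, of k] by (auto simp: fr j(3) ok_def)
      then have *: "runB rep_body r = (if ok k j \<and> j < r ''rep'' k then r(''rep'' := (r ''rep'')(k := j)) else r)"
        unfolding run.simps(4) by (simp add: fr j(3))
      show "P (Suc j) ((runB rep_body r)(''v'' := (runB rep_body r ''v'')(0 := Suc j)))"
        using j(2) unfolding * P_def by (auto simp: less_Suc_eq split: if_splits)
    qed simp
    moreover have "runB ?c t = runB (PFor ''v'' ''n'' rep_body) t0" using k(2) by (simp add: t0_def)
    ultimately have P: "P n (runB ?c t)" by simp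
    moreover have "rep i k = runB ?c t ''rep'' k" if "in_color es (Suc i) k"
      unfolding part_rep_def using P that okn unfolding P_def ok_def
      by (intro Least_equality) auto
    ultimately show ?thesis by (auto simp: P_def)
  qed
  define Q where "Q k r \<longleftrightarrow> (\<forall>u<k. in_color es (Suc i) u \<longrightarrow> r ''rep'' u = rep i u)" for k and r :: state
  have "Q n (runB rep_prog s)"
    unfolding rep_prog_def
  proof (rule run_For[where P = Q])
    show "n = min (s ''n'' 0) (s ''B'' 0)" using loadedD[OF l] by simp
    show "Q 0 (s(''u'' := (s ''u'')(0 := 0)))" by (simp add: Q_def)
    fix k t
    assume k: "k < n" "Q k t" "t ''u'' 0 = k" and t: "\<And>y. y \<notin> insert ''u'' (writes ?c) \<Longrightarrow> t y = s y"
    show "Q (Suc k) ((runB ?c t)(''u'' := (runB ?c t ''u'')(0 := Suc k)))"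
      using body[OF k(1,3) t] k(2) unfolding Q_def by (auto simp: less_Suc_eq simp del: run.simps)
  qed simp
  then show ?thesis using u in_color_D[OF u] by (simp add: Q_def)
qed

text \<open>\<open>link\<close> writes both directions of an edge, whereas \<open>slot_edges\<close>
  and \<open>all_edges\<close> list one.\<close>

definition sym_hull :: "(nat \<times> nat) set \<Rightarrow> (nat \<times> nat) set" where
  "sym_hull A = A \<union> A\<inverse>"

lemma sym_hull_simps: "sym_hull {(a, b)} = {(a, b), (b, a)}"
  "sym_hull (A \<union> B) = sym_hull A \<union> sym_hull B" "sym_hull (\<Union>x\<in>X. f x) = (\<Union>x\<in>X. sym_hull (f x))"
  "sym_hull {} = {}"
  by (auto simp: sym_hull_def)

lemma offset_lt_gsize: "i < K \<Longrightarrow> k < n \<Longrightarrow> r < 2 * n + 2 \<Longrightarrow> offset i k + r < gsize"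
  using offset_bound[of i k r] by (simp add: gsize_def)

lemma slot_prog:
  assumes l: "loaded s" and ik: "s ''i'' 0 = i" "i < K" "s ''k'' 0 = k" "k < n" and o: "s ''o'' 0 = offset i k"
    and ic: "\<And>u. u < n \<Longrightarrow> s ''ic'' u \<noteq> 0 \<longleftrightarrow> in_color es (Suc i) u"
    and rep: "\<And>u. in_color es (Suc i) u \<Longrightarrow> s ''rep'' u = rep i u"
  defines "s' \<equiv> runB slot_prog s"
  shows "graph_in gsize s' = graph_in gsize s \<union> sym_hull (slot_edges i k (offset i k))"
    "s' ''o'' 0 = offset i (Suc k)"
proof -
  let ?o = "offset i k" and ?N = gsize
  define s1 where "s1 = runB (PFor ''w'' ''n'' gate_body) s"
  define s2 where "s2 = runB (link hubA_reg hubB_reg) s1"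
  define s3 where "s3 = runB (PCond (Less (reg ''k'') (Read ''input'' (Plus (Plus (Const 5) (reg ''n'')) (reg ''i''))))
       (PFor ''u'' ''n'' port_body) PSkip) s2"
  have fr1: "a \<notin> {''w'', ''adj''} \<Longrightarrow> s1 a = s a" for a unfolding s1_def by (rule run_frame) simp
  have fr2: "a \<notin> {''w'', ''adj''} \<Longrightarrow> s2 a = s a" for a
    unfolding s2_def using run_frame[of a "link hubA_reg hubB_reg" "''B''" s1] fr1[of a] by simp
  have fr3: "a \<notin> {''w'', ''u'', ''adj''} \<Longrightarrow> s3 a = s a" for a
    unfolding s3_def using run_frame[of a "PFor ''u'' ''n'' port_body" "''B''" s2] fr2[of a] by simp
  have l1: "loaded s1" by (rule loaded_frame[OF l], rule fr1, assumption, simp add: input_vars_def)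
  have l2: "loaded s2" by (rule loaded_frame[OF l], rule fr2, assumption, simp add: input_vars_def)
  have lt: "?o + r < ?N" if "r < 2 * n + 2" for r using offset_lt_gsize ik that by simp
  have "graph_in ?N s1 = graph_in ?N s \<union> (\<Union>w<n. sym_hull {(?o + w, ?o + n + w), (?o + n + w, ?o + 2 * n), (?o + n + w, ?o + 2 * n + 1)})"
    unfolding s1_def
  proof (rule graph_in_For)
    show "n = min (s ''n'' 0) (s ''B'' 0)" using loadedD[OF l] by simp
    fix w t assume w: "w < n" "t ''w'' 0 = w" and t: "\<And>y. y \<notin> insert ''w'' (writes gate_body) \<Longrightarrow> t y = s y"
    define t1 where "t1 = runB (link port_reg gate_reg) t"
    define t2 where "t2 = runB (link gate_reg hubA_reg) t1"
    have f1: "a \<noteq> ''adj'' \<Longrightarrow> t1 a = t a" for a unfolding t1_def by (rule run_frame) simp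
    have f2: "a \<noteq> ''adj'' \<Longrightarrow> t2 a = t a" for a
      unfolding t2_def using run_frame[of a "link gate_reg hubA_reg" "''B''" t1] f1[of a] by simp
    have v: "t ''o'' 0 = ?o" "t ''n'' 0 = n" using t o loadedD[OF l] by simp_all
    have e: "env ?N t" "env ?N t1" "env ?N t2"
      using loadedD(1)[OF l] t f1 f2 by (simp_all add: env_def)
    have b: "?o + w < ?N" "?o + n + w < ?N" "?o + (n + n) < ?N" "?o + (n + n) + 1 < ?N"
      using lt[of w] lt[of "n + w"] lt[of "2 * n"] lt[of "2 * n + 1"] w by (simp_all add: add.assoc mult_2)
    have "graph_in ?N (runB gate_body t) = graph_in ?N (runB (link gate_reg hubB_reg) t2)"
      by (simp add: t1_def t2_def)
    also have "\<dots> = graph_in ?N t2 \<union> {(?o + n + w, ?o + (n + n) + 1), (?o + (n + n) + 1, ?o + n + w)}"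
      using link[OF e(3), of gate_reg hubB_reg] b v w f2 by simp
    also have "graph_in ?N t2 = graph_in ?N t1 \<union> {(?o + n + w, ?o + (n + n)), (?o + (n + n), ?o + n + w)}"
      unfolding t2_def using link[OF e(2), of gate_reg hubA_reg] b v w f1 by simp
    also have "graph_in ?N t1 = graph_in ?N t \<union> {(?o + w, ?o + n + w), (?o + n + w, ?o + w)}"
      unfolding t1_def using link[OF e(1), of port_reg gate_reg] b v w by simp
    finally show "graph_in ?N (runB gate_body t) = graph_in ?N t \<union>
       sym_hull {(?o + w, ?o + n + w), (?o + n + w, ?o + 2 * n), (?o + n + w, ?o + 2 * n + 1)}"
      by (auto simp: sym_hull_def mult_2 add.assoc)
  qed simp_all
  moreover have "graph_in ?N s2 = graph_in ?N s1 \<union> sym_hull {(?o + 2 * n, ?o + 2 * n + 1)}"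
    unfolding s2_def using link[OF loadedD(1)[OF l1], of hubA_reg hubB_reg] fr1 o loadedD(2)[OF l] lt[of "2 * n"] lt[of "2 * n + 1"]
    by (simp add: sym_hull_simps mult_2 add.assoc)
  moreover have "graph_in ?N s3 = graph_in ?N s2 \<union>
    sym_hull (\<Union>u\<in>{u. u < n \<and> in_color es (Suc i) u \<and> k < m i}. {(u, ?o + rep i u)})"
  proof (cases "k < m i")
    case False
    then have "s3 = s2" unfolding s3_def using fr2 ik loadedD(2)[OF l] loadedD(12)[OF l ik(2)] by simp
    then show ?thesis using False by (simp add: sym_hull_simps)
  next
    case True
    then have s3: "s3 = runB (PFor ''u'' ''n'' port_body) s2"
      unfolding s3_def using fr2 ik loadedD(2)[OF l] loadedD(12)[OF l ik(2)] by simp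
    have "graph_in ?N s3 = graph_in ?N s2 \<union>
        (\<Union>u<n. if in_color es (Suc i) u then sym_hull {(u, ?o + rep i u)} else {})"
      unfolding s3
    proof (rule graph_in_For)
      show "n = min (s2 ''n'' 0) (s2 ''B'' 0)" using loadedD[OF l2] by simp
      fix u t assume u: "u < n" "t ''u'' 0 = u" and t: "\<And>y. y \<notin> insert ''u'' (writes port_body) \<Longrightarrow> t y = s2 y"
      have v: "t ''ic'' = s ''ic''" "t ''rep'' = s ''rep''" "t ''o'' 0 = ?o" using t fr2 o by simp_all
      have e: "env ?N t" using loadedD(1)[OF l2] t by (simp add: env_def)
      show "graph_in ?N (runB port_body t) = graph_in ?N t \<union>
        (if in_color es (Suc i) u then sym_hull {(u, ?o + rep i u)} else {})"
      proof (cases "in_color es (Suc i) u")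
        case True
        then have "?o + rep i u < ?N" using lt[of "rep i u"] part_rep(3)[OF True] by simp
        then show ?thesis
          using link[OF e, of "reg ''u''" "Plus (reg ''o'') (Read ''rep'' (reg ''u''))"]
            u v True ic[OF u(1)] rep[OF True] n_le_gsize by (simp add: sym_hull_simps)
      next
        case False
        then show ?thesis using u v ic[OF u(1)] by simp
      qed
    qed simp_all
    then show ?thesis using True by (auto simp: sym_hull_simps split: if_splits)
  qed
  moreover have s': "s' = s3(''o'' := (s3 ''o'')(0 := offset i k + (n + n) + 2))"
    using fr3 o loadedD(2)[OF l] unfolding s'_def slot_prog_def by (simp add: s1_def s2_def s3_def)
  moreover have "graph_in ?N s' = graph_in ?N s3" by (rule graph_in_cong) (simp add: s')
  ultimately show "graph_in gsize s' = graph_in gsize s \<union> sym_hull (slot_edges i k (offset i k))"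
    unfolding slot_edges_def sym_hull_simps(2,3) by (simp only: Un_assoc)
  show "s' ''o'' 0 = offset i (Suc k)" unfolding s' by (simp add: offset_def)
qed

lemma color_prog:
  assumes l: "loaded s" and i: "s ''i'' 0 = i" "i < K" and o: "s ''o'' 0 = offset i 0"
  defines "s' \<equiv> runB color_prog s"
  shows "graph_in gsize s' = graph_in gsize s \<union> (\<Union>k<n. sym_hull (slot_edges i k (offset i k)))"
    "s' ''o'' 0 = offset (Suc i) 0"
proof -
  define s1 where "s1 = runB clear_prog s"
  define s2 where "s2 = runB load_prog s1"
  define s3 where "s3 = runB rep_prog s2"
  have fr1: "a \<notin> {''u'', ''v'', ''ic'', ''ca''} \<Longrightarrow> s1 a = s a" for a
    unfolding s1_def by (rule run_frame) (simp add: writes_build)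
  have fr2: "a \<notin> {''a'', ''j'', ''ic'', ''ca''} \<Longrightarrow> s2 a = s1 a" for a
    unfolding s2_def by (rule run_frame) (simp add: writes_build)
  have fr3: "a \<notin> {''u'', ''v'', ''rep''} \<Longrightarrow> s3 a = s2 a" for a
    unfolding s3_def by (rule run_frame) (simp add: writes_build)
  have l1: "loaded s1" by (rule loaded_frame[OF l], rule fr1, assumption, simp add: input_vars_def)
  have l2: "loaded s2" by (rule loaded_frame[OF l1], rule fr2, assumption, simp add: input_vars_def)
  have l3: "loaded s3" by (rule loaded_frame[OF l2], rule fr3, assumption, simp add: input_vars_def)
  have i1: "s1 ''i'' 0 = i" using i fr1 by simp
  have ic: "u < n \<Longrightarrow> s2 ''ic'' u \<noteq> 0 \<longleftrightarrow> in_color es (Suc i) u"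
    and ca: "u < n \<Longrightarrow> v < n \<Longrightarrow> s2 ''ca'' (u * gsize + v) \<noteq> 0 \<longleftrightarrow> adj i u v" for u v
    using load_prog[OF l1 i1] clear_prog[OF l] unfolding s1_def[symmetric] s2_def[symmetric] by blast+
  have rep: "in_color es (Suc i) u \<Longrightarrow> s3 ''rep'' u = rep i u" for u
    using rep_prog[OF l2 ic ca] unfolding s3_def .
  define P where "P k t \<longleftrightarrow> graph_in gsize t = graph_in gsize s3 \<union> (\<Union>k<k. sym_hull (slot_edges i k (offset i k)))
      \<and> t ''o'' 0 = offset i k" for k t
  have "P n (runB (PFor ''k'' ''n'' slot_prog) s3)"
  proof (rule run_For[where P = P])
    show "wf_prog ''B'' (PFor ''k'' ''n'' slot_prog)" using wf_color_prog by (simp add: color_prog_def)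
    show "n = min (s3 ''n'' 0) (s3 ''B'' 0)" using loadedD[OF l3] by simp
    show "P 0 (s3(''k'' := (s3 ''k'')(0 := 0)))" using o fr1 fr2 fr3 by (simp add: P_def graph_in_def)
    fix k t
    assume k: "k < n" "P k t" "t ''k'' 0 = k" and t: "\<And>y. y \<notin> insert ''k'' (writes slot_prog) \<Longrightarrow> t y = s3 y"
    have t': "\<And>y. y \<notin> {''k'', ''w'', ''u'', ''o'', ''adj''} \<Longrightarrow> t y = s3 y" using t by (simp add: writes_build)
    have lt: "loaded t" by (rule loaded_frame[OF l3], rule t', assumption, simp add: input_vars_def)
    have "graph_in gsize (runB slot_prog t) = graph_in gsize t \<union> sym_hull (slot_edges i k (offset i k))"
      "runB slot_prog t ''o'' 0 = offset i (Suc k)"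
      using slot_prog[OF lt _ i(2) k(3,1)] t' i1 fr2 fr3 k(2) ic rep by (simp_all add: P_def)
    then show "P (Suc k) ((runB slot_prog t)(''k'' := (runB slot_prog t ''k'')(0 := Suc k)))"
      using k(2) unfolding P_def
      by (subst graph_in_cong[of _ "runB slot_prog t"]) (auto simp: less_Suc_eq)
  qed
  moreover have "runB (PFor ''k'' ''n'' slot_prog) s3 = s'"
    by (simp add: s'_def color_prog_def s1_def s2_def s3_def)
  moreover have "graph_in gsize s3 = graph_in gsize s"
    by (rule graph_in_cong) (simp add: fr1 fr2 fr3)
  ultimately show "graph_in gsize s' = graph_in gsize s \<union> (\<Union>k<n. sym_hull (slot_edges i k (offset i k)))"
    "s' ''o'' 0 = offset (Suc i) 0"
    by (simp_all add: P_def offset_def)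
qed

text \<open>After the last slot the address \<open>o\<close> equals \<open>dummy_offset\<close>,
  where the dummies begin. That \<open>adj\<close> is empty at the start is due to the
  zero-initialized memory.\<close>

lemma build_prog:
  assumes init: "s ''N'' 0 = gsize" "gsize \<le> s ''B'' 0" "s ''n'' 0 = n" "s ''ne'' 0 = length es" "s ''K'' 0 = K"
     "s ''z'' 0 = n - 2 * p" "n \<le> s ''B'' 0" "length es \<le> s ''B'' 0" "K \<le> s ''B'' 0" "n - 2 * p \<le> s ''B'' 0"
     "\<And>i. i < K \<Longrightarrow> s ''input'' (5 + n + i) = m i"
     "\<And>j. j < length es \<Longrightarrow> (s ''input'' (5 + n + K + 3 * j), s ''input'' (5 + n + K + 3 * j + 1),
        s ''input'' (5 + n + K + 3 * j + 2)) = es ! j"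
     "graph_in gsize s = {}"
  defines "s' \<equiv> runB build_prog s"
  shows "env gsize s'" "graph_in gsize s' = sym_hull all_edges"
proof -
  let ?r = "PAssign ''row'' (reg ''u'') (reg ''o'') ;; setr ''o'' (Plus (reg ''o'') (reg ''N''))"
  define s0 where "s0 = runB rows_init s"
  have fr0: "a \<notin> {''o'', ''u'', ''row''} \<Longrightarrow> s0 a = s a" for a
    unfolding s0_def by (rule run_frame) (simp add: writes_build)
  define R where "R k t \<longleftrightarrow> t ''o'' 0 = k * gsize \<and> (\<forall>u<k. t ''row'' u = u * gsize)" for k and t :: state
  have "R gsize s0"
    unfolding s0_def rows_init_def run.simps(3)
  proof (rule run_For[where P = R])
    fix k t
    assume k: "k < gsize" "R k t" "t ''u'' 0 = k" and
      t: "\<And>y. y \<notin> insert ''u'' (writes ?r) \<Longrightarrow> t y = runB (setr ''o'' (Const 0)) s y"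
    have "t ''N'' 0 = gsize" using t[of "''N''"] init by simp
    then show "R (Suc k) ((runB ?r t)(''u'' := (runB ?r t ''u'')(0 := Suc k)))"
      using k by (auto simp: R_def less_Suc_eq)
  qed (use init in \<open>auto simp: R_def\<close>)
  define s1 where "s1 = s0(''o'' := (s0 ''o'')(0 := n), ''eb'' := (s0 ''eb'')(0 := 5 + n + K))"
  have fr1: "a \<notin> {''o'', ''u'', ''row'', ''eb''} \<Longrightarrow> s1 a = s a" for a using fr0 by (simp add: s1_def)
  have l1: "loaded s1"
    unfolding loaded_def env_def using init \<open>R gsize s0\<close> by (simp add: fr1 R_def) (simp add: s1_def)
  define s2 where "s2 = runB (PFor ''i'' ''K'' color_prog) s1"
  let ?d = "PFor ''u'' ''n'' (link (Plus (reg ''o'') (reg ''d'')) (reg ''u''))"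
  have s': "s' = runB (PFor ''d'' ''z'' ?d) s2"
    unfolding s'_def build_prog_def using init fr0
    by (simp add: s0_def[symmetric] s1_def s2_def)
  have w: "writes color_prog \<inter> input_vars = {}" by (auto simp: build_defs input_vars_def)
  define P where "P i t \<longleftrightarrow> graph_in gsize t = (\<Union>i<i. \<Union>k<n. sym_hull (slot_edges i k (offset i k)))
      \<and> t ''o'' 0 = offset i 0" for i t
  have P: "P K s2"
    unfolding s2_def
  proof (rule run_For[where P = P])
    show "wf_prog ''B'' (PFor ''i'' ''K'' color_prog)" using wf_color_prog by (simp add: build_defs)
    show "K = min (s1 ''K'' 0) (s1 ''B'' 0)" using loadedD[OF l1] by simp
    show "P 0 (s1(''i'' := (s1 ''i'')(0 := 0)))"
      using init(13) by (simp add: P_def graph_in_def fr1) (simp add: s1_def offset_def)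
    fix i t
    assume i: "i < K" "P i t" "t ''i'' 0 = i" and t: "\<And>y. y \<notin> insert ''i'' (writes color_prog) \<Longrightarrow> t y = s1 y"
    have lt: "loaded t"
      by (rule loaded_frame[OF l1], rule t, assumption) (use w in \<open>simp add: input_vars_def\<close>)
    have "graph_in gsize (runB color_prog t) = graph_in gsize t \<union> (\<Union>k<n. sym_hull (slot_edges i k (offset i k)))"
      "runB color_prog t ''o'' 0 = offset (Suc i) 0"
      using color_prog[OF lt i(3,1)] i(2) by (simp_all add: P_def)
    then show "P (Suc i) ((runB color_prog t)(''i'' := (runB color_prog t ''i'')(0 := Suc i)))"
      using i(2) unfolding P_def
      by (subst graph_in_cong[of _ "runB color_prog t"]) (simp_all add: lessThan_Suc Un_commute)
  qed
  have fr2: "a \<notin> insert ''i'' (writes color_prog) \<Longrightarrow> s2 a = s1 a" for a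
    unfolding s2_def by (rule run_frame) simp
  have l2: "loaded s2"
    by (rule loaded_frame[OF l1], rule fr2, assumption) (use w in \<open>simp add: input_vars_def\<close>)
  have o2: "s2 ''o'' 0 = dummy_offset" using P by (simp add: P_def offset_def dummy_offset_def)
  have "graph_in gsize s' = graph_in gsize s2 \<union> (\<Union>d<n - 2 * p. \<Union>u<n. sym_hull {(dummy_offset + d, u)})"
    unfolding s'
  proof (rule graph_in_For)
    show "n - 2 * p = min (s2 ''z'' 0) (s2 ''B'' 0)" using loadedD(5)[OF l2] loadedD(10)[OF l2] by simp
    fix d t assume d: "d < n - 2 * p" "t ''d'' 0 = d" and t: "\<And>y. y \<notin> insert ''d'' (writes ?d) \<Longrightarrow> t y = s2 y"
    have lt: "loaded t" by (rule loaded_frame[OF l2], rule t, assumption, simp add: input_vars_def)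
    have ot: "t ''o'' 0 = dummy_offset" using t o2 by simp
    show "graph_in gsize (runB ?d t) = graph_in gsize t \<union> (\<Union>u<n. sym_hull {(dummy_offset + d, u)})"
    proof (rule graph_in_For)
      show "n = min (t ''n'' 0) (t ''B'' 0)" using loadedD[OF lt] by simp
      fix u r assume u: "u < n" "r ''u'' 0 = u"
        and r: "\<And>y. y \<notin> insert ''u'' (writes (link (Plus (reg ''o'') (reg ''d'')) (reg ''u''))) \<Longrightarrow> r y = t y"
      have "env gsize r" "r ''o'' 0 = dummy_offset" "r ''d'' 0 = d"
        using loadedD(1)[OF lt] r ot d(2) by (simp_all add: env_def)
      moreover have "dummy_offset + d < gsize" "u < gsize" using d u n_le_gsize by (simp_all add: gsize_def)
      ultimately show "graph_in gsize (runB (link (Plus (reg ''o'') (reg ''d'')) (reg ''u'')) r) =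
          graph_in gsize r \<union> sym_hull {(dummy_offset + d, u)}"
        using link[of gsize r "Plus (reg ''o'') (reg ''d'')" "reg ''u''"] u by (simp add: sym_hull_simps)
    qed simp_all
  qed simp_all
  then show "graph_in gsize s' = sym_hull all_edges"
    using P unfolding P_def all_edges_def by (simp add: sym_hull_simps)
  have "loaded s'" unfolding s'
    by (rule loaded_frame[OF l2, where W = "{''d'', ''u'', ''adj''}"]) (simp_all add: run_frame input_vars_def)
  then show "env gsize s'" by (rule loadedD)
qed

lemma build_match:
  assumes "env gsize s" "graph_in gsize s = sym_hull all_edges"
  shows "runB match_prog s ''output'' 0 \<noteq> 0 \<longleftrightarrow> (\<exists>X P Q. slots X P Q)"
proof -
  have E: "edge_in gsize s u v \<longleftrightarrow> (u, v) \<in> all_edges \<union> all_edges\<inverse>" if "u < gsize" "v < gsize" for u v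
  proof -
    have "edge_in gsize s u v \<longleftrightarrow> (u, v) \<in> graph_in gsize s" using that by (simp add: edge_in_def graph_in_def)
    then show ?thesis by (simp add: assms(2) sym_hull_def)
  qed
  have "sym_adj gsize s" unfolding sym_adj_def using E by auto
  then have "runB match_prog s ''output'' 0 \<noteq> 0 \<longleftrightarrow> has_perfect_matching {..<gsize} (edge_in gsize s)"
    by (rule match_prog[OF assms(1)])
  \<comment> \<open>The two relations agree only below \<open>gsize\<close>, so the claim is
    transferred along the identity map.\<close>
  also have "\<dots> \<longleftrightarrow> has_perfect_matching {..<gsize} (\<lambda>x y. (x, y) \<in> all_edges \<union> all_edges\<inverse>)"
    by (rule has_perfect_matching_bij[of id]) (use E in auto)
  finally show ?thesis unfolding has_perfect_matching_code .
qed

end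

section \<open>The decision program\<close>

lemma concat_triples:
  fixes es :: "(nat \<times> nat \<times> nat) list"
  assumes "j < length es"
  defines "c \<equiv> concat (map (\<lambda>(u, v, i). [u, v, i]) es)"
  shows "(c ! (3 * j), c ! (3 * j + 1), c ! (3 * j + 2)) = es ! j"
  unfolding c_def using assms(1)
proof (induction es arbitrary: j)
  case (Cons e es)
  obtain u v i where e: "e = (u, v, i)" by (cases e)
  show ?case
  proof (cases j)
    case 0
    then show ?thesis by (simp add: e numeral_2_eq_2)
  next
    case (Suc k)
    show ?thesis using Cons.IH[of k] Cons.prems by (simp add: e Suc)
  qed
qed simp

lemma length_concat_triples: "length (concat (map (\<lambda>(u, v, i). [u, v, i]) es)) = 3 * length es"
  by (induction es) auto

lemma length_encode: "length (encode I) = 5 + nverts I + length (bounds I) + 3 * length (edge_list I)"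
  using length_concat_triples[of "edge_list I"] by (simp add: encode_def)

lemma encode_nth:
  "encode I ! 0 = nverts I" "encode I ! 1 = length (edge_list I)" "encode I ! 2 = length (bounds I)"
  "encode I ! 3 = (if target I < 0 then 1 else 0)" "encode I ! 4 = nat \<bar>target I\<bar>"
  by (simp_all add: encode_def numeral_2_eq_2 numeral_3_eq_3 nth_append eval_nat_numeral)

lemma encode_bounds: "i < length (bounds I) \<Longrightarrow> encode I ! (5 + nverts I + i) = bounds I ! i"
  by (simp add: encode_def nth_append eval_nat_numeral)

lemma encode_edges:
  assumes "j < length (edge_list I)"
  defines "k \<equiv> 5 + nverts I + length (bounds I) + 3 * j"
  shows "(encode I ! k, encode I ! (k + 1), encode I ! (k + 2)) = edge_list I ! j"
proof -
  let ?h = "[nverts I, length (edge_list I), length (bounds I),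
      (if target I < 0 then 1 else 0), nat \<bar>target I\<bar>] @ [0..<nverts I] @ bounds I"
  let ?c = "concat (map (\<lambda>(u, v, i). [u, v, i]) (edge_list I))"
  have e: "encode I = ?h @ ?c" by (simp add: encode_def)
  have h: "length ?h = 5 + nverts I + length (bounds I)" by simp
  have "encode I ! (k + r) = ?c ! (3 * j + r)" for r
    unfolding e k_def using nth_append_length_plus[of ?h ?c "3 * j + r"] unfolding h by (simp add: add.assoc)
  from this[of 0] this[of 1] this[of 2] show ?thesis using concat_triples[OF assms(1)] by simp
qed

text \<open>Every word contributes at least one bit, so bounds in the number of words carry over to
  the bit length.\<close>

lemma length_le_input_size: "length w \<le> input_size w"
  by (induction w) (auto simp: input_size_def)

lemma size_prog:
  assumes n: "s ''input'' 0 = n" "n \<le> s ''length'' 0" and K: "s ''input'' 2 = K" "K \<le> s ''length'' 0"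
    and p: "s ''input'' 4 = p"
  defines "s' \<equiv> run ''length'' size_prog s"
  shows "s' ''n'' 0 = n" "s' ''ne'' 0 = s ''input'' 1" "s' ''K'' 0 = K" "s' ''sg'' 0 = s ''input'' 3"
    "s' ''p'' 0 = p" "s' ''z'' 0 = n - 2 * p" "s' ''N'' 0 = n + K * n * (2 * n + 2) + (n - 2 * p)"
    "s' ''B'' 0 = s' ''N'' 0 + s ''length'' 0" "s' ''input'' = s ''input''" "s' ''adj'' = s ''adj''"
    "s' ''output'' = s ''output''"
proof -
  let ?c = "setr ''N'' (Plus (reg ''N'') (Plus (Plus (reg ''n'') (reg ''n'')) (Const 2)))"
  let ?d = "PFor ''k'' ''n'' ?c"
  define s1 where "s1 = run ''length'' (setr ''n'' (Read ''input'' (Const 0)) ;; setr ''ne'' (Read ''input'' (Const 1)) ;;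
     setr ''K'' (Read ''input'' (Const 2)) ;; setr ''sg'' (Read ''input'' (Const 3)) ;;
     setr ''p'' (Read ''input'' (Const 4)) ;; setr ''N'' (reg ''n'')) s"
  have s1: "s1 ''n'' 0 = n" "s1 ''ne'' 0 = s ''input'' 1" "s1 ''K'' 0 = K" "s1 ''sg'' 0 = s ''input'' 3" "s1 ''p'' 0 = p"
    "s1 ''N'' 0 = n" "s1 ''input'' = s ''input''" "s1 ''adj'' = s ''adj''" "s1 ''output'' = s ''output''"
    "s1 ''length'' = s ''length''"
    using n K p by (simp_all add: s1_def)
  define s2 where "s2 = run ''length'' (PFor ''i'' ''K'' ?d) s1"
  have fr2: "a \<notin> {''i'', ''k'', ''N''} \<Longrightarrow> s2 a = s1 a" for a unfolding s2_def by (rule run_frame) simp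
  define P where "P i t \<longleftrightarrow> t ''N'' 0 = n + i * n * (2 * n + 2)" for i and t :: state
  have "P K s2"
    unfolding s2_def
  proof (rule run_For[where P = P])
    show "K = min (s1 ''K'' 0) (s1 ''length'' 0)" using K s1 by simp
    show "P 0 (s1(''i'' := (s1 ''i'')(0 := 0)))" using s1 by (simp add: P_def)
    fix i t
    assume i: "i < K" "P i t" "t ''i'' 0 = i" and t: "\<And>y. y \<notin> insert ''i'' (writes ?d) \<Longrightarrow> t y = s1 y"
    define Q where "Q k r \<longleftrightarrow> r ''N'' 0 = n + i * n * (2 * n + 2) + k * (2 * n + 2)" for k and r :: state
    have "Q n (run ''length'' ?d t)"
    proof (rule run_For[where P = Q])
      show "n = min (t ''n'' 0) (t ''length'' 0)" using n s1 t by simp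
      show "Q 0 (t(''k'' := (t ''k'')(0 := 0)))" using i(2) by (simp add: P_def Q_def)
      fix k r
      assume "k < n" "Q k r" "r ''k'' 0 = k" and r: "\<And>y. y \<notin> insert ''k'' (writes ?c) \<Longrightarrow> r y = t y"
      moreover have "r ''n'' 0 = n" using r t s1 by simp
      ultimately show "Q (Suc k) ((run ''length'' ?c r)(''k'' := (run ''length'' ?c r ''k'')(0 := Suc k)))"
        by (simp add: Q_def)
    qed simp
    then show "P (Suc i) ((run ''length'' ?d t)(''i'' := (run ''length'' ?d t ''i'')(0 := Suc i)))"
      by (simp add: P_def Q_def algebra_simps)
  qed simp
  then have N2: "s2 ''N'' 0 = n + K * n * (2 * n + 2)" by (simp add: P_def)
  have "s' = run ''length'' (setr ''z'' (Minus (Minus (reg ''n'') (reg ''p'')) (reg ''p'')) ;;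
     setr ''N'' (Plus (reg ''N'') (reg ''z'')) ;; setr ''B'' (Plus (reg ''N'') (reg ''length''))) s2"
    by (simp add: s'_def size_prog_def s2_def s1_def)
  then show "s' ''n'' 0 = n" "s' ''ne'' 0 = s ''input'' 1" "s' ''K'' 0 = K" "s' ''sg'' 0 = s ''input'' 3"
    "s' ''p'' 0 = p" "s' ''z'' 0 = n - 2 * p" "s' ''N'' 0 = n + K * n * (2 * n + 2) + (n - 2 * p)"
    "s' ''B'' 0 = s' ''N'' 0 + s ''length'' 0" "s' ''input'' = s ''input''" "s' ''adj'' = s ''adj''"
    "s' ''output'' = s ''output''"
    using s1 fr2 N2 by (simp_all add: mult_2)
qed

lemma card_matching_le:
  assumes I: "I \<in> grm_instances" and M: "matching (graph_of I) M"
  shows "2 * card M \<le> nverts I"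
proof -
  have wf: "wf_ecgraph (graph_of I)" using I by (simp add: grm_instances_def)
  have ME: "M \<subseteq> edges (graph_of I)" and dis: "disjoint_family_on (ends (graph_of I)) M"
    using M by (auto simp: matching_def)
  have e: "ends (graph_of I) e \<subseteq> {..<nverts I}" "card (ends (graph_of I) e) = 2" if "e \<in> M" for e
    using bspec[OF conjunct2[OF conjunct2[OF wf[unfolded wf_ecgraph_def]]], of e] ME that
    by (auto simp: graph_of_def)
  have "finite M" using ME by (rule finite_subset) (simp add: graph_of_def)
  then have "card (\<Union>e\<in>M. ends (graph_of I) e) = (\<Sum>e\<in>M. card (ends (graph_of I) e))"
    using dis e by (intro card_UN_disjoint) (auto simp: disjoint_family_on_def intro!: card_ge_0_finite)
  also have "\<dots> = 2 * card M" using e(2) by simp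
  finally show ?thesis
    using card_mono[of "{..<nverts I}" "\<Union>e\<in>M. ends (graph_of I) e"] e(1) by auto
qed

text \<open>In \<open>[:0, 3, 2, 2:]\<close> the argument is the number \<open>L\<close> of input
  words, which bounds \<open>n\<close> and \<open>K\<close>. The terms \<open>n\<close>,
  \<open>n - 2 * p\<close> and \<open>L\<close> of \<open>B\<close> account for
  \<open>3 * L\<close>, and \<open>K * n * (2 * n + 2)\<close> is at most
  \<open>2 * L^2 + 2 * L^3\<close>.\<close>

lemma main_prog_correct:
  assumes I: "I \<in> grm_instances" "strictly_CM_colored (graph_of I)"
  defines "s \<equiv> run ''length'' size_prog (init_state (encode I))"
  shows "accepting (runB main_prog s) \<longleftrightarrow> grm_yes I"
    "s ''B'' 0 \<le> poly [:0, 3, 2, 2:] (length (encode I))"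
proof -
  let ?w = "encode I"
  define n where "n = nverts I"
  define K where "K = length (bounds I)"
  define p where "p = nat \<bar>target I\<bar>"
  have L: "length ?w = 5 + n + K + 3 * length (edge_list I)" by (simp add: length_encode n_def K_def)
  have inp: "init_state ?w ''input'' i = ?w ! i" if "i < length ?w" for i using that by (simp add: init_state_def)
  have len: "init_state ?w ''length'' 0 = length ?w" by (simp add: init_state_def)
  have hd: "init_state ?w ''input'' 0 = n" "init_state ?w ''input'' 1 = length (edge_list I)"
    "init_state ?w ''input'' 2 = K" "init_state ?w ''input'' 3 = (if target I < 0 then 1 else 0)"
    "init_state ?w ''input'' 4 = p"
    using encode_nth[of I] by (simp_all add: inp L n_def K_def p_def)
  have sz: "s ''n'' 0 = n" "s ''ne'' 0 = length (edge_list I)" "s ''K'' 0 = K" "s ''sg'' 0 = (if target I < 0 then 1 else 0)"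
    "s ''p'' 0 = p" "s ''z'' 0 = n - 2 * p" "s ''N'' 0 = n + K * n * (2 * n + 2) + (n - 2 * p)"
    "s ''B'' 0 = s ''N'' 0 + length ?w" "s ''input'' = init_state ?w ''input''" "s ''adj'' = init_state ?w ''adj''"
    "s ''output'' = init_state ?w ''output''"
    using size_prog[of "init_state ?w" n K p] unfolding len s_def[symmetric] hd by (simp_all add: L)
  have "K * n * (2 * n + 2) \<le> length ?w * length ?w * (2 * length ?w + 2)"
    by (intro mult_mono) (simp_all add: L)
  then show "s ''B'' 0 \<le> poly [:0, 3, 2, 2:] (length ?w)"
    unfolding sz(7,8) using L by (simp add: algebra_simps)
  show "accepting (runB main_prog s) \<longleftrightarrow> grm_yes I"
  proof (cases "target I \<le> 0")
    case True
    then have "accepting (runB main_prog s)"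
      by (auto simp: main_prog_def sz accepting_def p_def)
    moreover have "grm_yes I"
      unfolding grm_yes_def has_generalized_rainbow_matching_def using True
      by (intro exI[of _ "{}"]) (auto simp: matching_def disjoint_family_on_def)
    ultimately show ?thesis by simp
  next
    case False
    then have p: "target I = int p" "p \<noteq> 0" by (auto simp: p_def)
    show ?thesis
    proof (cases "n < 2 * p")
      case True
      then have "runB main_prog s = s" using p by (simp add: main_prog_def sz)
      moreover have "s ''output'' 0 = 0" unfolding sz by (simp add: init_state_def)
      moreover have "\<not> grm_yes I"
      proof
        assume "grm_yes I"
        then obtain M where "matching (graph_of I) M" "p \<le> card M"
          unfolding grm_yes_def has_generalized_rainbow_matching_def p by auto
        then show False using card_matching_le[OF I(1), of M] True by (simp add: n_def)
      qed
      ultimately show ?thesis by (simp add: accepting_def)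
    next
      case False
      then have 2: "2 * p \<le> nverts I" by (simp add: n_def)
      interpret gadget n K p "edge_list I" "(!) (bounds I)"
        unfolding n_def K_def by (rule gadget_of_instance[OF I 2])
      have N: "s ''N'' 0 = gsize" by (simp add: sz gsize_def dummy_offset_def)
      have "graph_in gsize s = {}" unfolding graph_in_def sz by (simp add: init_state_def)
      moreover have "s ''input'' (5 + n + i) = bounds I ! i" if "i < K" for i
        unfolding sz using inp[of "5 + n + i"] encode_bounds[of i I] that by (simp add: L n_def K_def)
      moreover have "(s ''input'' (5 + n + K + 3 * j), s ''input'' (5 + n + K + 3 * j + 1),
          s ''input'' (5 + n + K + 3 * j + 2)) = edge_list I ! j" if "j < length (edge_list I)" for j
        unfolding sz using inp[of "5 + n + K + 3 * j"] inp[of "5 + n + K + 3 * j + 1"] inp[of "5 + n + K + 3 * j + 2"]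
          encode_edges[OF that] that by (simp add: L n_def K_def)
      moreover have "gsize \<le> s ''B'' 0" "n \<le> s ''B'' 0" "length (edge_list I) \<le> s ''B'' 0" "K \<le> s ''B'' 0"
        "n - 2 * p \<le> s ''B'' 0" using N sz(8) L by auto
      ultimately have bd: "env gsize (runB build_prog s)"
        "graph_in gsize (runB build_prog s) = sym_hull all_edges"
        using build_prog[of s] N sz(1-3,6) by blast+
      have "runB main_prog s = runB match_prog (runB build_prog s)"
        using p False by (simp add: main_prog_def sz)
      then have "accepting (runB main_prog s) \<longleftrightarrow> (\<exists>X P Q. slots X P Q)"
        using build_match[OF bd] by (simp add: accepting_def)
      also have "\<dots> \<longleftrightarrow> grm_yes I"
        using grm_yes_iff_slots[OF I 2 p(1)] by (simp add: n_def K_def)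
      finally show ?thesis .
    qed
  qed
qed

theorem theorem4:
  shows "poly_time_decidable_on encode
           {I \<in> grm_instances. strictly_CM_colored (graph_of I)} grm_yes"
  unfolding poly_time_decidable_on_def
proof (rule exI[of _ "Seq (compile ''length'' size_prog) (compile ''B'' main_prog)"],
    rule exI[of _ "cost size_prog + pcompose (cost main_prog) [:0, 3, 2, 2:]"], rule ballI)
  let ?q = "cost size_prog + pcompose (cost main_prog) [:0, 3, 2, 2:]"
  fix I assume "I \<in> {I \<in> grm_instances. strictly_CM_colored (graph_of I)}"
  then have I: "I \<in> grm_instances" "strictly_CM_colored (graph_of I)" by auto
  let ?s = "init_state (encode I)"
  define s1 where "s1 = run ''length'' size_prog ?s"
  obtain t where t: "exec (compile ''length'' size_prog) ?s t s1" "t \<le> poly (cost size_prog) (?s ''length'' 0)"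
    using exec_compile[OF wf_size_prog] unfolding s1_def by blast
  obtain u where u: "exec (compile ''B'' main_prog) s1 u (runB main_prog s1)" "u \<le> poly (cost main_prog) (s1 ''B'' 0)"
    using exec_compile[OF wf_main_prog] by blast
  \<comment> \<open>The second program is charged with the value of \<open>B\<close>, itself
    polynomial in the number of words. Polynomials with natural coefficients are monotone, so this
    bound may be inserted.\<close>
  have "t + u \<le> poly ?q (length (encode I))"
    using t(2) u(2) poly_nat_mono[OF main_prog_correct(2)[OF I], of "cost main_prog"]
    unfolding s1_def by (simp add: poly_pcompose init_state_def del: poly_pCons)
  also have "\<dots> \<le> poly ?q (input_size (encode I))" by (rule poly_nat_mono[OF length_le_input_size])
  finally show "\<exists>t s. exec (Seq (compile ''length'' size_prog) (compile ''B'' main_prog)) ?s t s \<and>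
      t \<le> poly ?q (input_size (encode I)) \<and> (accepting s \<longleftrightarrow> grm_yes I)"
    using exec_Seq[OF t(1) u(1)] main_prog_correct(1)[OF I] unfolding s1_def by blast
qed

end
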